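(* Let $(S,h)$ be a general polarized K3 surface with $\mathrm{Pic}(S)=\mathbb{Z}h$, $h^2=2d>0$, and let $S_{2d}$ be a specialization of $S$ with $\mathrm{Pic}(S_{2d})=\mathbb{Z}h\oplus\mathbb{Z}k$ of rank two, where $k$ is primitive in $H^2(S_{2d},\mathbb{Z})$, with intersection matrix $$\begin{pmatrix} h^2 & h k \\ h k & k^2 \end{pmatrix}=\begin{pmatrix} 2d & b \\ b & 2c \end{pmatrix},\qquad b,c\in\mathbb{Z}.$$ Let $\alpha_{van}\in\mathrm{Br}(S)_2$ be the vanishing Brauer class of this specialization. Then the invariants of $\alpha_{van}$ are $$B_{van}h\equiv\tfrac12 b \mod\mathbb{Z},\qquad B_{van}^2\equiv\tfrac12 c\mod\mathbb{Z},$$ where $B_{van}$ is any B-field representing $\alpha_{van}$, and where the second quantity is an invariant (and the second congruence is asserted) only in the case that $4B_{van}h+h^2\equiv 0\mod 4$. In particular, $2B_{van}h\equiv\operatorname{disc}(\mathrm{Pic}(S_{2d}))\mod 2$.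
   Context: K3 surfaces are complex projective. $\mathrm{Br}(S)=H^2(S,\mathcal{O}_S^* )_{tors}$, with two-torsion subgroup $\mathrm{Br}(S)_2$. The exponential sequence gives $0\to H^2(S,\mathbb{Z})/\mathrm{Pic}(S)\to H^2(S,\mathcal{O}_S)\to H^2(S,\mathcal{O}_S^* )\to0$. A B-field representing $\alpha\in\mathrm{Br}(S)_2$ is a class $B\in\frac12H^2(S,\mathbb{Z})\subset H^2(S,\mathbb{Q})$ whose image in $H^2(S,\mathcal{O}_S)$ maps to $\alpha$; it is unique up to $\frac12\mathrm{Pic}(S)+H^2(S,\mathbb{Z})$. With $T(S)=\mathrm{Pic}(S)^\perp\subset H^2(S,\mathbb{Z})$, the class $\alpha$ is identified with the homomorphism $T(S)\to\frac12\mathbb{Z}/\mathbb{Z}\cong\mathbb{Z}/2\mathbb{Z}$, $x\mapsto x\cdot B \bmod\mathbb{Z}$. When $\mathrm{Pic}(S)=\mathbb{Z}h$, the invariants of $\alpha$ are $Bh \bmod\mathbb{Z}$ and, only in the case that $4Bh+h^2\equiv0\bmod 4$, $B^2\bmod\mathbb{Z}$. A specialization of $(S,h)$ to $S_{2d}$ is a family of quasi-polarized K3 surfaces over a complex disc with fibre $S_{2d}$ over $0$ and fibre $S$ over some non-zero point. It identifies $H^2(S,\mathbb{Z})=H^2(S_{2d},\mathbb{Z})$, with $\mathrm{Pic}(S)\subset\mathrm{Pic}(S_{2d})$ and $T(S)\supset T(S_{2d})$. Restricting homomorphisms to $T(S_{2d})$ gives a map $\mathrm{Br}(S)_2\to\mathrm{Br}(S_{2d})_2$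 with kernel of order two; the vanishing Brauer class $\alpha_{van}$ is the generator of this kernel. $\operatorname{disc}$ of a lattice is the determinant of a Gram matrix. *)

theory Defs
  imports
    "HOL-Analysis.Analysis"
    "HOL-Algebra.Coset"
    "HOL-Algebra.FiniteProduct"
    "Jordan_Normal_Form.Determinant"
begin

section \<open>Sheaf cohomology\<close>

text \<open>
  Cohomology of a sheaf \<open>F\<close> of \<open>G\<close>-valued functions (\<open>G\<close> an abelian group) on a space \<open>X\<close>, as the
  Cech cohomology obtained by passing to the direct limit over all open covers; on the paracompact
  Hausdorff spaces used below this is sheaf cohomology.

  It suffices to use covers \<open>(U x)\<close> indexed by the points of the space, with \<open>x \<in> U x\<close>: they are
  cofinal among all open covers.  A \<open>q\<close>-cochain of the limit complex is represented by a total
  function \<open>c\<close>, where \<open>c [x0, \<dots>, xq] p\<close> is the value at \<open>p\<close> of the component on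
  \<open>U x0 \<inter> \<dots> \<inter> U xq\<close>; it has to be a section there for some cover \<open>U\<close>, and two representatives are
  identified when they agree for some cover (see \<open>agree\<close>).  All values outside the intersections of
  some cover, and all values on lists of length different from \<open>q + 1\<close>, are irrelevant.
  A sheaf is given by its sections: \<open>f \<in> F W\<close> means that \<open>f\<close> restricted to \<open>W\<close> is a section over
  \<open>W\<close>, the values of \<open>f\<close> outside \<open>W\<close> being irrelevant.
\<close>

type_synonym ('p, 'v) cochain = "'p list \<Rightarrow> 'p \<Rightarrow> 'v"

type_synonym ('p, 'v) sheaf = "'p set \<Rightarrow> ('p \<Rightarrow> 'v) set"

definition point_covers :: "'p topology \<Rightarrow> ('p \<Rightarrow> 'p set) set" where
  "point_covers X = {U. \<forall>x\<in>topspace X. openin X (U x) \<and> x \<in> U x}"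

definition overlap :: "('p \<Rightarrow> 'p set) \<Rightarrow> 'p list \<Rightarrow> 'p set" where
  "overlap U xs = (\<Inter>x\<in>set xs. U x)"

definition simplices :: "'p topology \<Rightarrow> nat \<Rightarrow> 'p list set" where
  "simplices X q = {xs. set xs \<subseteq> topspace X \<and> length xs = Suc q}"

definition cochain_group :: "('v, 'b) monoid_scheme \<Rightarrow> ('p, 'v) cochain monoid" where
  "cochain_group G =
     \<lparr>carrier = {c. \<forall>xs p. c xs p \<in> carrier G},
      mult = (\<lambda>c d xs p. c xs p \<otimes>\<^bsub>G\<^esub> d xs p),
      one = (\<lambda>xs p. \<one>\<^bsub>G\<^esub>)\<rparr>"

definition agree :: "'p topology \<Rightarrow> nat \<Rightarrow> ('p, 'v) cochain \<Rightarrow> ('p, 'v) cochain \<Rightarrow> bool" where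
  "agree X q c d \<longleftrightarrow>
     (\<exists>W\<in>point_covers X. \<forall>xs\<in>simplices X q. \<forall>p\<in>overlap W xs. c xs p = d xs p)"

definition cochains ::
  "'p topology \<Rightarrow> ('v, 'b) monoid_scheme \<Rightarrow> ('p, 'v) sheaf \<Rightarrow> nat \<Rightarrow> ('p, 'v) cochain set" where
  "cochains X G F q =
     {c \<in> carrier (cochain_group G).
        \<exists>U\<in>point_covers X. \<forall>xs\<in>simplices X q. c xs \<in> F (overlap U xs)}"

definition coboundary :: "('v, 'b) monoid_scheme \<Rightarrow> ('p, 'v) cochain \<Rightarrow> ('p, 'v) cochain" where
  "coboundary G c = (\<lambda>xs p.
     finprod G (\<lambda>i. c (take i xs @ drop (Suc i) xs) p [^]\<^bsub>G\<^esub> ((- 1) ^ i :: int)) {..<length xs})"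

definition cocycles ::
  "'p topology \<Rightarrow> ('v, 'b) monoid_scheme \<Rightarrow> ('p, 'v) sheaf \<Rightarrow> nat \<Rightarrow> ('p, 'v) cochain set" where
  "cocycles X G F q =
     {c \<in> cochains X G F q. agree X (Suc q) (coboundary G c) \<one>\<^bsub>cochain_group G\<^esub>}"

definition coboundaries ::
  "'p topology \<Rightarrow> ('v, 'b) monoid_scheme \<Rightarrow> ('p, 'v) sheaf \<Rightarrow> nat \<Rightarrow> ('p, 'v) cochain set" where
  "coboundaries X G F q =
     {c \<in> cochains X G F q.
        case q of
          0 \<Rightarrow> agree X q c \<one>\<^bsub>cochain_group G\<^esub>
        | Suc r \<Rightarrow> \<exists>e\<in>cochains X G F r. agree X q c (coboundary G e)}"

definition cohomology ::
  "'p topology \<Rightarrow> ('v, 'b) monoid_scheme \<Rightarrow> ('p, 'v) sheaf \<Rightarrow> nat \<Rightarrow> ('p, 'v) cochain set monoid" where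
  "cohomology X G F q =
     (cochain_group G)\<lparr>carrier := cocycles X G F q\<rparr> Mod coboundaries X G F q"

definition coh_class ::
  "'p topology \<Rightarrow> ('v, 'b) monoid_scheme \<Rightarrow> ('p, 'v) sheaf \<Rightarrow> nat \<Rightarrow> ('p, 'v) cochain
    \<Rightarrow> ('p, 'v) cochain set" where
  "coh_class X G F q c = coboundaries X G F q #>\<^bsub>cochain_group G\<^esub> c"

text \<open>
  The class in \<open>cohomology X G F q\<close> induced from the class \<open>A\<close> by an operation \<open>f\<close> on cochains.
  In all uses \<open>f\<close> respects cocycles and coboundaries, so that the union is over equal sets.
\<close>

definition induced ::
  "'p topology \<Rightarrow> ('v, 'b) monoid_scheme \<Rightarrow> ('p, 'v) sheaf \<Rightarrow> nat
    \<Rightarrow> (('q, 'w) cochain \<Rightarrow> ('p, 'v) cochain) \<Rightarrow> ('q, 'w) cochain set \<Rightarrow> ('p, 'v) cochain set" where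
  "induced X G F q f A = (\<Union>a\<in>A. coh_class X G F q (f a))"

definition pull_cochain :: "('p \<Rightarrow> 'q) \<Rightarrow> ('q, 'v) cochain \<Rightarrow> ('p, 'v) cochain" where
  "pull_cochain f c = (\<lambda>xs p. c (map f xs) (f p))"

definition additive_group :: "'a::ab_group_add monoid" where
  "additive_group = \<lparr>carrier = UNIV, mult = (+), one = 0\<rparr>"

definition unit_group :: "'a::field monoid" where
  "unit_group = \<lparr>carrier = - {0}, mult = (*), one = 1\<rparr>"

definition locally_constant :: "'p topology \<Rightarrow> 'v set \<Rightarrow> ('p, 'v) sheaf" where
  "locally_constant X A W =
     {f. \<forall>p\<in>W. f p \<in> A \<and> (\<exists>V. openin X V \<and> p \<in> V \<and> (\<forall>q\<in>V \<inter> W. f q = f p))}"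


section \<open>Complex manifolds\<close>

text \<open>A complex manifold is a topological space with the sheaf of holomorphic functions on it.\<close>

record 'p cspace =
  topol :: "'p topology"
  hol :: "('p, complex) sheaf"

type_synonym 'p cclass = "('p, complex) cochain set"

definition holo_on :: "(complex ^ 'n \<Rightarrow> complex) \<Rightarrow> (complex ^ 'n) set \<Rightarrow> bool" where
  "holo_on f V \<longleftrightarrow>
     (\<forall>z\<in>V. \<exists>D. (f has_derivative D) (at z) \<and> (\<forall>a v. D (a *s v) = a * D v))"

definition cchart :: "'p cspace \<Rightarrow> 'p set \<Rightarrow> ('p \<Rightarrow> complex ^ 'n) \<Rightarrow> bool" where
  "cchart S U \<psi> \<longleftrightarrow>
     openin (topol S) U \<and> open (\<psi> ` U) \<and>
     homeomorphic_map (subtopology (topol S) U) (top_of_set (\<psi> ` U)) \<psi> \<and>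
     (\<forall>W f. openin (topol S) W \<and> W \<subseteq> U \<longrightarrow>
        (f \<in> hol S W \<longleftrightarrow> holo_on (f \<circ> inv_into U \<psi>) (\<psi> ` W)))"

definition complex_manifold :: "'n::finite itself \<Rightarrow> 'p cspace \<Rightarrow> bool" where
  "complex_manifold n S \<longleftrightarrow>
     Hausdorff_space (topol S) \<and>
     (\<exists>\<B>. countable \<B> \<and> (\<forall>B\<in>\<B>. openin (topol S) B) \<and>
        (\<forall>U p. openin (topol S) U \<and> p \<in> U \<longrightarrow> (\<exists>B\<in>\<B>. p \<in> B \<and> B \<subseteq> U))) \<and>
     (\<forall>W f. openin (topol S) W \<longrightarrow>
        (f \<in> hol S W \<longleftrightarrow>
          (\<forall>p\<in>W. \<exists>V. openin (topol S) V \<and> p \<in> V \<and> V \<subseteq> W \<and> f \<in> hol S V))) \<and>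
     (\<forall>p\<in>topspace (topol S). \<exists>U (\<psi> :: 'p \<Rightarrow> complex ^ 'n). p \<in> U \<and> cchart S U \<psi>)"

definition hol_units :: "'p cspace \<Rightarrow> ('p, complex) sheaf" where
  "hol_units S W = {f \<in> hol S W. \<forall>p\<in>W. f p \<noteq> 0}"

text \<open>Cohomology with coefficients in the sheaves Z, Q, O and O*; they all have complex values.\<close>

definition HZ :: "'p cspace \<Rightarrow> nat \<Rightarrow> 'p cclass monoid" where
  "HZ S q = cohomology (topol S) additive_group (locally_constant (topol S) \<int>) q"

definition HQ :: "'p cspace \<Rightarrow> nat \<Rightarrow> 'p cclass monoid" where
  "HQ S q = cohomology (topol S) additive_group (locally_constant (topol S) \<rat>) q"

definition HO :: "'p cspace \<Rightarrow> nat \<Rightarrow> 'p cclass monoid" where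
  "HO S q = cohomology (topol S) additive_group (hol S) q"

definition HU :: "'p cspace \<Rightarrow> nat \<Rightarrow> 'p cclass monoid" where
  "HU S q = cohomology (topol S) unit_group (hol_units S) q"

text \<open>Maps on cohomology: Z to Q, Q to O, and the exponential map from O to O*.\<close>

definition Z_to_Q :: "'p cspace \<Rightarrow> nat \<Rightarrow> 'p cclass \<Rightarrow> 'p cclass" where
  "Z_to_Q S q = induced (topol S) additive_group (locally_constant (topol S) \<rat>) q id"

definition Q_to_O :: "'p cspace \<Rightarrow> nat \<Rightarrow> 'p cclass \<Rightarrow> 'p cclass" where
  "Q_to_O S q = induced (topol S) additive_group (hol S) q id"

definition exp_cochain :: "('p, complex) cochain \<Rightarrow> ('p, complex) cochain" where
  "exp_cochain c = (\<lambda>xs p. exp (2 * of_real pi * \<i> * c xs p))"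

definition O_to_U :: "'p cspace \<Rightarrow> nat \<Rightarrow> 'p cclass \<Rightarrow> 'p cclass" where
  "O_to_U S q = induced (topol S) unit_group (hol_units S) q exp_cochain"

text \<open>Pullback of integral classes on the target along a continuous map out of \<open>S\<close>.\<close>

definition pull_Z :: "'p cspace \<Rightarrow> nat \<Rightarrow> ('p \<Rightarrow> 'p) \<Rightarrow> 'p cclass \<Rightarrow> 'p cclass" where
  "pull_Z S q f =
     induced (topol S) additive_group (locally_constant (topol S) \<int>) q (pull_cochain f)"

definition cup :: "'p cspace \<Rightarrow> 'p cclass \<Rightarrow> 'p cclass \<Rightarrow> 'p cclass" where
  "cup S A B =
     (\<Union>a\<in>A. \<Union>b\<in>B. coh_class (topol S) additive_group (locally_constant (topol S) \<rat>) 4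
        (\<lambda>xs p. a (take 3 xs) p * b (drop 2 xs) p))"


section \<open>Line bundles\<close>

text \<open>
  Line bundles are elements of \<open>HU S 1\<close>, the first cohomology of O*.  The first Chern class is the
  connecting map of the exponential sequence: lift the transition functions to logarithms \<open>l\<close>
  (divided by \<open>2 \<pi> i\<close>) and take the coboundary.  The other usual sign convention changes all Chern
  classes by a sign, which affects nothing below.
\<close>

definition chern_class :: "'p cspace \<Rightarrow> 'p cclass \<Rightarrow> 'p cclass \<Rightarrow> bool" where
  "chern_class S L c \<longleftrightarrow>
     L \<in> carrier (HU S 1) \<and> c \<in> carrier (HZ S 2) \<and>
     (\<exists>l\<in>cochains (topol S) additive_group (hol S) 1.
        exp_cochain l \<in> L \<and> coboundary additive_group l \<in> c)"

definition Pic :: "'p cspace \<Rightarrow> 'p cclass set" where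
  "Pic S = {c. \<exists>L. chern_class S L c}"

definition transition_functions ::
  "'p cspace \<Rightarrow> ('p \<Rightarrow> 'p set) \<Rightarrow> ('p, complex) cochain \<Rightarrow> bool" where
  "transition_functions S U g \<longleftrightarrow>
     U \<in> point_covers (topol S) \<and>
     (\<forall>x\<in>topspace (topol S). \<forall>y\<in>topspace (topol S). g [x, y] \<in> hol_units S (U x \<inter> U y)) \<and>
     (\<forall>x\<in>topspace (topol S). \<forall>y\<in>topspace (topol S). \<forall>z\<in>topspace (topol S).
        \<forall>p\<in>U x \<inter> U y \<inter> U z. g [x, y] p * g [y, z] p = g [x, z] p)"

definition global_section ::
  "'p cspace \<Rightarrow> ('p \<Rightarrow> 'p set) \<Rightarrow> ('p, complex) cochain \<Rightarrow> ('p \<Rightarrow> 'p \<Rightarrow> complex) \<Rightarrow> bool" where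
  "global_section S U g s \<longleftrightarrow>
     (\<forall>x\<in>topspace (topol S). s x \<in> hol S (U x)) \<and>
     (\<forall>x\<in>topspace (topol S). \<forall>y\<in>topspace (topol S).
        \<forall>p\<in>U x \<inter> U y. s x p = g [x, y] p * s y p)"

definition effective :: "'p cspace \<Rightarrow> 'p cclass \<Rightarrow> bool" where
  "effective S M \<longleftrightarrow>
     M \<in> carrier (HU S 1) \<and>
     (\<exists>g\<in>M. \<exists>U s. transition_functions S U g \<and> global_section S U g s \<and>
        (\<exists>x\<in>topspace (topol S). s x x \<noteq> 0))"

text \<open>
  A line bundle on a compact complex surface is very ample if finitely many global sections
  \<open>s 0, \<dots>, s N\<close> define a closed embedding into projective space: they have no common zero, and the
  resulting map is injective and immersive.
\<close>

definition very_ample :: "'p cspace \<Rightarrow> 'p cclass \<Rightarrow> bool" where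
  "very_ample S M \<longleftrightarrow>
     M \<in> carrier (HU S 1) \<and>
     (\<exists>g\<in>M. \<exists>U (N::nat) s.
        transition_functions S U g \<and> (\<forall>i\<le>N. global_section S U g (s i)) \<and>
        (\<forall>p\<in>topspace (topol S). \<exists>i\<le>N. s i p p \<noteq> 0) \<and>
        (\<forall>p\<in>topspace (topol S). \<forall>q\<in>topspace (topol S). p \<noteq> q \<longrightarrow>
           (\<exists>i\<le>N. \<exists>j\<le>N. s i p p * s j q q \<noteq> s j p p * s i q q)) \<and>
        (\<forall>p V (\<psi> :: 'p \<Rightarrow> complex ^ 2) v D.
           cchart S V \<psi> \<and> p \<in> V \<and> v \<noteq> 0 \<and>
           (\<forall>i\<le>N. (s i p \<circ> inv_into V \<psi> has_derivative D i) (at (\<psi> p))) \<longrightarrow>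
           \<not> (\<exists>\<mu>. \<forall>i\<le>N. D i v = \<mu> * s i p p)))"

definition ample :: "'p cspace \<Rightarrow> 'p cclass \<Rightarrow> bool" where
  "ample S L \<longleftrightarrow> L \<in> carrier (HU S 1) \<and> (\<exists>m::nat>0. very_ample S (L [^]\<^bsub>HU S 1\<^esub> m))"


section \<open>K3 surfaces\<close>

text \<open>
  Triviality of the canonical bundle: there is a nowhere vanishing holomorphic 2-form, given in a
  chart \<open>(z, w)\<close> on \<open>U\<close> as \<open>\<omega> U \<psi> dz \<and> dw\<close>.
\<close>

definition trivial_canonical_bundle :: "'p cspace \<Rightarrow> bool" where
  "trivial_canonical_bundle S \<longleftrightarrow>
     (\<exists>\<omega>. (\<forall>U (\<psi> :: 'p \<Rightarrow> complex ^ 2). cchart S U \<psi> \<longrightarrow> \<omega> U \<psi> \<in> hol_units S U) \<and>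
          (\<forall>U (\<psi> :: 'p \<Rightarrow> complex ^ 2) V (\<psi>' :: 'p \<Rightarrow> complex ^ 2) p D.
             cchart S U \<psi> \<and> cchart S V \<psi>' \<and> p \<in> U \<inter> V \<and>
             (\<psi>' \<circ> inv_into U \<psi> has_derivative D) (at (\<psi> p)) \<longrightarrow>
             \<omega> U \<psi> p = \<omega> V \<psi>' p * Determinants.det (matrix D)))"

definition K3_surface :: "'p cspace \<Rightarrow> bool" where
  "K3_surface S \<longleftrightarrow>
     complex_manifold TYPE(2) S \<and> topspace (topol S) \<noteq> {} \<and>
     compact_space (topol S) \<and> connected_space (topol S) \<and>
     trivial_canonical_bundle S \<and>
     carrier (HO S 1) = {\<one>\<^bsub>HO S 1\<^esub>} \<and>
     (\<exists>L. ample S L)"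

text \<open>
  The degree map \<open>H\<^sup>4(S, \<rat>) \<rightarrow> \<rat>\<close>, which restricts to an isomorphism \<open>H\<^sup>4(S, \<int>) \<cong> \<int>\<close>.  The
  isomorphism is unique up to sign; the one given by the complex orientation is the one for which
  ample classes have positive square.
\<close>

definition degree_map :: "'p cspace \<Rightarrow> ('p cclass \<Rightarrow> rat) \<Rightarrow> bool" where
  "degree_map S D \<longleftrightarrow>
     D \<in> hom (HQ S 4) additive_group \<and>
     bij_betw (D \<circ> Z_to_Q S 4) (carrier (HZ S 4)) \<int> \<and>
     (\<forall>L c. ample S L \<and> chern_class S L c \<longrightarrow> D (cup S (Z_to_Q S 2 c) (Z_to_Q S 2 c)) > 0)"

text \<open>The intersection form on \<open>H\<^sup>2(S, \<rat>)\<close> and on \<open>H\<^sup>2(S, \<int>)\<close>.\<close>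

definition inter_Q :: "'p cspace \<Rightarrow> ('p cclass \<Rightarrow> rat) \<Rightarrow> 'p cclass \<Rightarrow> 'p cclass \<Rightarrow> rat" where
  "inter_Q S D A B = D (cup S A B)"

definition inter_Z :: "'p cspace \<Rightarrow> ('p cclass \<Rightarrow> rat) \<Rightarrow> 'p cclass \<Rightarrow> 'p cclass \<Rightarrow> rat" where
  "inter_Z S D x y = inter_Q S D (Z_to_Q S 2 x) (Z_to_Q S 2 y)"

definition polarization :: "'p cspace \<Rightarrow> 'p cclass \<Rightarrow> bool" where
  "polarization S h \<longleftrightarrow> (\<exists>L. ample S L \<and> chern_class S L h)"

text \<open>
  Big and nef line bundles.  Curves are effective divisors, and conversely, so nefness may be tested
  on the line bundles that have a nonzero section; a nef line bundle is big iff its square is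
  positive.
\<close>

definition quasi_polarization :: "'p cspace \<Rightarrow> 'p cclass \<Rightarrow> bool" where
  "quasi_polarization S L \<longleftrightarrow>
     (\<exists>D c. degree_map S D \<and> chern_class S L c \<and> inter_Z S D c c > 0 \<and>
        (\<forall>M m. effective S M \<and> chern_class S M m \<longrightarrow> inter_Z S D c m \<ge> 0))"


section \<open>Brauer classes and B-fields\<close>

definition Br :: "'p cspace \<Rightarrow> 'p cclass set" where
  "Br S = {\<alpha> \<in> carrier (HU S 2). \<exists>n::nat>0. \<alpha> [^]\<^bsub>HU S 2\<^esub> n = \<one>\<^bsub>HU S 2\<^esub>}"

definition Br2 :: "'p cspace \<Rightarrow> 'p cclass set" where
  "Br2 S = {\<alpha> \<in> Br S. \<alpha> [^]\<^bsub>HU S 2\<^esub> (2::nat) = \<one>\<^bsub>HU S 2\<^esub>}"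

definition B_field :: "'p cspace \<Rightarrow> 'p cclass \<Rightarrow> 'p cclass \<Rightarrow> bool" where
  "B_field S \<alpha> B \<longleftrightarrow>
     B \<in> carrier (HQ S 2) \<and> B [^]\<^bsub>HQ S 2\<^esub> (2::nat) \<in> Z_to_Q S 2 ` carrier (HZ S 2) \<and>
     O_to_U S 2 (Q_to_O S 2 B) = \<alpha>"

definition transcendental_lattice :: "'p cspace \<Rightarrow> ('p cclass \<Rightarrow> rat) \<Rightarrow> 'p cclass set" where
  "transcendental_lattice S D = {x \<in> carrier (HZ S 2). \<forall>y\<in>Pic S. inter_Z S D x y = 0}"

text \<open>
  The homomorphism \<open>T(S) \<rightarrow> (1/2)\<int>/\<int>\<close>, \<open>x \<mapsto> x \<cdot> B mod \<int>\<close>, attached to a 2-torsion Brauer class; it does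
  not depend on the chosen B-field.  Elements of \<open>\<rat>/\<int>\<close> are represented by their fractional part.
\<close>

definition Brauer_hom ::
  "'p cspace \<Rightarrow> ('p cclass \<Rightarrow> rat) \<Rightarrow> 'p cclass \<Rightarrow> 'p cclass \<Rightarrow> rat" where
  "Brauer_hom S D \<alpha> = (\<lambda>x. frac (inter_Q S D (Z_to_Q S 2 x) (SOME B. B_field S \<alpha> B)))"


section \<open>Specializations\<close>

text \<open>Fibres, with the functions that are locally restrictions of holomorphic functions.\<close>

definition fibre :: "'p cspace \<Rightarrow> ('p \<Rightarrow> complex) \<Rightarrow> complex \<Rightarrow> 'p cspace" where
  "fibre X \<pi> s =
     \<lparr>topol = subtopology (topol X) {x. \<pi> x = s},
      hol = (\<lambda>W. {f. \<forall>p\<in>W. \<exists>V g. openin (topol X) V \<and> p \<in> V \<and> g \<in> hol X V \<and>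
                        (\<forall>q\<in>V \<inter> W. f q = g q)})\<rparr>"

definition restrict_bundle :: "'p cspace \<Rightarrow> 'p cclass \<Rightarrow> 'p cclass" where
  "restrict_bundle Y L = induced (topol Y) unit_group (hol_units Y) 1 id L"

text \<open>
  A family of quasi-polarized K3 surfaces over the disc of radius \<open>r\<close>: a proper holomorphic submersion
  \<open>\<pi>\<close> from a complex threefold with K3 surfaces as fibres, and a line bundle \<open>L\<close> on the total space
  that is a quasi-polarization on each fibre.
\<close>

definition quasi_polarized_family ::
  "'p cspace \<Rightarrow> ('p \<Rightarrow> complex) \<Rightarrow> real \<Rightarrow> 'p cclass \<Rightarrow> bool" where
  "quasi_polarized_family X \<pi> r L \<longleftrightarrow>
     0 < r \<and> complex_manifold TYPE(3) X \<and>
     \<pi> ` topspace (topol X) = ball 0 r \<and>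
     proper_map (topol X) (top_of_set (ball 0 r)) \<pi> \<and>
     \<pi> \<in> hol X (topspace (topol X)) \<and>
     (\<forall>U (\<psi> :: 'p \<Rightarrow> complex ^ 3) p D.
        cchart X U \<psi> \<and> p \<in> U \<and> (\<pi> \<circ> inv_into U \<psi> has_derivative D) (at (\<psi> p)) \<longrightarrow> surj D) \<and>
     L \<in> carrier (HU X 1) \<and>
     (\<forall>s\<in>ball 0 r. K3_surface (fibre X \<pi> s) \<and>
        quasi_polarization (fibre X \<pi> s) (restrict_bundle (fibre X \<pi> s) L))"

text \<open>
  A topological trivialization over the disc.  One always exists (Ehresmann), and any two of them
  induce the same identifications of the cohomology of the fibres with that of the central fibre.
\<close>

definition trivialization ::
  "'p cspace \<Rightarrow> ('p \<Rightarrow> complex) \<Rightarrow> real \<Rightarrow> ('p \<times> complex \<Rightarrow> 'p) \<Rightarrow> bool" where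
  "trivialization X \<pi> r \<Phi> \<longleftrightarrow>
     homeomorphic_map (prod_topology (topol (fibre X \<pi> 0)) (top_of_set (ball 0 r))) (topol X) \<Phi> \<and>
     (\<forall>y\<in>topspace (topol (fibre X \<pi> 0)). \<Phi> (y, 0) = y \<and> (\<forall>s\<in>ball 0 r. \<pi> (\<Phi> (y, s)) = s))"

text \<open>
  \<open>S0\<close> is a specialization of \<open>(S, h)\<close>; \<open>\<phi>\<close> is the homeomorphism from \<open>S0\<close> to \<open>S\<close> of a
  trivialization, and \<open>H\<^sup>2(S, \<int>)\<close> is identified with \<open>H\<^sup>2(S0, \<int>)\<close> through \<open>pull_Z S0 2 \<phi>\<close>.
\<close>

definition specialization ::
  "'p cspace \<Rightarrow> 'p cclass \<Rightarrow> 'p cspace \<Rightarrow> ('p \<Rightarrow> 'p) \<Rightarrow> bool" where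
  "specialization S h S0 \<phi> \<longleftrightarrow>
     (\<exists>X \<pi> r L \<Phi> t.
        quasi_polarized_family X \<pi> r L \<and> trivialization X \<pi> r \<Phi> \<and>
        t \<in> ball 0 r \<and> t \<noteq> 0 \<and>
        S0 = fibre X \<pi> 0 \<and> S = fibre X \<pi> t \<and> chern_class S (restrict_bundle S L) h \<and>
        \<phi> = (\<lambda>y. \<Phi> (y, t)))"

text \<open>
  The kernel of \<open>Br(S)\<^sub>2 \<rightarrow> Br(S0)\<^sub>2\<close>, the restriction of homomorphisms to \<open>T(S0) \<subseteq> T(S)\<close>.
\<close>

definition specialization_kernel ::
  "'p cspace \<Rightarrow> ('p cclass \<Rightarrow> rat) \<Rightarrow> 'p cspace \<Rightarrow> ('p cclass \<Rightarrow> rat) \<Rightarrow> ('p \<Rightarrow> 'p) \<Rightarrow> 'p cclass set"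
  where
  "specialization_kernel S D S0 D0 \<phi> =
     {\<alpha> \<in> Br2 S. \<forall>x\<in>transcendental_lattice S D.
        pull_Z S0 2 \<phi> x \<in> transcendental_lattice S0 D0 \<longrightarrow> Brauer_hom S D \<alpha> x = 0}"

definition vanishing_Brauer_class ::
  "'p cspace \<Rightarrow> ('p cclass \<Rightarrow> rat) \<Rightarrow> 'p cspace \<Rightarrow> ('p cclass \<Rightarrow> rat) \<Rightarrow> ('p \<Rightarrow> 'p) \<Rightarrow> 'p cclass \<Rightarrow> bool"
  where
  "vanishing_Brauer_class S D S0 D0 \<phi> \<alpha> \<longleftrightarrow>
     card (specialization_kernel S D S0 D0 \<phi>) = 2 \<and>
     \<alpha> \<in> specialization_kernel S D S0 D0 \<phi> \<and> \<alpha> \<noteq> \<one>\<^bsub>HU S 2\<^esub>"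


section \<open>Lattices and congruences\<close>

definition Z_basis :: "('a, 'm) monoid_scheme \<Rightarrow> 'a set \<Rightarrow> 'a list \<Rightarrow> bool" where
  "Z_basis G P bs \<longleftrightarrow>
     bij_betw (\<lambda>n. finprod G (\<lambda>i. bs ! i [^]\<^bsub>G\<^esub> (n i :: int)) {..<length bs})
       ({..<length bs} \<rightarrow>\<^sub>E UNIV) P"

text \<open>The determinant of a Gram matrix; it does not depend on the basis.\<close>

definition lattice_disc :: "('a, 'm) monoid_scheme \<Rightarrow> 'a set \<Rightarrow> ('a \<Rightarrow> 'a \<Rightarrow> rat) \<Rightarrow> rat" where
  "lattice_disc G P f =
     (THE \<delta>. \<exists>bs. Z_basis G P bs \<and>
        \<delta> = Determinant.det (Matrix.mat (length bs) (length bs) (\<lambda>(i, j). f (bs ! i) (bs ! j))))"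

definition primitive :: "('a, 'm) monoid_scheme \<Rightarrow> 'a \<Rightarrow> bool" where
  "primitive G x \<longleftrightarrow>
     x \<in> carrier G \<and> x \<noteq> \<one>\<^bsub>G\<^esub> \<and> (\<forall>y\<in>carrier G. \<forall>m::nat. x = y [^]\<^bsub>G\<^esub> m \<longrightarrow> m = 1)"

definition rat_cong :: "rat \<Rightarrow> rat \<Rightarrow> rat \<Rightarrow> bool" where
  "rat_cong x y m \<longleftrightarrow> (\<exists>n::int. x - y = m * of_int n)"

end

theory Submission
  imports Defs
begin

text \<open>
  Let \<open>k'\<close> in \<open>H\<^sup>2(S, \<int>)\<close> correspond to \<open>k\<close>, and let \<open>\<alpha>\<close> be the class with B-field \<open>k' / 2\<close>.  Pairing
  with \<open>k\<close> vanishes on \<open>T(S0)\<close>, so \<open>\<alpha>\<close> lies in the kernel.  If \<open>\<alpha>\<close> were trivial, the exponential sequence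
  would give \<open>k' = n h + 2 z\<close> with \<open>z\<close> integral; then \<open>2 z\<close>, and hence \<open>z\<close>, would lie in \<open>Pic S0\<close>, as
  \<open>H\<^sup>2(S0, O)\<close> is torsion-free, contradicting that \<open>h, k\<close> is a basis.  So \<open>\<alpha>\<close> is the vanishing class, as the
  kernel has order two.  By the exponential sequence every B-field \<open>B\<close> of \<open>\<alpha>\<close> satisfies
  \<open>2 B = n h + k' + 2 z\<close>, from which the invariants are read off.
\<close>

section \<open>Cochains on point-indexed covers\<close>

text \<open>Classes with coefficients in Z, Q and O are all represented by complex-valued cochains,
  so a change of coefficients is the identity on representatives and
  \<open>2 B = n h + k' + 2 z\<close> can be paired term by term. This requires the cup product to
  descend to classes and to be commutative in degree 2. Two exactness statements carry the geometry:
  an integral class dies in O iff it is in \<open>Pic\<close>, and a class of O that dies in O* is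
  integral. The second is the delicate one, as logarithms have to be chosen on a single cover. The
  degree maps \<open>D\<close> and \<open>D0\<close> are given independently of each other. They
  match because \<open>h\<close> has the same square \<open>2 d > 0\<close> on both fibres. Squaring
  gives \<open>B^2 = c / 2 + n (n d + b) / 2\<close> up to integers, where \<open>n\<close> is the
  ambiguity of \<open>B\<close> by half of \<open>Pic S\<close>. The middle term is an integer for
  every \<open>n\<close> exactly when \<open>b + d\<close> is even, which is what
  \<open>4 B h + h^2 = 0 mod 4\<close> amounts to. \<open>lattice_disc\<close> is a definite
  description over all basis lists, so the Gram determinant has to be compared for every such list,
  including lists whose entries are not elements of the group.\<close>

lemma (in comm_group) finprod_inv:
  assumes "f \<in> A \<rightarrow> carrier G"
  shows "finprod G (\<lambda>i. inv (f i)) A = inv (finprod G f A)"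
proof (cases "finite A")
  case True
  have cl: "(\<lambda>i. inv (f i)) \<in> A \<rightarrow> carrier G"
    using assms by auto
  have "finprod G (\<lambda>i. inv (f i)) A \<otimes> finprod G f A = finprod G (\<lambda>i. inv (f i) \<otimes> f i) A"
    using assms by (intro finprod_multf [symmetric]) auto
  also have "\<dots> = \<one>"
    using assms by (intro finprod_one_eqI) (auto simp: Pi_iff)
  finally show ?thesis
    using assms cl by (intro inv_equality [symmetric]) auto
qed (use assms in simp)

lemma overlap_Nil [simp]: "overlap U [] = UNIV"
  and overlap_Cons [simp]: "overlap U (x # xs) = U x \<inter> overlap U xs"
  by (auto simp: overlap_def)

lemma point_covers_Int:
  assumes "U \<in> point_covers X" "V \<in> point_covers X"
  shows "(\<lambda>x. U x \<inter> V x) \<in> point_covers X"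
  using assms by (auto simp: point_covers_def)

lemma overlap_Int [simp]: "overlap (\<lambda>x. U x \<inter> V x) xs = overlap U xs \<inter> overlap V xs"
  by (auto simp: overlap_def)

text \<open>Simplices are non-empty lists. The empty list would have overlap \<open>UNIV\<close>,
  which need not be open in \<open>X\<close>.\<close>

lemma openin_overlap:
  assumes "U \<in> point_covers X" "xs \<in> simplices X q"
  shows "openin X (overlap U xs)"
proof -
  have "xs \<noteq> []" using assms by (auto simp: simplices_def)
  then show ?thesis
    unfolding overlap_def using assms
    by (intro openin_Inter) (auto simp: point_covers_def simplices_def)
qed

definition face :: "nat \<Rightarrow> 'a list \<Rightarrow> 'a list" where
  "face i xs = take i xs @ drop (Suc i) xs"

lemma set_face: "set (face i xs) \<subseteq> set xs"
  by (auto simp: face_def dest: in_set_takeD in_set_dropD)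

lemma face_simplices:
  assumes "xs \<in> simplices X (Suc q)" "i < length xs"
  shows "face i xs \<in> simplices X q"
  using assms set_face [of i xs] by (auto simp: simplices_def face_def)

lemma overlap_face: "overlap U xs \<subseteq> overlap U (face i xs)"
  using set_face [of i xs] by (auto simp: overlap_def)

lemma agree_refl [simp]: "agree X q c c"
  by (auto simp: agree_def point_covers_def intro!: exI [of _ "\<lambda>_. topspace X"])

lemma agree_sym: "agree X q c d \<Longrightarrow> agree X q d c"
  by (fastforce simp: agree_def)

lemma agree_trans:
  assumes "agree X q c d" "agree X q d e"
  shows "agree X q c e"
proof -
  obtain U V where U: "U \<in> point_covers X" "\<And>xs p. xs \<in> simplices X q \<Longrightarrow> p \<in> overlap U xs \<Longrightarrow> c xs p = d xs p"
    and V: "V \<in> point_covers X" "\<And>xs p. xs \<in> simplices X q \<Longrightarrow> p \<in> overlap V xs \<Longrightarrow> d xs p = e xs p"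
    using assms by (auto simp: agree_def)
  then show ?thesis
    unfolding agree_def
    by (intro bexI [of _ "\<lambda>x. U x \<inter> V x"]) (auto simp: point_covers_Int)
qed

text \<open>Two agreements hold simultaneously on the intersection of their covers, so any pointwise
  deduction from them is again an agreement. This transports identities that hold only after
  refinement.\<close>

lemma agree_cong2:
  assumes "agree X q c c'" "agree X q d d'"
    and "\<And>xs p. xs \<in> simplices X q \<Longrightarrow> c xs p = c' xs p \<Longrightarrow> d xs p = d' xs p \<Longrightarrow> e xs p = e' xs p"
  shows "agree X q e e'"
proof -
  obtain U V where U: "U \<in> point_covers X" "\<And>xs p. xs \<in> simplices X q \<Longrightarrow> p \<in> overlap U xs \<Longrightarrow> c xs p = c' xs p"
    and V: "V \<in> point_covers X" "\<And>xs p. xs \<in> simplices X q \<Longrightarrow> p \<in> overlap V xs \<Longrightarrow> d xs p = d' xs p"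
    using assms(1,2) by (auto simp: agree_def)
  show ?thesis
    unfolding agree_def using U V assms(3)
    by (intro bexI [of _ "\<lambda>x. U x \<inter> V x"]) (auto simp: point_covers_Int)
qed

lemma agree_cong:
  assumes "agree X q c c'"
    and "\<And>xs p. xs \<in> simplices X q \<Longrightarrow> c xs p = c' xs p \<Longrightarrow> e xs p = e' xs p"
  shows "agree X q e e'"
  using agree_cong2 [OF assms(1) assms(1)] assms(2) by blast

lemma cochain_group_simps [simp]:
  "c \<in> carrier (cochain_group G) \<longleftrightarrow> (\<forall>xs p. c xs p \<in> carrier G)"
  "c \<otimes>\<^bsub>cochain_group G\<^esub> d = (\<lambda>xs p. c xs p \<otimes>\<^bsub>G\<^esub> d xs p)"
  "\<one>\<^bsub>cochain_group G\<^esub> = (\<lambda>xs p. \<one>\<^bsub>G\<^esub>)"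
  by (auto simp: cochain_group_def)

lemma (in comm_group) comm_group_cochain_group: "comm_group (cochain_group G)"
proof (rule comm_groupI)
  fix c assume "c \<in> carrier (cochain_group G)"
  then show "\<exists>d\<in>carrier (cochain_group G). d \<otimes>\<^bsub>cochain_group G\<^esub> c = \<one>\<^bsub>cochain_group G\<^esub>"
    by (intro bexI [of _ "\<lambda>xs p. inv (c xs p)"]) auto
qed (auto simp: m_ac)

lemma (in comm_group) inv_cochain_group:
  assumes "c \<in> carrier (cochain_group G)"
  shows "inv\<^bsub>cochain_group G\<^esub> c = (\<lambda>xs p. inv (c xs p))"
proof -
  interpret C: comm_group "cochain_group G" by (rule comm_group_cochain_group)
  show ?thesis
    using assms by (intro C.inv_equality) auto
qed

text \<open>Evaluation at a fixed list and point is a homomorphism to \<open>G\<close>, and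
  homomorphisms preserve powers.\<close>

lemma (in comm_group) int_pow_cochain_group:
  fixes c :: "('p, 'a) cochain"
  assumes "c \<in> carrier (cochain_group G)"
  shows "c [^]\<^bsub>cochain_group G\<^esub> (n :: int) = (\<lambda>xs p. c xs p [^] n)"
proof (intro ext)
  fix xs :: "'p list" and p :: 'p
  interpret C: comm_group "cochain_group G :: ('p, 'a) cochain monoid" by (rule comm_group_cochain_group)
  interpret group_hom "cochain_group G :: ('p, 'a) cochain monoid" G "\<lambda>c. c xs p"
    by unfold_locales (auto simp: hom_def)
  from hom_int_pow [OF assms]
  show "(c [^]\<^bsub>cochain_group G\<^esub> n) xs p = c xs p [^] n" .
qed

section \<open>Alternating coboundaries with values in an abelian group\<close>

context comm_group
begin

lemma coboundary_Nil [simp]: "coboundary G c [] p = \<one>"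
  by (simp add: coboundary_def)

text \<open>Face 0 drops \<open>x\<close>; face \<open>i + 1\<close> keeps \<open>x\<close> and
  deletes entry \<open>i\<close> of \<open>xs\<close>, with the opposite sign. With this recursion,
  identities between coboundaries go by induction on the list instead of by manipulating alternating
  products.\<close>

lemma coboundary_Cons:
  assumes "\<And>xs p. c xs p \<in> carrier G"
  shows "coboundary G c (x # xs) p = c xs p \<otimes> inv (coboundary G (\<lambda>ys. c (x # ys)) xs p)"
proof -
  define f where "f i = c (take i (x # xs) @ drop (Suc i) (x # xs)) p [^] ((- 1) ^ i :: int)" for i
  define g where "g i = c (x # (take i xs @ drop (Suc i) xs)) p [^] ((- 1) ^ i :: int)" for i
  have fc: "f i \<in> carrier G" and gc: "g i \<in> carrier G" for i
    using assms by (auto simp: f_def g_def)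
  have fg: "f (Suc i) = inv (g i)" for i
    using assms by (simp add: f_def g_def int_pow_neg)
  have "coboundary G c (x # xs) p = finprod G f (insert 0 (Suc ` {..<length xs}))"
    unfolding coboundary_def f_def lessThan_Suc_eq_insert_0 [symmetric] by simp
  also have "\<dots> = f 0 \<otimes> finprod G f (Suc ` {..<length xs})"
    using fc by (subst finprod_insert) auto
  also have "finprod G f (Suc ` {..<length xs}) = finprod G (\<lambda>i. inv (g i)) {..<length xs}"
    using fc by (subst finprod_reindex) (auto simp: fg)
  also have "\<dots> = inv (finprod G g {..<length xs})"
    using gc by (intro finprod_inv) auto
  also have "f 0 = c xs p"
    using assms by (simp add: f_def)
  finally show ?thesis
    by (simp add: coboundary_def g_def)
qed

lemma coboundary_closed:
  assumes "\<And>xs p. c xs p \<in> carrier G"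
  shows "coboundary G c xs p \<in> carrier G"
  unfolding coboundary_def using assms by (intro finprod_closed) auto

lemma coboundary_one [simp]: "coboundary G (\<lambda>xs p. \<one>) = (\<lambda>xs p. \<one>)"
  by (intro ext) (simp add: coboundary_def finprod_one_eqI)

lemma coboundary_mult:
  assumes "\<And>xs p. c xs p \<in> carrier G" "\<And>xs p. d xs p \<in> carrier G"
  shows "coboundary G (\<lambda>xs p. c xs p \<otimes> d xs p) xs p = coboundary G c xs p \<otimes> coboundary G d xs p"
  using assms
proof (induction xs arbitrary: c d)
  case (Cons x xs)
  then show ?case
    by (simp add: coboundary_Cons coboundary_closed inv_mult m_ac)
qed simp

lemma coboundary_inv:
  assumes "\<And>xs p. c xs p \<in> carrier G"
  shows "coboundary G (\<lambda>xs p. inv (c xs p)) xs p = inv (coboundary G c xs p)"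
  using assms
proof (induction xs arbitrary: c)
  case (Cons x xs)
  then show ?case
    by (simp add: coboundary_Cons coboundary_closed inv_mult)
qed simp

text \<open>Put \<open>e ys = c (x # ys)\<close>. By the recursion the coboundary of
  \<open>c\<close> on \<open>x # ys\<close> is that of \<open>c\<close> restricted to tails,
  \<open>c ys\<close>, over the coboundary of \<open>e\<close>. Applying the coboundary again and
  the induction hypothesis to \<open>e\<close> leaves the coboundary of \<open>c\<close> on
  \<open>xs\<close>, which cancels against the first factor; no double product has to be
  reordered.\<close>

lemma coboundary_coboundary:
  assumes "\<And>xs p. c xs p \<in> carrier G"
  shows "coboundary G (coboundary G c) xs p = \<one>"
  using assms
proof (induction xs arbitrary: c)
  case (Cons x xs)
  define e where "e = (\<lambda>ys. c (x # ys))"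
  have c: "\<And>xs p. c xs p \<in> carrier G" and e: "\<And>xs p. e xs p \<in> carrier G"
    using Cons.prems by (auto simp: e_def)
  have eq: "(\<lambda>ys. coboundary G c (x # ys)) = (\<lambda>ys p. c ys p \<otimes> inv (coboundary G e ys p))"
    using c by (intro ext) (simp add: coboundary_Cons e_def)
  have "coboundary G (\<lambda>ys. coboundary G c (x # ys)) xs p
      = coboundary G c xs p \<otimes> inv (coboundary G (coboundary G e) xs p)"
    unfolding eq using c e
    by (simp add: coboundary_mult coboundary_inv coboundary_closed)
  also have "\<dots> = coboundary G c xs p"
    using Cons.IH [of e] c e by (simp add: coboundary_closed)
  finally have "coboundary G (\<lambda>ys. coboundary G c (x # ys)) xs p = coboundary G c xs p" .
  then show ?case
    using c by (simp add: coboundary_Cons coboundary_closed)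
qed simp

lemma coboundary_cong:
  assumes "\<And>i. i < length xs \<Longrightarrow> c (face i xs) p = d (face i xs) p"
    and "\<And>xs p. d xs p \<in> carrier G"
  shows "coboundary G c xs p = coboundary G d xs p"
  unfolding coboundary_def using assms by (intro finprod_cong') (auto simp: face_def)

text \<open>The same cover works, since the overlap of a list is contained in the overlap of each of
  its faces.\<close>

lemma agree_coboundary:
  assumes "agree X q c d" "\<And>xs p. d xs p \<in> carrier G"
  shows "agree X (Suc q) (coboundary G c) (coboundary G d)"
proof -
  obtain U where U: "U \<in> point_covers X" "\<And>xs p. xs \<in> simplices X q \<Longrightarrow> p \<in> overlap U xs \<Longrightarrow> c xs p = d xs p"
    using assms by (auto simp: agree_def)
  show ?thesis
    unfolding agree_def
  proof (intro bexI [OF _ U(1)] ballI)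
    fix xs p assume "xs \<in> simplices X (Suc q)" "p \<in> overlap U xs"
    then show "coboundary G c xs p = coboundary G d xs p"
      using overlap_face [of U xs] assms(2)
      by (intro coboundary_cong U(2) face_simplices) auto
  qed
qed

end

text \<open>Sections are total functions whose values off \<open>W\<close> are irrelevant, whence
  \<open>section_cong\<close>. Restriction is to arbitrary subsets, so passing to smaller covers
  needs no openness argument.\<close>

locale coeff_sheaf = comm_group G for G (structure) +
  fixes X :: "'p topology" and F :: "'p set \<Rightarrow> ('p \<Rightarrow> 'a) set"
  assumes restrict: "f \<in> F W \<Longrightarrow> V \<subseteq> W \<Longrightarrow> f \<in> F V"
    and section_cong: "f \<in> F W \<Longrightarrow> (\<And>p. p \<in> W \<Longrightarrow> f p = g p) \<Longrightarrow> g \<in> F W"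
    and section_one: "openin X W \<Longrightarrow> (\<lambda>p. \<one>) \<in> F W"
    and section_mult: "openin X W \<Longrightarrow> f \<in> F W \<Longrightarrow> g \<in> F W \<Longrightarrow> (\<lambda>p. f p \<otimes> g p) \<in> F W"
    and section_inv: "openin X W \<Longrightarrow> f \<in> F W \<Longrightarrow> (\<lambda>p. inv (f p)) \<in> F W"
begin

abbreviation "C \<equiv> cochain_group G"

lemma cochainsI:
  assumes "\<And>xs p. c xs p \<in> carrier G" "U \<in> point_covers X"
    "\<And>xs. xs \<in> simplices X q \<Longrightarrow> c xs \<in> F (overlap U xs)"
  shows "c \<in> cochains X G F q"
  using assms by (auto simp: cochains_def)

lemma cochains_closed: "c \<in> cochains X G F q \<Longrightarrow> c xs p \<in> carrier G"
  by (auto simp: cochains_def)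

lemma cochains_common_cover:
  assumes "c \<in> cochains X G F q" "d \<in> cochains X G F r"
  obtains U where "U \<in> point_covers X" "\<And>xs. xs \<in> simplices X q \<Longrightarrow> c xs \<in> F (overlap U xs)"
    "\<And>xs. xs \<in> simplices X r \<Longrightarrow> d xs \<in> F (overlap U xs)"
proof -
  obtain U V where "U \<in> point_covers X" "\<And>xs. xs \<in> simplices X q \<Longrightarrow> c xs \<in> F (overlap U xs)"
     "V \<in> point_covers X" "\<And>xs. xs \<in> simplices X r \<Longrightarrow> d xs \<in> F (overlap V xs)"
    using assms by (auto simp: cochains_def)
  then show ?thesis
    by (intro that [of "\<lambda>x. U x \<inter> V x"]) (auto simp: point_covers_Int intro: restrict)
qed

lemma cochains_one: "(\<lambda>xs p. \<one>) \<in> cochains X G F q"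
  by (rule cochainsI [where U = "\<lambda>_. topspace X"])
     (auto simp: point_covers_def intro!: section_one openin_overlap)

lemma cochains_mult:
  assumes "c \<in> cochains X G F q" "d \<in> cochains X G F q"
  shows "(\<lambda>xs p. c xs p \<otimes> d xs p) \<in> cochains X G F q"
proof -
  obtain U where "U \<in> point_covers X" "\<And>xs. xs \<in> simplices X q \<Longrightarrow> c xs \<in> F (overlap U xs)"
    "\<And>xs. xs \<in> simplices X q \<Longrightarrow> d xs \<in> F (overlap U xs)"
    using cochains_common_cover [OF assms] by metis
  then show ?thesis
    by (intro cochainsI [where U = U])
      (simp_all add: section_mult openin_overlap cochains_closed [OF assms(1)] cochains_closed [OF assms(2)])
qed

lemma cochains_inv:
  assumes "c \<in> cochains X G F q"
  shows "(\<lambda>xs p. inv (c xs p)) \<in> cochains X G F q"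
proof -
  obtain U where "U \<in> point_covers X" "\<And>xs. xs \<in> simplices X q \<Longrightarrow> c xs \<in> F (overlap U xs)"
    using assms by (auto simp: cochains_def)
  then show ?thesis
    by (intro cochainsI [where U = U])
      (simp_all add: section_inv openin_overlap cochains_closed [OF assms])
qed

lemma cochains_agree:
  assumes "c \<in> cochains X G F q" "agree X q c d" "\<And>xs p. d xs p \<in> carrier G"
  shows "d \<in> cochains X G F q"
proof -
  obtain U V where U: "U \<in> point_covers X" "\<And>xs. xs \<in> simplices X q \<Longrightarrow> c xs \<in> F (overlap U xs)"
     and V: "V \<in> point_covers X" "\<And>xs p. xs \<in> simplices X q \<Longrightarrow> p \<in> overlap V xs \<Longrightarrow> c xs p = d xs p"
    using assms by (auto simp: cochains_def agree_def)
  have "d xs \<in> F (overlap (\<lambda>x. U x \<inter> V x) xs)" if "xs \<in> simplices X q" for xs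
    by (rule section_cong [of "c xs"]) (use U V that in \<open>auto intro: restrict\<close>)
  then show ?thesis
    using U V assms(3) by (intro cochainsI [where U = "\<lambda>x. U x \<inter> V x"]) (auto simp: point_covers_Int)
qed

lemma section_finprod:
  assumes "finite I" "openin X W" "\<And>i. i \<in> I \<Longrightarrow> f i \<in> F W" "\<And>i p. i \<in> I \<Longrightarrow> f i p \<in> carrier G"
  shows "(\<lambda>p. finprod G (\<lambda>i. f i p) I) \<in> F W"
  using assms
proof (induction I rule: finite_induct)
  case empty
  then show ?case by (simp add: section_one)
next
  case (insert i I)
  have "(\<lambda>p. finprod G (\<lambda>i. f i p) (insert i I)) = (\<lambda>p. f i p \<otimes> finprod G (\<lambda>i. f i p) I)"
    using insert by (intro ext finprod_insert) auto
  then show ?case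
    using insert by (auto intro!: section_mult)
qed

lemma coboundary_in_cochains:
  assumes "c \<in> cochains X G F q"
  shows "coboundary G c \<in> cochains X G F (Suc q)"
proof -
  obtain U where U: "U \<in> point_covers X" "\<And>xs. xs \<in> simplices X q \<Longrightarrow> c xs \<in> F (overlap U xs)"
    using assms by (auto simp: cochains_def)
  show ?thesis
  proof (rule cochainsI [OF _ U(1)])
    show "coboundary G c xs p \<in> carrier G" for xs p
      by (intro coboundary_closed cochains_closed [OF assms])
    fix xs assume xs: "xs \<in> simplices X (Suc q)"
    have "(\<lambda>p. c (face i xs) p [^] ((- 1) ^ i :: int)) \<in> F (overlap U xs)" if "i < length xs" for i
    proof -
      have "c (face i xs) \<in> F (overlap U xs)"
        by (rule restrict [OF U(2) [OF face_simplices [OF xs that]] overlap_face])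
      moreover have "(\<lambda>p. inv (c (face i xs) p)) \<in> F (overlap U xs)"
        using section_inv [OF openin_overlap [OF U(1) xs]] calculation by blast
      \<comment> \<open>The exponent \<open>(- 1) ^ i\<close> is 1 or -1, so closure of sections
        under inverses is all that the signs require.\<close>
      moreover have "c ys p [^] (1 :: int) = c ys p" "c ys p [^] (- 1 :: int) = inv (c ys p)" for ys p
        using cochains_closed [OF assms] by (simp_all add: int_pow_neg)
      ultimately show ?thesis
        by (cases "even i") simp_all
    qed
    then show "coboundary G c xs \<in> F (overlap U xs)"
      unfolding coboundary_def face_def [symmetric]
      using U xs cochains_closed [OF assms]
      by (intro section_finprod openin_overlap) auto
  qed
qed

lemma cocyclesI:
  assumes "c \<in> cochains X G F q" "agree X (Suc q) (coboundary G c) (\<lambda>xs p. \<one>)"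
  shows "c \<in> cocycles X G F q"
  using assms by (simp add: cocycles_def)

lemma cocycles_cochains: "c \<in> cocycles X G F q \<Longrightarrow> c \<in> cochains X G F q"
  by (simp add: cocycles_def)

lemma cocycles_closed: "c \<in> cocycles X G F q \<Longrightarrow> c xs p \<in> carrier G"
  by (rule cochains_closed [OF cocycles_cochains])

lemma agree_coboundary_cocycle:
  "c \<in> cocycles X G F q \<Longrightarrow> agree X (Suc q) (coboundary G c) (\<lambda>xs p. \<one>)"
  by (simp add: cocycles_def)

lemma cocycles_agree:
  assumes "c \<in> cocycles X G F q" "agree X q c d" "\<And>xs p. d xs p \<in> carrier G"
  shows "d \<in> cocycles X G F q"
proof (rule cocyclesI)
  show "d \<in> cochains X G F q"
    using assms cochains_agree by (auto simp: cocycles_def)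
  have "agree X (Suc q) (coboundary G d) (coboundary G c)"
    by (intro agree_coboundary agree_sym [OF assms(2)] cocycles_closed [OF assms(1)])
  then show "agree X (Suc q) (coboundary G d) (\<lambda>xs p. \<one>)"
    using assms(1) agree_trans agree_coboundary_cocycle by blast
qed

lemma coboundary_in_cocycles:
  assumes "c \<in> cochains X G F q"
  shows "coboundary G c \<in> cocycles X G F (Suc q)"
proof (rule cocyclesI)
  have "coboundary G (coboundary G c) = (\<lambda>xs p. \<one>)"
    by (intro ext coboundary_coboundary cochains_closed [OF assms])
  then show "agree X (Suc (Suc q)) (coboundary G (coboundary G c)) (\<lambda>xs p. \<one>)"
    by simp
qed (use assms coboundary_in_cochains in auto)

lemma coboundaries_Suc:
  "coboundaries X G F (Suc r) =
     {c \<in> cochains X G F (Suc r). \<exists>e\<in>cochains X G F r. agree X (Suc r) c (coboundary G e)}"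
  by (simp add: coboundaries_def)

lemma coboundariesI:
  assumes "e \<in> cochains X G F r" "agree X (Suc r) c (coboundary G e)" "\<And>xs p. c xs p \<in> carrier G"
  shows "c \<in> coboundaries X G F (Suc r)"
  using assms cochains_agree [OF coboundary_in_cochains [OF assms(1)] agree_sym [OF assms(2)]]
  unfolding coboundaries_Suc by blast

lemma coboundariesE:
  assumes "c \<in> coboundaries X G F (Suc r)"
  obtains e where "e \<in> cochains X G F r" "agree X (Suc r) c (coboundary G e)"
  using assms unfolding coboundaries_Suc by blast

lemma subgroup_cocycles: "subgroup (cocycles X G F q) C"
proof -
  interpret C: comm_group C by (rule comm_group_cochain_group)
  show ?thesis
  proof (rule C.subgroupI)
    have "(\<lambda>xs p. \<one>) \<in> cocycles X G F q"
      by (rule cocyclesI [OF cochains_one]) simp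
    then show "cocycles X G F q \<noteq> {}" by blast
  next
    fix c assume c: "c \<in> cocycles X G F q"
    have "agree X (Suc q) (coboundary G (\<lambda>xs p. inv (c xs p))) (\<lambda>xs p. \<one>)"
      using agree_coboundary_cocycle [OF c]
      by (rule agree_cong) (use c in \<open>simp add: coboundary_inv cocycles_closed\<close>)
    then show "inv\<^bsub>C\<^esub> c \<in> cocycles X G F q"
      using c by (subst inv_cochain_group)
        (simp_all add: cocycles_closed cocyclesI cochains_inv cocycles_cochains)
  next
    fix c d assume c: "c \<in> cocycles X G F q" and d: "d \<in> cocycles X G F q"
    have "agree X (Suc q) (coboundary G (\<lambda>xs p. c xs p \<otimes> d xs p)) (\<lambda>xs p. \<one>)"
      using agree_coboundary_cocycle [OF c] agree_coboundary_cocycle [OF d]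
      by (rule agree_cong2) (use c d in \<open>simp add: coboundary_mult cocycles_closed\<close>)
    then show "c \<otimes>\<^bsub>C\<^esub> d \<in> cocycles X G F q"
      using c d by (simp add: cocyclesI cochains_mult cocycles_cochains)
  qed (use cocycles_closed in \<open>simp add: subset_iff\<close>)
qed

text \<open>In degree 0 the group \<open>coboundaries\<close> consists of the cochains that are
  trivial on some cover; dividing by it identifies representatives of the same cochain of the limit.
  Hence the separate case.\<close>

lemma coboundaries_subset: "coboundaries X G F q \<subseteq> cocycles X G F q"
proof
  fix c assume c: "c \<in> coboundaries X G F q"
  then have cc: "c \<in> cochains X G F q" by (simp add: coboundaries_def)
  show "c \<in> cocycles X G F q"
  proof (cases q)
    case 0
    have "agree X q (\<lambda>xs p. \<one>) c"
      using c 0 by (intro agree_sym [of X q c]) (simp add: coboundaries_def)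
    moreover have "(\<lambda>xs p. \<one>) \<in> cocycles X G F q"
      using subgroup.one_closed [OF subgroup_cocycles [of q]] by simp
    ultimately show ?thesis
      using cochains_closed [OF cc] by (intro cocycles_agree [of "\<lambda>xs p. \<one>" q c])
  next
    case (Suc r)
    obtain e where e: "e \<in> cochains X G F r" "agree X (Suc r) c (coboundary G e)"
      using c unfolding Suc by (rule coboundariesE)
    show ?thesis
      unfolding Suc using cochains_closed [OF cc]
      by (intro cocycles_agree [OF coboundary_in_cocycles [OF e(1)] agree_sym [OF e(2)]])
  qed
qed

lemma subgroup_coboundaries: "subgroup (coboundaries X G F q) C"
proof -
  interpret C: comm_group C by (rule comm_group_cochain_group)
  have cl: "c xs p \<in> carrier G" if "c \<in> coboundaries X G F q" for c xs p
    using that coboundaries_subset cocycles_closed by blast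
  show ?thesis
  proof (cases q)
    case 0
    have eq: "coboundaries X G F q = {c \<in> cochains X G F q. agree X q c (\<lambda>xs p. \<one>)}"
      by (simp add: coboundaries_def 0)
    show ?thesis
    proof (rule C.subgroupI)
      show "coboundaries X G F q \<noteq> {}"
        unfolding eq using cochains_one agree_refl by blast
      show "inv\<^bsub>C\<^esub> c \<in> coboundaries X G F q" if c: "c \<in> coboundaries X G F q" for c
      proof -
        have "agree X q (\<lambda>xs p. inv (c xs p)) (\<lambda>xs p. \<one>)"
          by (rule agree_cong [of X q c "\<lambda>xs p. \<one>"]) (use c in \<open>simp_all add: eq\<close>)
        then show ?thesis
          using c cl [OF c] by (subst inv_cochain_group) (simp_all add: eq cochains_inv)
      qed
      show "c \<otimes>\<^bsub>C\<^esub> d \<in> coboundaries X G F q"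
        if c: "c \<in> coboundaries X G F q" and d: "d \<in> coboundaries X G F q" for c d
      proof -
        have "agree X q (\<lambda>xs p. c xs p \<otimes> d xs p) (\<lambda>xs p. \<one>)"
          by (rule agree_cong2 [of X q c "\<lambda>xs p. \<one>" d "\<lambda>xs p. \<one>"]) (use c d in \<open>simp_all add: eq\<close>)
        then show ?thesis
          using c d by (simp add: eq cochains_mult)
      qed
    qed (use cl in \<open>simp add: subset_iff\<close>)
  next
    case (Suc r)
    show ?thesis
      unfolding Suc
    proof (rule C.subgroupI)
      have "(\<lambda>xs p. \<one>) \<in> coboundaries X G F (Suc r)"
        by (rule coboundariesI [OF cochains_one]) simp_all
      then show "coboundaries X G F (Suc r) \<noteq> {}" by blast
      show "inv\<^bsub>C\<^esub> c \<in> coboundaries X G F (Suc r)" if c: "c \<in> coboundaries X G F (Suc r)" for c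
      proof -
        obtain e where e: "e \<in> cochains X G F r" "agree X (Suc r) c (coboundary G e)"
          using c by (rule coboundariesE)
        have "agree X (Suc r) (\<lambda>xs p. inv (c xs p)) (coboundary G (\<lambda>xs p. inv (e xs p)))"
          using e(2) by (rule agree_cong) (simp add: coboundary_inv cochains_closed [OF e(1)])
        then have "(\<lambda>xs p. inv (c xs p)) \<in> coboundaries X G F (Suc r)"
          using cl c Suc by (intro coboundariesI [OF cochains_inv [OF e(1)]]) simp_all
        then show ?thesis
          using cl c Suc by (subst inv_cochain_group) simp_all
      qed
      show "c \<otimes>\<^bsub>C\<^esub> d \<in> coboundaries X G F (Suc r)"
        if c: "c \<in> coboundaries X G F (Suc r)" and d: "d \<in> coboundaries X G F (Suc r)" for c d
      proof -
        obtain e where e: "e \<in> cochains X G F r" "agree X (Suc r) c (coboundary G e)"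
          using c by (rule coboundariesE)
        obtain e' where e': "e' \<in> cochains X G F r" "agree X (Suc r) d (coboundary G e')"
          using d by (rule coboundariesE)
        have "agree X (Suc r) (\<lambda>xs p. c xs p \<otimes> d xs p) (coboundary G (\<lambda>xs p. e xs p \<otimes> e' xs p))"
          using e(2) e'(2)
          by (rule agree_cong2) (simp add: coboundary_mult cochains_closed [OF e(1)] cochains_closed [OF e'(1)])
        then show ?thesis
          using cl c d Suc by (simp add: coboundariesI [OF cochains_mult [OF e(1) e'(1)]])
      qed
    qed (use cl Suc in \<open>simp add: subset_iff\<close>)
  qed
qed

end

section \<open>Cohomology groups\<close>

context coeff_sheaf
begin

lemma coh_class_mem_iff:
  "c' \<in> coh_class X G F q c \<longleftrightarrow> (\<exists>b\<in>coboundaries X G F q. c' = (\<lambda>xs p. b xs p \<otimes> c xs p))"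
  by (auto simp: coh_class_def r_coset_def)

lemma comm_group_cocycles: "comm_group (C\<lparr>carrier := cocycles X G F q\<rparr>)"
proof -
  interpret C: comm_group C by (rule comm_group_cochain_group)
  interpret Z: group "C\<lparr>carrier := cocycles X G F q\<rparr>"
    by (rule C.subgroup_imp_group [OF subgroup_cocycles])
  show ?thesis
    by (rule Z.group_comm_groupI) (simp add: m_comm cocycles_closed)
qed

lemma subgroup_coboundaries_cocycles:
  "subgroup (coboundaries X G F q) (C\<lparr>carrier := cocycles X G F q\<rparr>)"
proof -
  interpret C: comm_group C by (rule comm_group_cochain_group)
  show ?thesis
    by (rule C.subgroup_incl [OF subgroup_coboundaries subgroup_cocycles coboundaries_subset])
qed

lemma normal_coboundaries_cocycles:
  "coboundaries X G F q \<lhd> C\<lparr>carrier := cocycles X G F q\<rparr>"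
  by (rule comm_group.subgroup_imp_normal [OF comm_group_cocycles subgroup_coboundaries_cocycles])

lemma comm_group_cohomology: "comm_group (cohomology X G F q)"
  unfolding cohomology_def
  by (rule comm_group.abelian_FactGroup [OF comm_group_cocycles subgroup_coboundaries_cocycles])

lemma carrier_cohomology:
  "carrier (cohomology X G F q) = coh_class X G F q ` cocycles X G F q"
  by (simp add: cohomology_def carrier_FactGroup coh_class_def)

lemma coh_class_carrier [intro]:
  "c \<in> cocycles X G F q \<Longrightarrow> coh_class X G F q c \<in> carrier (cohomology X G F q)"
  by (simp add: carrier_cohomology)

lemma cohomologyE:
  assumes "A \<in> carrier (cohomology X G F q)"
  obtains a where "a \<in> cocycles X G F q" "A = coh_class X G F q a"
  using assms by (auto simp: carrier_cohomology)

lemma coh_class_mult: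
  assumes "c \<in> cocycles X G F q" "d \<in> cocycles X G F q"
  shows "coh_class X G F q c \<otimes>\<^bsub>cohomology X G F q\<^esub> coh_class X G F q d =
    coh_class X G F q (\<lambda>xs p. c xs p \<otimes> d xs p)"
  using assms normal.rcos_sum [OF normal_coboundaries_cocycles, of c q d]
  by (simp add: coh_class_def cohomology_def)

lemma coh_class_one: "coh_class X G F q (\<lambda>xs p. \<one>) = \<one>\<^bsub>cohomology X G F q\<^esub>"
proof -
  interpret C: comm_group C by (rule comm_group_cochain_group)
  show ?thesis
    using C.coset_mult_one [of "coboundaries X G F q"] subgroup.subset [OF subgroup_coboundaries]
    by (simp add: coh_class_def cohomology_def)
qed

lemma coh_class_int_pow:
  assumes "c \<in> cocycles X G F q"
  shows "coh_class X G F q c [^]\<^bsub>cohomology X G F q\<^esub> (n :: int) =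
    coh_class X G F q (\<lambda>xs p. c xs p [^] n)"
proof -
  interpret C: comm_group C by (rule comm_group_cochain_group)
  have "c [^]\<^bsub>C\<lparr>carrier := cocycles X G F q\<rparr>\<^esub> n = c [^]\<^bsub>C\<^esub> n"
    by (rule C.int_pow_consistent [OF subgroup_cocycles assms, symmetric])
  also have "\<dots> = (\<lambda>xs p. c xs p [^] n)"
    by (rule int_pow_cochain_group) (simp add: cocycles_closed [OF assms])
  finally show ?thesis
    using normal.FactGroup_int_pow [OF normal_coboundaries_cocycles, of c q n] assms
    by (simp add: coh_class_def cohomology_def)
qed

lemma coh_class_nat_pow:
  assumes "c \<in> cocycles X G F q"
  shows "coh_class X G F q c [^]\<^bsub>cohomology X G F q\<^esub> (n :: nat) =
    coh_class X G F q (\<lambda>xs p. c xs p [^] n)"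
  using coh_class_int_pow [OF assms, of "int n"] by (simp add: int_pow_int)

lemma cocycles_mult:
  "c \<in> cocycles X G F q \<Longrightarrow> d \<in> cocycles X G F q \<Longrightarrow> (\<lambda>xs p. c xs p \<otimes> d xs p) \<in> cocycles X G F q"
  using subgroup.m_closed [OF subgroup_cocycles] by auto

lemma cocycles_inv:
  assumes "c \<in> cocycles X G F q"
  shows "(\<lambda>xs p. inv (c xs p)) \<in> cocycles X G F q"
  using subgroup.m_inv_closed [OF subgroup_cocycles assms] cocycles_closed [OF assms]
  by (simp add: inv_cochain_group)

lemma cocycles_one: "(\<lambda>xs p. \<one>) \<in> cocycles X G F q"
  using subgroup.one_closed [OF subgroup_cocycles] by simp

lemma coh_class_eq_iff:
  assumes "c \<in> cocycles X G F q" "d \<in> cocycles X G F q"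
  shows "coh_class X G F q c = coh_class X G F q d \<longleftrightarrow>
    (\<lambda>xs p. c xs p \<otimes> inv (d xs p)) \<in> coboundaries X G F q"
proof -
  interpret C: comm_group C by (rule comm_group_cochain_group)
  have cl: "c \<in> carrier C" "d \<in> carrier C"
    using assms cocycles_closed by auto
  have "coh_class X G F q c = coh_class X G F q d \<longleftrightarrow> c \<in> coh_class X G F q d"
    unfolding coh_class_def
    using C.repr_independence [OF _ _ subgroup_coboundaries] C.rcos_self [OF _ subgroup_coboundaries] cl
    by metis
  also have "\<dots> \<longleftrightarrow> c \<otimes>\<^bsub>C\<^esub> inv\<^bsub>C\<^esub> d \<in> coboundaries X G F q"
    unfolding coh_class_def
    using subgroup.rcos_module [OF subgroup_coboundaries C.is_group cl(2) cl(1)] .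
  finally show ?thesis
    using cl by (simp add: inv_cochain_group)
qed

text \<open>That \<open>c\<close> is a cocycle is part of the conclusion: it agrees with the product
  of a cocycle and a coboundary. Only its values have to be checked beforehand.\<close>

lemma coh_class_eqI:
  assumes "d \<in> cocycles X G F (Suc r)" "e \<in> cochains X G F r"
    "agree X (Suc r) c (\<lambda>xs p. d xs p \<otimes> coboundary G e xs p)" "\<And>xs p. c xs p \<in> carrier G"
  shows "c \<in> cocycles X G F (Suc r)" "coh_class X G F (Suc r) c = coh_class X G F (Suc r) d"
proof -
  show c: "c \<in> cocycles X G F (Suc r)"
    by (rule cocycles_agree [OF cocycles_mult [OF assms(1) coboundary_in_cocycles [OF assms(2)]]
          agree_sym [OF assms(3)] assms(4)])
  have "agree X (Suc r) (\<lambda>xs p. c xs p \<otimes> inv (d xs p)) (coboundary G e)"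
    using assms(3)
  proof (rule agree_cong)
    fix xs p assume "c xs p = d xs p \<otimes> coboundary G e xs p"
    moreover have "d xs p \<in> carrier G" "coboundary G e xs p \<in> carrier G"
      by (simp_all add: cocycles_closed [OF assms(1)] coboundary_closed cochains_closed [OF assms(2)])
    ultimately show "c xs p \<otimes> inv (d xs p) = coboundary G e xs p"
      by (simp add: m_comm [of "d xs p"] m_assoc)
  qed
  then have "(\<lambda>xs p. c xs p \<otimes> inv (d xs p)) \<in> coboundaries X G F (Suc r)"
    using assms(4) cocycles_closed [OF assms(1)] by (intro coboundariesI [OF assms(2)]) auto
  then show "coh_class X G F (Suc r) c = coh_class X G F (Suc r) d"
    using coh_class_eq_iff [OF c assms(1)] by simp
qed

lemma coh_class_eqE:
  assumes "c \<in> cocycles X G F (Suc r)" "d \<in> cocycles X G F (Suc r)"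
    "coh_class X G F (Suc r) c = coh_class X G F (Suc r) d"
  obtains e where "e \<in> cochains X G F r" "agree X (Suc r) c (\<lambda>xs p. d xs p \<otimes> coboundary G e xs p)"
proof -
  obtain e where e: "e \<in> cochains X G F r" "agree X (Suc r) (\<lambda>xs p. c xs p \<otimes> inv (d xs p)) (coboundary G e)"
    using assms coh_class_eq_iff coboundariesE by blast
  have "agree X (Suc r) c (\<lambda>xs p. d xs p \<otimes> coboundary G e xs p)"
    using e(2)
  proof (rule agree_cong)
    fix xs p assume eq: "c xs p \<otimes> inv (d xs p) = coboundary G e xs p"
    show "c xs p = d xs p \<otimes> coboundary G e xs p"
      unfolding eq [symmetric] using cocycles_closed [OF assms(1)] cocycles_closed [OF assms(2)]
      by (simp add: m_lcomm)
  qed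
  then show ?thesis using e(1) that by blast
qed

lemma coh_class_self:
  assumes "c \<in> cocycles X G F q" 
  shows "c \<in> coh_class X G F q c"
proof -
  interpret C: comm_group C by (rule comm_group_cochain_group)
  show ?thesis
    unfolding coh_class_def
    using C.rcos_self [OF _ subgroup_coboundaries, of c q] cocycles_closed [OF assms] by simp
qed

lemma coh_class_memD:
  assumes "c \<in> cocycles X G F q" "c' \<in> coh_class X G F q c"
  shows "c' \<in> cocycles X G F q" "coh_class X G F q c' = coh_class X G F q c"
proof -
  obtain b where b: "b \<in> coboundaries X G F q" "c' = (\<lambda>xs p. b xs p \<otimes> c xs p)"
    using assms by (auto simp: coh_class_mem_iff)
  then have bc: "b \<in> cocycles X G F q" using coboundaries_subset by blast
  then show c': "c' \<in> cocycles X G F q"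
    unfolding b(2) using assms(1) by (rule cocycles_mult)
  have "(\<lambda>xs p. c' xs p \<otimes> inv (c xs p)) = b"
    unfolding b(2) using cocycles_closed [OF bc] cocycles_closed [OF assms(1)]
    by (intro ext) (simp add: m_assoc)
  then show "coh_class X G F q c' = coh_class X G F q c"
    using coh_class_eq_iff [OF c' assms(1)] b(1) by simp
qed

end

text \<open>A morphism of limit complexes, possibly between different spaces and groups. It is
  instantiated by inclusions of coefficient sheaves, by the exponential and by pullback along a
  continuous map.\<close>

locale cochain_map = src: coeff_sheaf G X F + tgt: coeff_sheaf G' X' F'
  for G (structure) and X :: "'p topology" and F :: "'p set \<Rightarrow> ('p \<Rightarrow> 'a) set"
    and G' and X' :: "'q topology" and F' :: "'q set \<Rightarrow> ('q \<Rightarrow> 'c) set" +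
  fixes f :: "('p, 'a) cochain \<Rightarrow> ('q, 'c) cochain"
  assumes map_closed: "(\<And>xs p. c xs p \<in> carrier G) \<Longrightarrow> f c ys q \<in> carrier G'"
    and map_mult: "(\<And>xs p. c xs p \<in> carrier G) \<Longrightarrow> (\<And>xs p. d xs p \<in> carrier G) \<Longrightarrow>
      f (\<lambda>xs p. c xs p \<otimes> d xs p) = (\<lambda>ys q. f c ys q \<otimes>\<^bsub>G'\<^esub> f d ys q)"
    and map_coboundary: "(\<And>xs p. c xs p \<in> carrier G) \<Longrightarrow> f (coboundary G c) = coboundary G' (f c)"
    and map_agree: "agree X n c d \<Longrightarrow> agree X' n (f c) (f d)"
    and map_cochains: "c \<in> cochains X G F n \<Longrightarrow> f c \<in> cochains X' G' F' n"
begin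

lemma map_one: "f (\<lambda>xs p. \<one>) = (\<lambda>ys q. \<one>\<^bsub>G'\<^esub>)"
proof (intro ext)
  fix ys q
  let ?u = "f (\<lambda>xs p. \<one>) ys q"
  have "?u \<in> carrier G'" by (rule map_closed) simp
  moreover have "f (\<lambda>xs p. \<one> \<otimes> \<one>) = (\<lambda>ys q. f (\<lambda>xs p. \<one>) ys q \<otimes>\<^bsub>G'\<^esub> f (\<lambda>xs p. \<one>) ys q)"
    by (rule map_mult) simp_all
  then have "?u = ?u \<otimes>\<^bsub>G'\<^esub> ?u"
    by (simp add: fun_eq_iff)
  ultimately show "?u = \<one>\<^bsub>G'\<^esub>"
    using tgt.r_cancel_one' by metis
qed

lemma map_cocycles:
  assumes "c \<in> cocycles X G F n"
  shows "f c \<in> cocycles X' G' F' n"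
proof (rule tgt.cocyclesI)
  show "f c \<in> cochains X' G' F' n"
    using assms map_cochains src.cocycles_cochains by blast
  show "agree X' (Suc n) (coboundary G' (f c)) (\<lambda>xs p. \<one>\<^bsub>G'\<^esub>)"
    using map_agree [OF src.agree_coboundary_cocycle [OF assms]] map_coboundary [of c]
      src.cocycles_closed [OF assms] by (simp add: map_one)
qed

lemma map_coboundaries:
  assumes "c \<in> coboundaries X G F n"
  shows "f c \<in> coboundaries X' G' F' n"
proof (cases n)
  case 0
  then have "c \<in> cochains X G F 0" "agree X 0 c (\<lambda>xs p. \<one>)"
    using assms by (simp_all add: coboundaries_def)
  then show ?thesis
    using map_agree [of 0 c "\<lambda>xs p. \<one>"] map_cochains [of c 0] 0 by (simp add: coboundaries_def map_one)
next
  case (Suc r)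
  obtain e where e: "e \<in> cochains X G F r" "agree X (Suc r) c (coboundary G e)"
    using assms unfolding Suc by (rule src.coboundariesE)
  have "c \<in> cocycles X G F n" using assms src.coboundaries_subset by blast
  then have "f c xs p \<in> carrier G'" for xs p
    using map_closed src.cocycles_closed by blast
  moreover have "agree X' (Suc r) (f c) (coboundary G' (f e))"
    using map_agree [OF e(2)] map_coboundary [of e] src.cochains_closed [OF e(1)] by simp
  ultimately show ?thesis
    unfolding Suc using map_cochains [OF e(1)] by (intro tgt.coboundariesI)
qed

text \<open>\<open>induced\<close> is a union over all representatives. Two of them differ by a
  coboundary, which \<open>f\<close> maps to a coboundary, so the united sets coincide and one
  representative computes the map.\<close>

lemma induced_coh_class:
  assumes "c \<in> cocycles X G F n"
  shows "induced X' G' F' n f (coh_class X G F n c) = coh_class X' G' F' n (f c)"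
proof -
  have "coh_class X' G' F' n (f c') = coh_class X' G' F' n (f c)" if c': "c' \<in> coh_class X G F n c" for c'
  proof -
    obtain b where b: "b \<in> coboundaries X G F n" "c' = (\<lambda>xs p. b xs p \<otimes> c xs p)"
      using c' unfolding src.coh_class_mem_iff by blast
    then have bc: "b \<in> cocycles X G F n" using src.coboundaries_subset by blast
    have "f c' = (\<lambda>xs p. f b xs p \<otimes>\<^bsub>G'\<^esub> f c xs p)"
      unfolding b(2) using src.cocycles_closed [OF bc] src.cocycles_closed [OF assms] by (intro map_mult)
    then have "f c' \<in> coh_class X' G' F' n (f c)"
      unfolding tgt.coh_class_mem_iff using map_coboundaries [OF b(1)] by blast
    then show ?thesis
      using tgt.coh_class_memD(2) [OF map_cocycles [OF assms]] by blast
  qed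
  then show ?thesis
    unfolding induced_def using src.coh_class_self [OF assms] by blast
qed

end

section \<open>Additive and multiplicative coefficients\<close>

lemma additive_group_simps [simp]:
  "carrier additive_group = UNIV" "x \<otimes>\<^bsub>additive_group\<^esub> y = x + y" "\<one>\<^bsub>additive_group\<^esub> = 0"
  by (simp_all add: additive_group_def)

lemma comm_group_additive_group: "comm_group (additive_group :: 'a::ab_group_add monoid)"
  by (rule comm_groupI) (auto simp: algebra_simps intro: exI [of _ "- _"])

lemma inv_additive_group [simp]: "inv\<^bsub>additive_group\<^esub> x = - x"
  using group.inv_equality [OF comm_group.axioms(2) [OF comm_group_additive_group], of "- x" x] by simp

lemma int_pow_additive_group [simp]:
  fixes x :: "'a::ring_1"
  shows "x [^]\<^bsub>additive_group\<^esub> (n :: int) = of_int n * x"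
proof -
  have nat: "x [^]\<^bsub>additive_group\<^esub> (m :: nat) = of_nat m * x" for m
    by (induction m) (simp_all add: nat_pow_def algebra_simps)
  then show ?thesis
    by (simp add: int_pow_def2 of_nat_nat)
qed

lemma unit_group_simps [simp]:
  "carrier unit_group = - {0}" "x \<otimes>\<^bsub>unit_group\<^esub> y = x * y" "\<one>\<^bsub>unit_group\<^esub> = 1"
  by (simp_all add: unit_group_def)

lemma comm_group_unit_group: "comm_group (unit_group :: 'a::field monoid)"
proof (rule comm_groupI)
  fix x :: 'a assume "x \<in> carrier unit_group"
  then show "\<exists>y\<in>carrier unit_group. y \<otimes>\<^bsub>unit_group\<^esub> x = \<one>\<^bsub>unit_group\<^esub>"
    by (intro bexI [of _ "inverse x"]) auto
qed auto

lemma inv_unit_group [simp]: "x \<noteq> 0 \<Longrightarrow> inv\<^bsub>unit_group\<^esub> x = inverse x"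
  using group.inv_equality [OF comm_group.axioms(2) [OF comm_group_unit_group], of "inverse x" x] by simp

abbreviation add_coboundary :: "('p, complex) cochain \<Rightarrow> ('p, complex) cochain" where
  "add_coboundary \<equiv> coboundary additive_group"

lemma add_coboundary_Nil [simp]: "add_coboundary c [] p = 0"
  using comm_group.coboundary_Nil [OF comm_group_additive_group] by simp

lemma add_coboundary_Cons [simp]:
  "add_coboundary c (x # xs) p = c xs p - add_coboundary (\<lambda>ys. c (x # ys)) xs p"
  using comm_group.coboundary_Cons [OF comm_group_additive_group] by simp

lemma unit_coboundary_Cons:
  assumes "\<And>xs p. c xs p \<noteq> 0"
  shows "coboundary unit_group c (x # xs) p = c xs p * inverse (coboundary unit_group (\<lambda>ys. c (x # ys)) xs p)"
proof -
  have "coboundary unit_group (\<lambda>ys. c (x # ys)) xs p \<in> carrier unit_group"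
    by (rule comm_group.coboundary_closed [OF comm_group_unit_group]) (simp add: assms)
  then show ?thesis
    using assms comm_group.coboundary_Cons [OF comm_group_unit_group, of c x xs p] by simp
qed

lemma exp_cochain_nonzero [simp]: "exp_cochain c xs p \<noteq> 0"
  by (simp add: exp_cochain_def)

lemma exp_cochain_coboundary: "exp_cochain (add_coboundary c) = coboundary unit_group (exp_cochain c)"
proof (intro ext)
  fix xs p
  show "exp_cochain (add_coboundary c) xs p = coboundary unit_group (exp_cochain c) xs p"
  proof (induction xs arbitrary: c)
    case Nil
    then show ?case
      using comm_group.coboundary_Nil [OF comm_group_unit_group] by (simp add: exp_cochain_def)
  next
    case (Cons x xs)
    define e where "e = (\<lambda>ys. c (x # ys))"
    have e: "(\<lambda>ys. exp_cochain c (x # ys)) = exp_cochain e"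
      by (simp add: exp_cochain_def e_def)
    show ?case
      using Cons [of e] unfolding unit_coboundary_Cons [OF exp_cochain_nonzero] e
      by (simp add: exp_cochain_def e_def [symmetric] right_diff_distrib exp_diff divide_inverse)
  qed
qed

text \<open>The coefficient group is all of the complex numbers for each of Z, Q and O; integrality
  or rationality is a property of the sheaf. One cochain can thus be read in several theories, and
  carrier conditions become trivial.\<close>

locale additive_sheaf =
  fixes X :: "'p topology" and F :: "('p, complex) sheaf"
  assumes sheaf_restrict: "f \<in> F W \<Longrightarrow> V \<subseteq> W \<Longrightarrow> f \<in> F V"
    and sheaf_cong: "f \<in> F W \<Longrightarrow> (\<And>p. p \<in> W \<Longrightarrow> f p = g p) \<Longrightarrow> g \<in> F W"
    and sheaf_zero: "openin X W \<Longrightarrow> (\<lambda>p. 0) \<in> F W"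
    and sheaf_add: "openin X W \<Longrightarrow> f \<in> F W \<Longrightarrow> g \<in> F W \<Longrightarrow> (\<lambda>p. f p + g p) \<in> F W"
    and sheaf_uminus: "openin X W \<Longrightarrow> f \<in> F W \<Longrightarrow> (\<lambda>p. - f p) \<in> F W"
begin

sublocale coeff_sheaf additive_group X F
  by (intro coeff_sheaf.intro comm_group_additive_group coeff_sheaf_axioms.intro)
     (auto intro: sheaf_restrict sheaf_cong sheaf_zero sheaf_add sheaf_uminus)

abbreviation "cls q \<equiv> coh_class X additive_group F q"
abbreviation "cyc q \<equiv> cocycles X additive_group F q"
abbreviation "coch q \<equiv> cochains X additive_group F q"

lemmas coch_zero = cochains_one [simplified]
lemmas coch_uminus = cochains_inv [simplified]
lemmas cyc_zero = cocycles_one [simplified]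
lemmas cyc_add = cocycles_mult [simplified]
lemmas cyc_uminus = cocycles_inv [simplified]
lemmas cls_add = coh_class_mult [simplified]
lemmas cls_int_pow = coh_class_int_pow [simplified]

lemma cyc_diff: "c \<in> cyc q \<Longrightarrow> d \<in> cyc q \<Longrightarrow> (\<lambda>xs p. c xs p - d xs p) \<in> cyc q"
  using cyc_add [of c q "\<lambda>xs p. - d xs p"] cyc_uminus [of d q] by simp

lemma cyc_agree: "c \<in> cyc q \<Longrightarrow> agree X q c d \<Longrightarrow> d \<in> cyc q"
  by (rule cocycles_agree) auto

lemma cls_eqI:
  assumes "d \<in> cyc (Suc r)" "e \<in> coch r" "agree X (Suc r) c (\<lambda>xs p. d xs p + add_coboundary e xs p)"
  shows "c \<in> cyc (Suc r)" "cls (Suc r) c = cls (Suc r) d"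
  using coh_class_eqI [OF assms(1,2), of c] assms(3) by auto

lemma cls_eqE:
  assumes "c \<in> cyc (Suc r)" "d \<in> cyc (Suc r)" "cls (Suc r) c = cls (Suc r) d"
  obtains e where "e \<in> coch r" "agree X (Suc r) c (\<lambda>xs p. d xs p + add_coboundary e xs p)"
  using coh_class_eqE [OF assms] by auto

end

lemma add_coboundary_uminus: "add_coboundary (\<lambda>xs p. - c xs p) xs p = - add_coboundary c xs p"
  using comm_group.coboundary_inv [OF comm_group_additive_group, of c] by simp

text \<open>The factor may vary with the point, because the coboundary acts on lists only. In the
  Leibniz rule the factor is \<open>a [x] p\<close>.\<close>

lemma add_coboundary_cmult: "add_coboundary (\<lambda>xs p. k p * c xs p) xs p = k p * add_coboundary c xs p"
  by (induction xs arbitrary: c) (simp_all add: right_diff_distrib)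

lemma locally_constant_combine:
  assumes "f \<in> locally_constant X A W" "g \<in> locally_constant X B W"
    and "\<And>a b. a \<in> A \<Longrightarrow> b \<in> B \<Longrightarrow> h a b \<in> D"
  shows "(\<lambda>p. h (f p) (g p)) \<in> locally_constant X D W"
  unfolding locally_constant_def
proof (intro CollectI ballI conjI)
  fix p assume p: "p \<in> W"
  then show "h (f p) (g p) \<in> D"
    using assms by (auto simp: locally_constant_def)
  obtain U where U: "openin X U" "p \<in> U" "\<forall>q\<in>U \<inter> W. f q = f p"
    using assms(1) p unfolding locally_constant_def by blast
  obtain V where V: "openin X V" "p \<in> V" "\<forall>q\<in>V \<inter> W. g q = g p"
    using assms(2) p unfolding locally_constant_def by blast
  show "\<exists>V. openin X V \<and> p \<in> V \<and> (\<forall>q\<in>V \<inter> W. h (f q) (g q) = h (f p) (g p))"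
    using U V by (intro exI [of _ "U \<inter> V"]) auto
qed

lemma locally_constant_restrict:
  "f \<in> locally_constant X A W \<Longrightarrow> V \<subseteq> W \<Longrightarrow> f \<in> locally_constant X A V"
  unfolding locally_constant_def by blast

lemma locally_constant_cong:
  assumes "f \<in> locally_constant X A W" "\<And>p. p \<in> W \<Longrightarrow> f p = g p"
  shows "g \<in> locally_constant X A W"
  unfolding locally_constant_def
proof (intro CollectI ballI conjI)
  fix p assume p: "p \<in> W"
  then show "g p \<in> A"
    using assms by (auto simp: locally_constant_def)
  obtain U where "openin X U" "p \<in> U" "\<forall>q\<in>U \<inter> W. f q = f p"
    using assms(1) p unfolding locally_constant_def by blast
  then show "\<exists>V. openin X V \<and> p \<in> V \<and> (\<forall>q\<in>V \<inter> W. g q = g p)"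
    using assms(2) p by (metis IntD2)
qed

lemma locally_constant_mono:
  "f \<in> locally_constant X A W \<Longrightarrow> A \<subseteq> B \<Longrightarrow> f \<in> locally_constant X B W"
  unfolding locally_constant_def by blast

lemma locally_constant_const:
  "openin X W \<Longrightarrow> a \<in> A \<Longrightarrow> (\<lambda>p. a) \<in> locally_constant X A W"
  by (auto simp: locally_constant_def)

lemma additive_sheaf_locally_constant:
  assumes "0 \<in> A" "\<And>a b. a \<in> A \<Longrightarrow> b \<in> A \<Longrightarrow> a - b \<in> A"
  shows "additive_sheaf X (locally_constant X A)"
proof
  have minus: "- a \<in> A" if "a \<in> A" for a
    using assms(2) [OF assms(1) that] by simp
  then have add: "a + b \<in> A" if "a \<in> A" "b \<in> A" for a b
    using assms(2) [of a "- b"] that by simp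
  show "(\<lambda>p. - f p) \<in> locally_constant X A W" if "f \<in> locally_constant X A W" for f W
    by (rule locally_constant_combine [OF that that, of "\<lambda>a b. - a"]) (rule minus)
  show "(\<lambda>p. f p + g p) \<in> locally_constant X A W"
    if "f \<in> locally_constant X A W" "g \<in> locally_constant X A W" for f g W
    by (rule locally_constant_combine [OF that]) (rule add)
  show "(\<lambda>p. 0) \<in> locally_constant X A W" if "openin X W" for W
    using that assms(1) by (rule locally_constant_const)
qed (fact locally_constant_restrict locally_constant_cong)+

section \<open>Cup products\<close>

text \<open>The Alexander-Whitney product: front and back part share the entry at position
  \<open>m\<close>. The product inside \<open>cup\<close> is the case \<open>m = 2\<close>.\<close>

definition cup_cochain :: "nat \<Rightarrow> ('p, complex) cochain \<Rightarrow> ('p, complex) cochain \<Rightarrow> ('p, complex) cochain" where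
  "cup_cochain m a b = (\<lambda>xs p. a (take (Suc m) xs) p * b (drop m xs) p)"

text \<open>The Leibniz rule. The induction on \<open>m\<close> moves the first vertex into
  \<open>a\<close>, each time changing the sign, until the front part is a single vertex; the length
  bound ensures that \<open>take (m + 2) xs\<close> is a full simplex.\<close>

lemma coboundary_cup_cochain:
  assumes "m + 2 \<le> length xs"
  shows "add_coboundary (cup_cochain m a b) xs p =
    add_coboundary a (take (m + 2) xs) p * b (drop (Suc m) xs) p +
    (- 1) ^ m * (a (take (Suc m) xs) p * add_coboundary b (drop m xs) p)"
  using assms
proof (induction m arbitrary: a xs)
  case 0
  then obtain x y ys where xs: "xs = x # y # ys"
    by (auto simp: numeral_2_eq_2 Suc_le_length_iff)
  have eq: "(\<lambda>zs. cup_cochain 0 a b (x # zs)) = (\<lambda>zs p. a [x] p * b (x # zs) p)"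
    by (simp add: cup_cochain_def)
  show ?case
    \<comment> \<open>Only the vertex \<open>x\<close> is split off at first, so that the scalar
      \<open>a [x] p\<close> can leave the remaining coboundary before that is expanded.\<close>
    by (simp only: xs add_coboundary_Cons [of _ x] eq add_coboundary_cmult)
       (simp add: cup_cochain_def numeral_2_eq_2 algebra_simps)
next
  case (Suc m)
  then obtain x ys where xs: "xs = x # ys" "m + 2 \<le> length ys"
    by (cases xs) auto
  have eq: "(\<lambda>zs. cup_cochain (Suc m) a b (x # zs)) = cup_cochain m (\<lambda>zs. a (x # zs)) b"
    by (simp add: cup_cochain_def)
  have "add_coboundary (cup_cochain (Suc m) a b) xs p = cup_cochain (Suc m) a b ys p
      - add_coboundary (cup_cochain m (\<lambda>zs. a (x # zs)) b) ys p"
    by (simp add: xs(1) eq)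
  then show ?case
    using Suc.IH [OF xs(2), of "\<lambda>zs. a (x # zs)"]
    by (simp add: xs(1) cup_cochain_def algebra_simps)
qed

lemma take_simplices: "xs \<in> simplices X (m + n) \<Longrightarrow> take (Suc m) xs \<in> simplices X m"
  by (auto simp: simplices_def dest: in_set_takeD)

lemma drop_simplices: "xs \<in> simplices X (m + n) \<Longrightarrow> drop m xs \<in> simplices X n"
  by (auto simp: simplices_def dest: in_set_dropD)

lemma overlap_take: "overlap U xs \<subseteq> overlap U (take k xs)"
  by (auto simp: overlap_def dest: in_set_takeD)

lemma overlap_drop: "overlap U xs \<subseteq> overlap U (drop k xs)"
  by (auto simp: overlap_def dest: in_set_dropD)

lemma agree_cup_cochain:
  assumes "agree X m a a'" "agree X n b b'"
  shows "agree X (m + n) (cup_cochain m a b) (cup_cochain m a' b')"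
proof -
  obtain U where U: "U \<in> point_covers X" "\<And>xs p. xs \<in> simplices X m \<Longrightarrow> p \<in> overlap U xs \<Longrightarrow> a xs p = a' xs p"
    using assms(1) by (auto simp: agree_def)
  obtain V where V: "V \<in> point_covers X" "\<And>xs p. xs \<in> simplices X n \<Longrightarrow> p \<in> overlap V xs \<Longrightarrow> b xs p = b' xs p"
    using assms(2) by (auto simp: agree_def)
  show ?thesis
    unfolding agree_def
  proof (intro bexI [OF _ point_covers_Int [OF U(1) V(1)]] ballI)
    fix xs p assume xs: "xs \<in> simplices X (m + n)" and "p \<in> overlap (\<lambda>x. U x \<inter> V x) xs"
    then have "p \<in> overlap U (take (Suc m) xs)" "p \<in> overlap V (drop m xs)"
      using overlap_take [of U xs] overlap_drop [of V xs] by auto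
    then show "cup_cochain m a b xs p = cup_cochain m a' b' xs p"
      using U(2) [OF take_simplices [OF xs]] V(2) [OF drop_simplices [OF xs]]
      by (simp add: cup_cochain_def)
  qed
qed

lemma agree_coboundary_cup_cochain:
  "agree X (Suc (m + n)) (add_coboundary (cup_cochain m a b))
    (\<lambda>xs p. cup_cochain (Suc m) (add_coboundary a) b xs p + (- 1) ^ m * cup_cochain m a (add_coboundary b) xs p)"
  unfolding agree_def
proof (intro bexI ballI)
  fix xs p assume "xs \<in> simplices X (Suc (m + n))"
  then have "m + 2 \<le> length xs" by (simp add: simplices_def)
  from coboundary_cup_cochain [OF this, of a b p]
  show "add_coboundary (cup_cochain m a b) xs p = cup_cochain (Suc m) (add_coboundary a) b xs p
      + (- 1) ^ m * cup_cochain m a (add_coboundary b) xs p"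
    by (simp add: cup_cochain_def)
qed (auto simp: point_covers_def intro: openin_topspace)

locale ring_sheaf = additive_sheaf X F for X :: "'p topology" and F :: "('p, complex) sheaf" +
  assumes sheaf_mult: "openin X W \<Longrightarrow> f \<in> F W \<Longrightarrow> g \<in> F W \<Longrightarrow> (\<lambda>p. f p * g p) \<in> F W"
begin

lemma cup_cochains:
  assumes "a \<in> coch m" "b \<in> coch n"
  shows "cup_cochain m a b \<in> coch (m + n)"
proof -
  obtain U where U: "U \<in> point_covers X" "\<And>xs. xs \<in> simplices X m \<Longrightarrow> a xs \<in> F (overlap U xs)"
    "\<And>xs. xs \<in> simplices X n \<Longrightarrow> b xs \<in> F (overlap U xs)"
    using cochains_common_cover [OF assms] by metis
  show ?thesis
  proof (rule cochainsI [OF _ U(1)])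
    fix xs assume xs: "xs \<in> simplices X (m + n)"
    show "cup_cochain m a b xs \<in> F (overlap U xs)"
      unfolding cup_cochain_def
      by (intro sheaf_mult openin_overlap [OF U(1) xs]
          sheaf_restrict [OF U(2) [OF take_simplices [OF xs]] overlap_take]
          sheaf_restrict [OF U(3) [OF drop_simplices [OF xs]] overlap_drop])
  qed simp
qed

lemma agree_add_coboundary: "c \<in> cyc q \<Longrightarrow> agree X (Suc q) (add_coboundary c) (\<lambda>xs p. 0)"
  using agree_coboundary_cocycle [of c q] by simp

lemma cup_cocycles:
  assumes "a \<in> cyc m" "b \<in> cyc n"
  shows "cup_cochain m a b \<in> cyc (m + n)"
proof (rule cocyclesI)
  show "cup_cochain m a b \<in> coch (m + n)"
    using assms cocycles_cochains cup_cochains by blast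
  have "agree X (Suc m + n) (cup_cochain (Suc m) (add_coboundary a) b) (cup_cochain (Suc m) (\<lambda>xs p. 0) b)"
    by (rule agree_cup_cochain [OF agree_add_coboundary [OF assms(1)] agree_refl])
  moreover have "agree X (m + Suc n) (cup_cochain m a (add_coboundary b)) (cup_cochain m a (\<lambda>xs p. 0))"
    by (rule agree_cup_cochain [OF agree_refl agree_add_coboundary [OF assms(2)]])
  ultimately have "agree X (Suc (m + n))
      (\<lambda>xs p. cup_cochain (Suc m) (add_coboundary a) b xs p + (- 1) ^ m * cup_cochain m a (add_coboundary b) xs p)
      (\<lambda>xs p. 0)"
    unfolding add_Suc add_Suc_right by (rule agree_cong2) (auto simp: cup_cochain_def)
  then show "agree X (Suc (m + n)) (add_coboundary (cup_cochain m a b)) (\<lambda>xs p. \<one>\<^bsub>additive_group\<^esub>)"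
    using agree_trans [OF agree_coboundary_cup_cochain] by simp
qed

text \<open>If \<open>a\<close> and \<open>a'\<close> differ by the coboundary of \<open>e\<close>,
  the products with the cocycle \<open>b\<close> differ by the coboundary of \<open>e\<close> cup
  \<open>b\<close>, as the other Leibniz term vanishes.\<close>

lemma cls_cup_left:
  assumes "a \<in> cyc (Suc m)" "a' \<in> cyc (Suc m)" "b \<in> cyc n" "cls (Suc m) a = cls (Suc m) a'"
  shows "cls (Suc (m + n)) (cup_cochain (Suc m) a b) = cls (Suc (m + n)) (cup_cochain (Suc m) a' b)"
proof -
  obtain e where e: "e \<in> coch m" "agree X (Suc m) a (\<lambda>xs p. a' xs p + add_coboundary e xs p)"
    using cls_eqE [OF assms(1,2,4)] .
  have "agree X (m + Suc n) (cup_cochain m e (add_coboundary b)) (cup_cochain m e (\<lambda>xs p. 0))"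
    by (rule agree_cup_cochain [OF agree_refl agree_add_coboundary [OF assms(3)]])
  with agree_coboundary_cup_cochain [of X m n e b]
  have "agree X (Suc (m + n)) (add_coboundary (cup_cochain m e b)) (cup_cochain (Suc m) (add_coboundary e) b)"
    unfolding add_Suc_right by (rule agree_cong2) (auto simp: cup_cochain_def)
  with agree_cup_cochain [OF e(2) agree_refl, of n b]
  have "agree X (Suc (m + n)) (cup_cochain (Suc m) a b)
      (\<lambda>xs p. cup_cochain (Suc m) a' b xs p + add_coboundary (cup_cochain m e b) xs p)"
    unfolding add_Suc by (rule agree_cong2) (simp add: cup_cochain_def algebra_simps)
  with cup_cocycles [OF assms(2,3)] cup_cochains [OF e(1) cocycles_cochains [OF assms(3)]]
  show ?thesis unfolding add_Suc by (rule cls_eqI(2))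
qed

lemma cls_cup_right:
  assumes "a \<in> cyc m" "b \<in> cyc (Suc n)" "b' \<in> cyc (Suc n)" "cls (Suc n) b = cls (Suc n) b'"
  shows "cls (Suc (m + n)) (cup_cochain m a b) = cls (Suc (m + n)) (cup_cochain m a b')"
proof -
  obtain e where e: "e \<in> coch n" "agree X (Suc n) b (\<lambda>xs p. b' xs p + add_coboundary e xs p)"
    using cls_eqE [OF assms(2-4)] .
  \<comment> \<open>As \<open>a\<close> is closed, the coboundary of \<open>a\<close> cup
    \<open>e\<close> is \<open>(- 1) ^ m\<close> times \<open>a\<close> cup the coboundary of
    \<open>e\<close>. The sign is absorbed into the primitive.\<close>
  define e' where "e' = (if even m then cup_cochain m a e else (\<lambda>xs p. - cup_cochain m a e xs p))"
  have e': "e' \<in> coch (m + n)"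
    using cup_cochains [OF cocycles_cochains [OF assms(1)] e(1)] coch_uminus by (simp add: e'_def)
  have "add_coboundary e' xs p = (- 1) ^ m * add_coboundary (cup_cochain m a e) xs p" for xs p
    by (simp add: e'_def add_coboundary_uminus)
  moreover have "agree X (Suc m + n) (cup_cochain (Suc m) (add_coboundary a) e) (cup_cochain (Suc m) (\<lambda>xs p. 0) e)"
    by (rule agree_cup_cochain [OF agree_add_coboundary [OF assms(1)] agree_refl])
  with agree_coboundary_cup_cochain [of X m n a e]
  have "agree X (Suc (m + n)) (add_coboundary (cup_cochain m a e))
      (\<lambda>xs p. (- 1) ^ m * cup_cochain m a (add_coboundary e) xs p)"
    unfolding add_Suc by (rule agree_cong2) (auto simp: cup_cochain_def)
  ultimately have "agree X (Suc (m + n)) (add_coboundary e') (cup_cochain m a (add_coboundary e))"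
    by (auto elim!: agree_cong simp flip: mult.assoc power_mult_distrib)
  with agree_cup_cochain [OF agree_refl e(2), of m a]
  have "agree X (Suc (m + n)) (cup_cochain m a b) (\<lambda>xs p. cup_cochain m a b' xs p + add_coboundary e' xs p)"
    unfolding add_Suc_right by (rule agree_cong2) (simp add: cup_cochain_def algebra_simps)
  with cup_cocycles [OF assms(1,3)] e'
  show ?thesis unfolding add_Suc_right by (rule cls_eqI(2))
qed

text \<open>The front-back product is not commutative on cochains. For closed \<open>a\<close> and
  \<open>b\<close> of degree 2 the two orders differ by the coboundary of \<open>e\<close>; both
  degrees being even, no sign appears.\<close>

lemma cls_cup_commute:
  assumes "a \<in> cyc 2" "b \<in> cyc 2"
  shows "cls 4 (cup_cochain 2 a b) = cls 4 (cup_cochain 2 b a)"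
proof -
  \<comment> \<open>Steenrod's cup-1 product\<close>
  define e where "e = (\<lambda>xs p. a (face 2 xs) p * b (face 0 xs) p - a (face 1 xs) p * b (face 3 xs) p)"
  have e: "e \<in> coch 3"
  proof -
    obtain U where U: "U \<in> point_covers X" "\<And>xs. xs \<in> simplices X 2 \<Longrightarrow> a xs \<in> F (overlap U xs)"
      "\<And>xs. xs \<in> simplices X 2 \<Longrightarrow> b xs \<in> F (overlap U xs)"
      using cochains_common_cover [OF cocycles_cochains [OF assms(1)] cocycles_cochains [OF assms(2)]] by metis
    show ?thesis
    proof (rule cochainsI [OF _ U(1)])
      fix xs assume xs: "xs \<in> simplices X 3"
      then have "face i xs \<in> simplices X 2" if "i \<le> 3" for i
        using that by (intro face_simplices) (simp_all add: simplices_def eval_nat_numeral)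
      then have ab: "a (face i xs) \<in> F (overlap U xs)" "b (face i xs) \<in> F (overlap U xs)" if "i \<le> 3" for i
        using U(2,3) that by (meson sheaf_restrict overlap_face)+
      note op = openin_overlap [OF U(1) xs]
      have "(\<lambda>p. a (face 2 xs) p * b (face 0 xs) p + - (a (face 1 xs) p * b (face 3 xs) p)) \<in> F (overlap U xs)"
        by (rule sheaf_add [OF op sheaf_mult [OF op] sheaf_uminus [OF op sheaf_mult [OF op]]]) (simp_all add: ab)
      then show "e xs \<in> F (overlap U xs)"
        by (simp add: e_def)
    qed simp
  qed
  have "agree X 4 (cup_cochain 2 a b) (\<lambda>xs p. cup_cochain 2 b a xs p + add_coboundary e xs p)"
  proof -
    obtain U where U: "U \<in> point_covers X"
      "\<And>xs p. xs \<in> simplices X 3 \<Longrightarrow> p \<in> overlap U xs \<Longrightarrow> add_coboundary a xs p = 0"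
      using agree_add_coboundary [OF assms(1)] by (auto simp: agree_def)
    obtain V where V: "V \<in> point_covers X"
      "\<And>xs p. xs \<in> simplices X 3 \<Longrightarrow> p \<in> overlap V xs \<Longrightarrow> add_coboundary b xs p = 0"
      using agree_add_coboundary [OF assms(2)] by (auto simp: agree_def)
    show ?thesis
      unfolding agree_def
    proof (intro bexI [OF _ point_covers_Int [OF U(1) V(1)]] ballI)
      fix xs p assume xs: "xs \<in> simplices X 4" and p: "p \<in> overlap (\<lambda>x. U x \<inter> V x) xs"
      then obtain x0 x1 x2 x3 x4 where x: "xs = [x0, x1, x2, x3, x4]"
        by (auto simp: simplices_def eval_nat_numeral length_Suc_conv)
      \<comment> \<open>The cocycle condition on \<open>[x0, x, y, z]\<close> eliminates every value
        on a triple that avoids \<open>x0\<close>. After that the claim is a polynomial identity in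
        the remaining values.\<close>
      have ra: "a [x, y, z] p = a [x0, y, z] p - a [x0, x, z] p + a [x0, x, y] p"
        and rb: "b [x, y, z] p = b [x0, y, z] p - b [x0, x, z] p + b [x0, x, y] p"
        if "{x, y, z} \<subseteq> {x1, x2, x3, x4}" for x y z
        using that xs p U(2) [of "[x0, x, y, z]" p] V(2) [of "[x0, x, y, z]" p]
        by (auto simp: x simplices_def algebra_simps)
      note r = ra [of x1 x2 x3] ra [of x1 x2 x4] ra [of x1 x3 x4] ra [of x2 x3 x4]
        rb [of x1 x2 x3] rb [of x1 x2 x4] rb [of x1 x3 x4] rb [of x2 x3 x4]
      show "cup_cochain 2 a b xs p = cup_cochain 2 b a xs p + add_coboundary e xs p"
        by (simp add: x cup_cochain_def e_def face_def eval_nat_numeral) (simp add: r algebra_simps)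
    qed
  qed
  with cup_cocycles [OF assms(2,1)] e show ?thesis
    using cls_eqI(2) [of "cup_cochain 2 b a" 3 e "cup_cochain 2 a b"] by (simp add: eval_nat_numeral)
qed

lemma coch_scale:
  assumes "\<And>W. openin X W \<Longrightarrow> (\<lambda>p. r) \<in> F W" "c \<in> coch q"
  shows "(\<lambda>xs p. r * c xs p) \<in> coch q"
proof -
  obtain U where U: "U \<in> point_covers X" "\<And>xs. xs \<in> simplices X q \<Longrightarrow> c xs \<in> F (overlap U xs)"
    using assms(2) by (auto simp: cochains_def)
  show ?thesis
    by (rule cochainsI [OF _ U(1)]) (simp_all add: U assms(1) sheaf_mult openin_overlap [OF U(1)])
qed

lemma cyc_scale:
  assumes "\<And>W. openin X W \<Longrightarrow> (\<lambda>p. r) \<in> F W" "c \<in> cyc q"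
  shows "(\<lambda>xs p. r * c xs p) \<in> cyc q"
proof (rule cocyclesI [OF coch_scale [OF assms(1) cocycles_cochains [OF assms(2)]]])
  show "agree X (Suc q) (add_coboundary (\<lambda>xs p. r * c xs p)) (\<lambda>xs p. \<one>\<^bsub>additive_group\<^esub>)"
    by (rule agree_cong [OF agree_add_coboundary [OF assms(2)]]) (simp add: add_coboundary_cmult)
qed

end

section \<open>Holomorphic functions\<close>

lemma ring_sheaf_locally_constant:
  assumes "0 \<in> A" "\<And>a b. a \<in> A \<Longrightarrow> b \<in> A \<Longrightarrow> a - b \<in> A" "\<And>a b. a \<in> A \<Longrightarrow> b \<in> A \<Longrightarrow> a * b \<in> A"
  shows "ring_sheaf X (locally_constant X A)"
proof -
  interpret additive_sheaf X "locally_constant X A"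
    using assms(1,2) by (rule additive_sheaf_locally_constant)
  show ?thesis
    by unfold_locales (rule locally_constant_combine [where h = "(*)"]; (assumption | rule assms))
qed

lemma holo_on_compose:
  assumes "holo_on f V" "\<And>z. z \<in> V \<Longrightarrow> g field_differentiable at (f z)"
  shows "holo_on (\<lambda>z. g (f z)) V"
  unfolding holo_on_def
proof
  fix z assume z: "z \<in> V"
  obtain D where D: "(f has_derivative D) (at z)" "\<forall>a v. D (a *s v) = a * D v"
    using assms(1) z by (auto simp: holo_on_def)
  obtain g' where "(g has_field_derivative g') (at (f z))"
    using assms(2) [OF z] by (auto simp: field_differentiable_def)
  then have "((\<lambda>z. g (f z)) has_derivative (\<lambda>v. g' * D v)) (at z)"
    using has_derivative_compose [OF D(1)] by (auto simp: has_field_derivative_def)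
  then show "\<exists>D. ((\<lambda>z. g (f z)) has_derivative D) (at z) \<and> (\<forall>a v. D (a *s v) = a * D v)"
    using D(2) by (intro exI [of _ "\<lambda>v. g' * D v"]) simp
qed

lemma holo_on_const: "holo_on (\<lambda>z. c) V"
  unfolding holo_on_def by (auto intro!: exI [of _ "\<lambda>_. 0"])

lemma holo_on_add:
  assumes "holo_on f V" "holo_on g V"
  shows "holo_on (\<lambda>z. f z + g z) V"
  unfolding holo_on_def
proof
  fix z assume z: "z \<in> V"
  obtain D where D: "(f has_derivative D) (at z)" "\<forall>a v. D (a *s v) = a * D v"
    using assms(1) z unfolding holo_on_def by blast
  obtain E where E: "(g has_derivative E) (at z)" "\<forall>a v. E (a *s v) = a * E v"
    using assms(2) z unfolding holo_on_def by blast
  from D E show "\<exists>D. ((\<lambda>z. f z + g z) has_derivative D) (at z) \<and> (\<forall>a v. D (a *s v) = a * D v)"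
    by (intro exI [of _ "\<lambda>v. D v + E v"]) (auto intro: has_derivative_add simp: distrib_left)
qed

lemma holo_on_mult:
  assumes "holo_on f V" "holo_on g V"
  shows "holo_on (\<lambda>z. f z * g z) V"
  unfolding holo_on_def
proof
  fix z assume z: "z \<in> V"
  obtain D where D: "(f has_derivative D) (at z)" "\<forall>a v. D (a *s v) = a * D v"
    using assms(1) z unfolding holo_on_def by blast
  obtain E where E: "(g has_derivative E) (at z)" "\<forall>a v. E (a *s v) = a * E v"
    using assms(2) z unfolding holo_on_def by blast
  from D E show "\<exists>D. ((\<lambda>z. f z * g z) has_derivative D) (at z) \<and> (\<forall>a v. D (a *s v) = a * D v)"
    by (intro exI [of _ "\<lambda>v. f z * E v + D v * g z"] conjI has_derivative_mult)
       (simp_all add: algebra_simps)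
qed

text \<open>
  For a \<^const>\<open>complex_manifold\<close>, sections over sets that lie in no chart need not restrict to
  sections over smaller open sets.  The fibres of a family do have this property.
\<close>

locale complex_space =
  fixes S :: "'p cspace" and n :: "'n::finite itself"
  assumes manifold: "complex_manifold n S"
    and hol_restrict: "f \<in> hol S W \<Longrightarrow> V \<subseteq> W \<Longrightarrow> f \<in> hol S V"
    and hol_cong: "f \<in> hol S W \<Longrightarrow> (\<And>p. p \<in> W \<Longrightarrow> f p = g p) \<Longrightarrow> g \<in> hol S W"
begin

abbreviation "X \<equiv> topol S"

lemma hol_local:
  assumes "openin X W" "\<And>p. p \<in> W \<Longrightarrow> \<exists>V. openin X V \<and> p \<in> V \<and> V \<subseteq> W \<and> f \<in> hol S V"
  shows "f \<in> hol S W"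
proof -
  have "\<forall>W f. openin X W \<longrightarrow> (f \<in> hol S W \<longleftrightarrow>
      (\<forall>p\<in>W. \<exists>V. openin X V \<and> p \<in> V \<and> V \<subseteq> W \<and> f \<in> hol S V))"
    using manifold unfolding complex_manifold_def by blast
  then show ?thesis using assms by blast
qed

lemma chart_exists:
  assumes "p \<in> topspace X"
  obtains U and \<psi> :: "'p \<Rightarrow> complex ^ 'n" where "p \<in> U" "cchart S U \<psi>"
proof -
  have "\<exists>U (\<psi> :: 'p \<Rightarrow> complex ^ 'n). p \<in> U \<and> cchart S U \<psi>"
    using manifold assms unfolding complex_manifold_def by blast
  then show ?thesis using that by blast
qed

lemma hol_chart:
  fixes \<psi> :: "'p \<Rightarrow> complex ^ 'n"
  assumes "cchart S U \<psi>" "openin X W" "f \<in> hol S W"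
  shows "holo_on (f \<circ> inv_into U \<psi>) (\<psi> ` (U \<inter> W))"
  using assms hol_restrict [of f W "U \<inter> W"] unfolding cchart_def by auto

lemma hol_by_charts:
  assumes W: "openin X W"
    and "\<And>U (\<psi> :: 'p \<Rightarrow> complex ^ 'n). cchart S U \<psi> \<Longrightarrow> holo_on (f \<circ> inv_into U \<psi>) (\<psi> ` (U \<inter> W))"
  shows "f \<in> hol S W"
proof (rule hol_local [OF W])
  fix p assume p: "p \<in> W"
  then have "p \<in> topspace X" using W openin_subset by blast
  then obtain U and \<psi> :: "'p \<Rightarrow> complex ^ 'n" where U: "p \<in> U" "cchart S U \<psi>"
    by (rule chart_exists)
  moreover have "openin X (U \<inter> W)"
    using U(2) W by (auto simp: cchart_def)
  moreover have "f \<in> hol S (U \<inter> W)"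
    using assms(2) [OF U(2)] U(2) calculation(3) unfolding cchart_def by auto
  ultimately show "\<exists>V. openin X V \<and> p \<in> V \<and> V \<subseteq> W \<and> f \<in> hol S V"
    using p by blast
qed

lemma chart_inv:
  fixes \<psi> :: "'p \<Rightarrow> complex ^ 'n"
  assumes "cchart S U \<psi>" "p \<in> U"
  shows "inv_into U \<psi> (\<psi> p) = p"
proof -
  have "inj_on \<psi> U"
    using assms(1) openin_subset unfolding cchart_def homeomorphic_eq_everything_map
    by (metis topspace_subtopology_subset)
  then show ?thesis using assms(2) by simp
qed

lemma hol_const: "openin X W \<Longrightarrow> (\<lambda>p. c) \<in> hol S W"
  by (rule hol_by_charts) (simp_all add: o_def holo_on_const)

lemma hol_add:
  assumes "openin X W" "f \<in> hol S W" "g \<in> hol S W"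
  shows "(\<lambda>p. f p + g p) \<in> hol S W"
proof (rule hol_by_charts [OF assms(1)])
  fix U and \<psi> :: "'p \<Rightarrow> complex ^ 'n"
  assume U: "cchart S U \<psi>"
  have "holo_on (\<lambda>z. (f \<circ> inv_into U \<psi>) z + (g \<circ> inv_into U \<psi>) z) (\<psi> ` (U \<inter> W))"
    by (rule holo_on_add [OF hol_chart [OF U assms(1,2)] hol_chart [OF U assms(1,3)]])
  then show "holo_on ((\<lambda>p. f p + g p) \<circ> inv_into U \<psi>) (\<psi> ` (U \<inter> W))"
    by (simp add: o_def)
qed

lemma hol_mult:
  assumes "openin X W" "f \<in> hol S W" "g \<in> hol S W"
  shows "(\<lambda>p. f p * g p) \<in> hol S W"
proof (rule hol_by_charts [OF assms(1)])
  fix U and \<psi> :: "'p \<Rightarrow> complex ^ 'n"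
  assume U: "cchart S U \<psi>"
  have "holo_on (\<lambda>z. (f \<circ> inv_into U \<psi>) z * (g \<circ> inv_into U \<psi>) z) (\<psi> ` (U \<inter> W))"
    by (rule holo_on_mult [OF hol_chart [OF U assms(1,2)] hol_chart [OF U assms(1,3)]])
  then show "holo_on ((\<lambda>p. f p * g p) \<circ> inv_into U \<psi>) (\<psi> ` (U \<inter> W))"
    by (simp add: o_def)
qed

lemma hol_compose:
  assumes "openin X W" "f \<in> hol S W" "\<And>p. p \<in> W \<Longrightarrow> g field_differentiable at (f p)"
  shows "(\<lambda>p. g (f p)) \<in> hol S W"
proof (rule hol_by_charts [OF assms(1)])
  fix U and \<psi> :: "'p \<Rightarrow> complex ^ 'n"
  assume U: "cchart S U \<psi>"
  have "holo_on (\<lambda>z. g ((f \<circ> inv_into U \<psi>) z)) (\<psi> ` (U \<inter> W))"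
    by (rule holo_on_compose [OF hol_chart [OF U assms(1,2)]]) (use assms(3) chart_inv [OF U] in auto)
  then show "holo_on ((\<lambda>p. g (f p)) \<circ> inv_into U \<psi>) (\<psi> ` (U \<inter> W))"
    by (simp add: o_def)
qed

text \<open>Differentiability in a chart gives continuity on the chart image; the preimage of
  \<open>A\<close> is carried back to an open set of \<open>X\<close> by the chart
  homeomorphism.\<close>

lemma hol_continuous:
  assumes "openin X W" "f \<in> hol S W" "p \<in> W" "open A" "f p \<in> A"
  obtains V where "openin X V" "p \<in> V" "V \<subseteq> W" "f ` V \<subseteq> A"
proof -
  have "p \<in> topspace X" using assms openin_subset by blast
  then obtain U and \<psi> :: "'p \<Rightarrow> complex ^ 'n" where U: "p \<in> U" "cchart S U \<psi>"
    by (rule chart_exists)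
  have opU: "openin X U" and opsi: "open (\<psi> ` U)"
    and hom: "homeomorphic_map (subtopology X U) (top_of_set (\<psi> ` U)) \<psi>"
    using U(2) by (auto simp: cchart_def)
  have "openin (subtopology X U) (U \<inter> W)"
    using assms(1) openin_subtopology_Int2 by blast
  then have "openin (top_of_set (\<psi> ` U)) (\<psi> ` (U \<inter> W))"
    using hom homeomorphic_imp_open_map open_map_def by blast
  then have op: "open (\<psi> ` (U \<inter> W))"
    using opsi openin_open_trans by blast
  have "continuous_on (\<psi> ` (U \<inter> W)) (f \<circ> inv_into U \<psi>)"
    using hol_chart [OF U(2) assms(1,2)] unfolding holo_on_def
    by (intro continuous_at_imp_continuous_on ballI) (meson has_derivative_continuous)
  then have "open (\<psi> ` (U \<inter> W) \<inter> (f \<circ> inv_into U \<psi>) -` A)"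
    using op assms(4) by (meson continuous_on_open_vimage Int_commute open_Int continuous_open_preimage)
  moreover have "continuous_map (subtopology X U) euclidean \<psi>"
    using hom homeomorphic_imp_continuous_map continuous_map_in_subtopology by blast
  ultimately have "openin (subtopology X U)
      {q \<in> topspace (subtopology X U). \<psi> q \<in> \<psi> ` (U \<inter> W) \<inter> (f \<circ> inv_into U \<psi>) -` A}"
    by (intro openin_continuous_map_preimage) auto
  then have "openin X {q \<in> topspace (subtopology X U). \<psi> q \<in> \<psi> ` (U \<inter> W) \<inter> (f \<circ> inv_into U \<psi>) -` A}"
    using opU openin_trans_full by blast
  moreover have "{q \<in> topspace (subtopology X U). \<psi> q \<in> \<psi> ` (U \<inter> W) \<inter> (f \<circ> inv_into U \<psi>) -` A}
      = {q \<in> U \<inter> W. f q \<in> A}"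
  proof -
    have "\<psi> q = \<psi> r \<longleftrightarrow> q = r" if "q \<in> U" "r \<in> U" for q r
      using chart_inv [OF U(2)] that by metis
    then show ?thesis
      using openin_subset [OF opU] chart_inv [OF U(2)] by auto
  qed
  ultimately show ?thesis
    using that [of "{q \<in> U \<inter> W. f q \<in> A}"] U(1) assms(3,5) by auto
qed

lemma hol_units_local_log:
  assumes "openin X W" "f \<in> hol_units S W" "p \<in> W"
  obtains V l where "openin X V" "p \<in> V" "V \<subseteq> W" "l \<in> hol S V"
    "\<And>q. q \<in> V \<Longrightarrow> exp (2 * of_real pi * \<i> * l q) = f q"
proof -
  have f: "f \<in> hol S W" "f p \<noteq> 0"
    using assms by (auto simp: hol_units_def)
  \<comment> \<open>On this half-plane \<open>w / f p\<close> has positive real part and stays off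
    the branch cut, so \<open>Ln (w / f p)\<close> is holomorphic there. The constant
    \<open>Ln (f p)\<close> in \<open>g\<close> below restores the factor
    \<open>f p\<close>.\<close>
  define A where "A = {w. 0 < Re (w / f p)}"
  have "open A"
    unfolding A_def by (intro open_Collect_less continuous_intros) (use f in auto)
  moreover have "f p \<in> A" using f by (simp add: A_def)
  ultimately obtain V where V: "openin X V" "p \<in> V" "V \<subseteq> W" "f ` V \<subseteq> A"
    using hol_continuous [OF assms(1) f(1) assms(3)] by blast
  define g where "g w = (Ln (w / f p) + Ln (f p)) / (2 * of_real pi * \<i>)" for w
  have "(\<lambda>q. g (f q)) \<in> hol S V"
  proof (rule hol_compose [OF V(1) hol_restrict [OF f(1) V(3)]])
    fix q assume "q \<in> V"
    then have "f q / f p \<notin> \<real>\<^sub>\<le>\<^sub>0"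
      using V(4) by (auto simp: A_def complex_nonpos_Reals_iff)
    then show "g field_differentiable at (f q)"
      unfolding g_def field_differentiable_def using f(2)
      by (auto intro!: exI derivative_eq_intros)
  qed
  moreover have "exp (2 * of_real pi * \<i> * g (f q)) = f q" if "q \<in> V" for q
  proof -
    have "f q \<noteq> 0"
      using assms(2) V(3) that by (auto simp: hol_units_def)
    then show ?thesis
      using f(2) by (simp add: g_def exp_add)
  qed
  ultimately show ?thesis
    using that [OF V(1-3), of "\<lambda>q. g (f q)"] by blast
qed

lemma locally_constant_hol:
  assumes "openin X W" "f \<in> locally_constant X A W"
  shows "f \<in> hol S W"
proof (rule hol_local [OF assms(1)])
  fix p assume p: "p \<in> W"
  obtain V where V: "openin X V" "p \<in> V" "\<forall>q\<in>V \<inter> W. f q = f p"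
    using assms(2) p unfolding locally_constant_def by blast
  have "(\<lambda>q. f p) \<in> hol S (V \<inter> W)"
    using V(1) assms(1) by (intro hol_const) auto
  then have "f \<in> hol S (V \<inter> W)"
    using V(3) by (rule_tac hol_cong) auto
  then show "\<exists>V. openin X V \<and> p \<in> V \<and> V \<subseteq> W \<and> f \<in> hol S V"
    using V p assms(1) by (intro exI [of _ "V \<inter> W"]) auto
qed

sublocale ZS: ring_sheaf X "locally_constant X \<int>"
  by (rule ring_sheaf_locally_constant) auto

sublocale QS: ring_sheaf X "locally_constant X \<rat>"
  by (rule ring_sheaf_locally_constant) auto

sublocale OS: ring_sheaf X "hol S"
proof
  show "(\<lambda>p. f p * g p) \<in> hol S W" if "openin X W" "f \<in> hol S W" "g \<in> hol S W" for f g W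
    using that by (rule hol_mult)
  show "(\<lambda>p. - f p) \<in> hol S W" if "openin X W" "f \<in> hol S W" for f W
    using hol_mult [OF that(1) hol_const [OF that(1), of "- 1"] that(2)] by simp
  show "(\<lambda>p. f p + g p) \<in> hol S W" if "openin X W" "f \<in> hol S W" "g \<in> hol S W" for f g W
    using that by (rule hol_add)
  show "(\<lambda>p. 0) \<in> hol S W" if "openin X W" for W
    using that by (rule hol_const)
qed (rule hol_restrict hol_cong; assumption)+

sublocale US: coeff_sheaf unit_group X "hol_units S"
proof (intro coeff_sheaf.intro comm_group_unit_group coeff_sheaf_axioms.intro)
  show cong: "g \<in> hol_units S W" if "f \<in> hol_units S W" "\<And>p. p \<in> W \<Longrightarrow> f p = g p" for f g W
  proof -
    have f: "f \<in> hol S W" "\<And>p. p \<in> W \<Longrightarrow> f p \<noteq> 0"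
      using that(1) by (simp_all add: hol_units_def)
    have "g \<in> hol S W"
      by (rule hol_cong [OF f(1) that(2)])
    moreover have "g p \<noteq> 0" if "p \<in> W" for p
      using f(2) [OF that] \<open>\<And>p. p \<in> W \<Longrightarrow> f p = g p\<close> [OF that] by simp
    ultimately show ?thesis by (simp add: hol_units_def)
  qed
  show "f \<in> hol_units S V" if "f \<in> hol_units S W" "V \<subseteq> W" for f V W
    using that hol_restrict [of f W V] by (auto simp: hol_units_def)
  show "(\<lambda>p. \<one>\<^bsub>unit_group\<^esub>) \<in> hol_units S W" if "openin X W" for W
    using hol_const [OF that] by (simp add: hol_units_def)
  show "(\<lambda>p. f p \<otimes>\<^bsub>unit_group\<^esub> g p) \<in> hol_units S W"
    if "openin X W" "f \<in> hol_units S W" "g \<in> hol_units S W" for f g W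
    using that hol_mult [of W f g] by (simp add: hol_units_def)
  show "(\<lambda>p. inv\<^bsub>unit_group\<^esub> f p) \<in> hol_units S W" if W: "openin X W" and f: "f \<in> hol_units S W" for f W
  proof (rule cong)
    have "f \<in> hol S W" "\<And>p. p \<in> W \<Longrightarrow> f p \<noteq> 0"
      using f by (simp_all add: hol_units_def)
    then have "(\<lambda>p. inverse (f p)) \<in> hol S W"
      by (intro hol_compose [OF W, of f inverse]) (auto simp: field_differentiable_def intro: DERIV_inverse)
    then show "(\<lambda>p. inverse (f p)) \<in> hol_units S W"
      using f by (simp add: hol_units_def)
  qed (use f in \<open>simp add: hol_units_def\<close>)
qed

end

section \<open>Maps on cohomology and the intersection pairing\<close>

lemma cochain_map_id:
  assumes "additive_sheaf X F" "additive_sheaf X F'" "\<And>W f. openin X W \<Longrightarrow> f \<in> F W \<Longrightarrow> f \<in> F' W"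
  shows "cochain_map additive_group X F additive_group X F' id"
proof -
  interpret F: additive_sheaf X F by fact
  interpret F': additive_sheaf X F' by fact
  show ?thesis
  proof
    fix c n assume c: "c \<in> cochains X additive_group F n"
    then obtain U where U: "U \<in> point_covers X" "\<And>xs. xs \<in> simplices X n \<Longrightarrow> c xs \<in> F (overlap U xs)"
      by (auto simp: cochains_def)
    show "id c \<in> cochains X additive_group F' n"
      by (rule F'.cochainsI [OF _ U(1)]) (simp_all add: U assms(3) openin_overlap [OF U(1)])
  qed simp_all
qed

lemma coboundary_pull_cochain: "pull_cochain f (add_coboundary c) = add_coboundary (pull_cochain f c)"
proof (intro ext)
  fix ys q
  show "pull_cochain f (add_coboundary c) ys q = add_coboundary (pull_cochain f c) ys q"
  proof (induction ys arbitrary: c)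
    case (Cons y ys)
    have "pull_cochain f (add_coboundary c) (y # ys) q =
        pull_cochain f c ys q - pull_cochain f (add_coboundary (\<lambda>xs. c (f y # xs))) ys q"
      by (simp add: pull_cochain_def)
    also have "pull_cochain f (add_coboundary (\<lambda>xs. c (f y # xs))) ys q =
        add_coboundary (\<lambda>xs. pull_cochain f c (y # xs)) ys q"
      unfolding Cons by (simp add: pull_cochain_def)
    finally show ?case by simp
  qed (simp add: pull_cochain_def)
qed

text \<open>A cover indexed by points pulls back without any choice: the set attached to
  \<open>y\<close> is the preimage of the set attached to \<open>f y\<close>.\<close>

lemma pull_point_cover:
  assumes "continuous_map Y X f" "U \<in> point_covers X"
  shows "(\<lambda>y. {z \<in> topspace Y. f z \<in> U (f y)}) \<in> point_covers Y"
proof -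
  have "openin Y {z \<in> topspace Y. f z \<in> U (f y)} \<and> f y \<in> U (f y)" if y: "y \<in> topspace Y" for y
  proof -
    have "f y \<in> topspace X"
      using continuous_map_image_subset_topspace [OF assms(1)] y by blast
    then have U: "openin X (U (f y))" "f y \<in> U (f y)"
      using assms(2) by (auto simp: point_covers_def)
    then show ?thesis
      using openin_continuous_map_preimage [OF assms(1) U(1)] by simp
  qed
  then show ?thesis by (simp add: point_covers_def)
qed

lemma map_simplices:
  assumes "continuous_map Y X f" "ys \<in> simplices Y q"
  shows "map f ys \<in> simplices X q"
  using assms(2) continuous_map_image_subset_topspace [OF assms(1)]
  by (auto simp: simplices_def)

lemma overlap_pull:
  assumes "ys \<in> simplices Y q"
  shows "overlap (\<lambda>y. {z \<in> topspace Y. f z \<in> U (f y)}) ys = {z \<in> topspace Y. f z \<in> overlap U (map f ys)}"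
proof -
  have "ys \<noteq> []" using assms by (auto simp: simplices_def)
  then show ?thesis by (cases ys) (auto simp: overlap_def)
qed

lemma locally_constant_pull:
  assumes f: "continuous_map Y X f" and "g \<in> locally_constant X A W"
  shows "(\<lambda>q. g (f q)) \<in> locally_constant Y A {z \<in> topspace Y. f z \<in> W}"
  unfolding locally_constant_def
proof (intro CollectI ballI conjI)
  fix q assume q: "q \<in> {z \<in> topspace Y. f z \<in> W}"
  then show "g (f q) \<in> A"
    using assms(2) by (simp add: locally_constant_def)
  obtain V where V: "openin X V" "f q \<in> V" "\<forall>r\<in>V \<inter> W. g r = g (f q)"
    using assms(2) q unfolding locally_constant_def by blast
  have "openin Y {z \<in> topspace Y. f z \<in> V}"
    by (rule openin_continuous_map_preimage [OF f V(1)])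
  moreover have "q \<in> {z \<in> topspace Y. f z \<in> V}"
    using q V(2) by simp
  moreover have "\<forall>r\<in>{z \<in> topspace Y. f z \<in> V} \<inter> {z \<in> topspace Y. f z \<in> W}. g (f r) = g (f q)"
    using V(3) by blast
  ultimately show "\<exists>V. openin Y V \<and> q \<in> V \<and> (\<forall>r\<in>V \<inter> {z \<in> topspace Y. f z \<in> W}. g (f r) = g (f q))"
    by blast
qed

lemma cochain_map_pull:
  assumes f: "continuous_map Y X f"
    and "additive_sheaf X (locally_constant X A)" "additive_sheaf Y (locally_constant Y A)"
  shows "cochain_map additive_group X (locally_constant X A) additive_group Y (locally_constant Y A) (pull_cochain f)"
proof -
  interpret F: additive_sheaf X "locally_constant X A" by fact
  interpret F': additive_sheaf Y "locally_constant Y A" by fact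
  show ?thesis
  proof
    fix c n assume c: "c \<in> cochains X additive_group (locally_constant X A) n"
    then obtain U where U: "U \<in> point_covers X"
        "\<And>xs. xs \<in> simplices X n \<Longrightarrow> c xs \<in> locally_constant X A (overlap U xs)"
      by (auto simp: cochains_def)
    show "pull_cochain f c \<in> cochains Y additive_group (locally_constant Y A) n"
    proof (rule F'.cochainsI [OF _ pull_point_cover [OF f U(1)]])
      fix ys assume ys: "ys \<in> simplices Y n"
      show "pull_cochain f c ys \<in> locally_constant Y A (overlap (\<lambda>y. {z \<in> topspace Y. f z \<in> U (f y)}) ys)"
        unfolding overlap_pull [OF ys] pull_cochain_def
        by (rule locally_constant_pull [OF f U(2) [OF map_simplices [OF f ys]]])
    qed simp
  next
    fix c d n assume "agree X n c d"
    then obtain U where U: "U \<in> point_covers X"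
        "\<And>xs p. xs \<in> simplices X n \<Longrightarrow> p \<in> overlap U xs \<Longrightarrow> c xs p = d xs p"
      by (auto simp: agree_def)
    show "agree Y n (pull_cochain f c) (pull_cochain f d)"
      unfolding agree_def
    proof (intro bexI [OF _ pull_point_cover [OF f U(1)]] ballI)
      fix ys q assume ys: "ys \<in> simplices Y n"
        and "q \<in> overlap (\<lambda>y. {z \<in> topspace Y. f z \<in> U (f y)}) ys"
      then show "pull_cochain f c ys q = pull_cochain f d ys q"
        using U(2) [OF map_simplices [OF f ys]] unfolding overlap_pull [OF ys] pull_cochain_def by simp
    qed
  next
    fix c :: "('b, complex) cochain"
    show "pull_cochain f (add_coboundary c) = add_coboundary (pull_cochain f c)"
      by (rule coboundary_pull_cochain)
  qed (simp_all add: pull_cochain_def)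
qed

lemma pull_cochain_cup: "pull_cochain f (cup_cochain m a b) = cup_cochain m (pull_cochain f a) (pull_cochain f b)"
  by (simp add: pull_cochain_def cup_cochain_def take_map drop_map)

text \<open>\<open>g\<close> inverts \<open>f\<close> on the space only, and cochains are total
  functions, so the two sides agree on a cover but need not be equal.\<close>

lemma pull_cochain_inverse:
  assumes "\<And>y. y \<in> topspace Y \<Longrightarrow> g (f y) = y"
  shows "agree Y q (pull_cochain f (pull_cochain g c)) c"
  unfolding agree_def
proof (intro bexI ballI)
  show "(\<lambda>_. topspace Y) \<in> point_covers Y" by (simp add: point_covers_def)
  fix ys p assume ys: "ys \<in> simplices Y q" and "p \<in> overlap (\<lambda>_. topspace Y) ys"
  then have "p \<in> topspace Y"
    by (cases ys) (auto simp: simplices_def)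
  moreover have "map g (map f ys) = ys"
    using ys assms by (auto simp: simplices_def intro!: map_idI)
  ultimately show "pull_cochain f (pull_cochain g c) ys p = c ys p"
    using assms unfolding pull_cochain_def by simp
qed

context complex_space
begin

lemma cochain_map_Z_to_Q:
  "cochain_map additive_group X (locally_constant X (\<int> :: complex set)) additive_group X (locally_constant X \<rat>) id"
proof (rule cochain_map_id [OF ZS.additive_sheaf_axioms QS.additive_sheaf_axioms])
  show "f \<in> locally_constant X \<rat> W" if "f \<in> locally_constant X \<int> W" for f :: "'p \<Rightarrow> complex" and W
    using that Ints_subset_Rats by (rule locally_constant_mono)
qed

lemma cochain_map_Q_to_O:
  "cochain_map additive_group X (locally_constant X \<rat>) additive_group X (hol S) id"
  by (rule cochain_map_id [OF QS.additive_sheaf_axioms OS.additive_sheaf_axioms])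
     (rule locally_constant_hol)

lemma cochain_map_O_to_U:
  "cochain_map additive_group X (hol S) unit_group X (hol_units S) exp_cochain"
proof
  fix c n assume c: "c \<in> cochains X additive_group (hol S) n"
  then obtain U where U: "U \<in> point_covers X" "\<And>xs. xs \<in> simplices X n \<Longrightarrow> c xs \<in> hol S (overlap U xs)"
    by (auto simp: cochains_def)
  show "exp_cochain c \<in> cochains X unit_group (hol_units S) n"
  proof (rule US.cochainsI [OF _ U(1)])
    fix xs assume xs: "xs \<in> simplices X n"
    have "(\<lambda>p. exp (2 * of_real pi * \<i> * c xs p)) \<in> hol S (overlap U xs)"
      by (rule hol_compose [OF openin_overlap [OF U(1) xs] U(2) [OF xs], of "\<lambda>w. exp (2 * of_real pi * \<i> * w)"])
         (auto simp: field_differentiable_def intro!: exI derivative_eq_intros)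
    then show "exp_cochain c xs \<in> hol_units S (overlap U xs)"
      by (simp add: hol_units_def exp_cochain_def)
  qed simp
next
  fix c d :: "('p, complex) cochain" and n assume "agree X n c d"
  then show "agree X n (exp_cochain c) (exp_cochain d)"
    by (rule agree_cong) (simp add: exp_cochain_def)
qed (simp_all add: exp_cochain_coboundary, simp add: exp_cochain_def distrib_left exp_add)

lemma ZQ_cyc: "c \<in> ZS.cyc q \<Longrightarrow> c \<in> QS.cyc q"
  using cochain_map.map_cocycles [OF cochain_map_Z_to_Q] by simp

lemma QO_cyc: "c \<in> QS.cyc q \<Longrightarrow> c \<in> OS.cyc q"
  using cochain_map.map_cocycles [OF cochain_map_Q_to_O] by simp

lemma Z_to_Q_cls: "c \<in> ZS.cyc q \<Longrightarrow> Z_to_Q S q (ZS.cls q c) = QS.cls q c"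
  using cochain_map.induced_coh_class [OF cochain_map_Z_to_Q] by (simp add: Z_to_Q_def)

lemma Q_to_O_cls: "c \<in> QS.cyc q \<Longrightarrow> Q_to_O S q (QS.cls q c) = OS.cls q c"
  using cochain_map.induced_coh_class [OF cochain_map_Q_to_O] by (simp add: Q_to_O_def)

lemma O_to_U_cls:
  "c \<in> OS.cyc q \<Longrightarrow> O_to_U S q (OS.cls q c) = coh_class X unit_group (hol_units S) q (exp_cochain c)"
  using cochain_map.induced_coh_class [OF cochain_map_O_to_U] by (simp add: O_to_U_def)

lemma ZQ_cls_eq: "c \<in> ZS.cyc q \<Longrightarrow> d \<in> ZS.cyc q \<Longrightarrow> ZS.cls q c = ZS.cls q d \<Longrightarrow> QS.cls q c = QS.cls q d"
  using Z_to_Q_cls by metis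

lemma QO_cls_eq: "c \<in> QS.cyc q \<Longrightarrow> d \<in> QS.cyc q \<Longrightarrow> QS.cls q c = QS.cls q d \<Longrightarrow> OS.cls q c = OS.cls q d"
  using Q_to_O_cls by metis

lemma const_Q: "r \<in> \<rat> \<Longrightarrow> openin X W \<Longrightarrow> (\<lambda>p. r) \<in> locally_constant X \<rat> W"
  by (rule locally_constant_const)

lemma const_Z: "r \<in> \<int> \<Longrightarrow> openin X W \<Longrightarrow> (\<lambda>p. r) \<in> locally_constant X \<int> W"
  by (rule locally_constant_const)

end

section \<open>The intersection form attached to a degree map\<close>

locale degree_space = complex_space S n for S :: "'p cspace" and n :: "'n::finite itself" +
  fixes D :: "'p cclass \<Rightarrow> rat"
  assumes degree_map: "degree_map S D"
begin

text \<open>The intersection form on rational cocycles instead of classes. Sums and multiples of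
  cocycles are plain functions, so bilinearity can be used without the group operations of
  cohomology.\<close>

definition pairing :: "('p, complex) cochain \<Rightarrow> ('p, complex) cochain \<Rightarrow> rat" where
  "pairing a b = D (QS.cls 4 (cup_cochain 2 a b))"

lemma D_hom: "D \<in> hom (HQ S 4) additive_group"
  using degree_map by (simp add: degree_map_def)

lemma cup_Q: "a \<in> QS.cyc 2 \<Longrightarrow> b \<in> QS.cyc 2 \<Longrightarrow> cup_cochain 2 a b \<in> QS.cyc 4"
  using QS.cup_cocycles [of a 2 b 2] by simp

lemma cls_cup_cong:
  assumes "a \<in> QS.cyc 2" "a' \<in> QS.cyc 2" "b \<in> QS.cyc 2" "b' \<in> QS.cyc 2"
    and "QS.cls 2 a = QS.cls 2 a'" "QS.cls 2 b = QS.cls 2 b'"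
  shows "QS.cls 4 (cup_cochain 2 a b) = QS.cls 4 (cup_cochain 2 a' b')"
  using QS.cls_cup_left [of a 1 a' b 2] QS.cls_cup_right [of a' 2 b 1 b'] assms
  by (simp add: eval_nat_numeral)

lemma pairing_cong:
  assumes "a \<in> QS.cyc 2" "a' \<in> QS.cyc 2" "b \<in> QS.cyc 2" "b' \<in> QS.cyc 2"
    and "QS.cls 2 a = QS.cls 2 a'" "QS.cls 2 b = QS.cls 2 b'"
  shows "pairing a b = pairing a' b'"
  unfolding pairing_def using cls_cup_cong [OF assms] by simp

lemma cup_cls:
  assumes "a \<in> QS.cyc 2" "b \<in> QS.cyc 2"
  shows "cup S (QS.cls 2 a) (QS.cls 2 b) = QS.cls 4 (cup_cochain 2 a b)"
proof -
  have "coh_class X additive_group (locally_constant X \<rat>) 4 (\<lambda>xs p. a' (take 3 xs) p * b' (drop 2 xs) p) =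
      QS.cls 4 (cup_cochain 2 a b)" if "a' \<in> QS.cls 2 a" "b' \<in> QS.cls 2 b" for a' b'
    using cls_cup_cong [of a' a b' b] QS.coh_class_memD [OF assms(1) that(1)]
      QS.coh_class_memD [OF assms(2) that(2)] assms
    by (simp add: cup_cochain_def)
  then show ?thesis
    unfolding cup_def using QS.coh_class_self [OF assms(1)] QS.coh_class_self [OF assms(2)] by blast
qed

lemma inter_Q_cls: "a \<in> QS.cyc 2 \<Longrightarrow> b \<in> QS.cyc 2 \<Longrightarrow> inter_Q S D (QS.cls 2 a) (QS.cls 2 b) = pairing a b"
  by (simp add: inter_Q_def pairing_def cup_cls)

lemma inter_Z_cls: "a \<in> ZS.cyc 2 \<Longrightarrow> b \<in> ZS.cyc 2 \<Longrightarrow> inter_Z S D (ZS.cls 2 a) (ZS.cls 2 b) = pairing a b"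
  by (simp add: inter_Z_def Z_to_Q_cls inter_Q_cls ZQ_cyc)

lemma D_add:
  assumes "c \<in> QS.cyc 4" "d \<in> QS.cyc 4"
  shows "D (QS.cls 4 (\<lambda>xs p. c xs p + d xs p)) = D (QS.cls 4 c) + D (QS.cls 4 d)"
  using hom_mult [OF D_hom, of "QS.cls 4 c" "QS.cls 4 d"] assms
  by (simp add: HQ_def QS.cls_add QS.coh_class_carrier)

lemma D_int:
  assumes "c \<in> QS.cyc 4"
  shows "D (QS.cls 4 (\<lambda>xs p. of_int k * c xs p)) = of_int k * D (QS.cls 4 c)"
proof -
  have "D (QS.cls 4 c [^]\<^bsub>HQ S 4\<^esub> k) = D (QS.cls 4 c) [^]\<^bsub>additive_group\<^esub> k"
    using QS.comm_group_cohomology [of 4] comm_group_additive_group assms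
    by (intro hom_int_pow [OF D_hom]) (auto simp: HQ_def comm_group_def)
  then show ?thesis
    using QS.cls_int_pow [OF assms, of k] by (simp add: HQ_def)
qed

lemma pairing_commute: "a \<in> QS.cyc 2 \<Longrightarrow> b \<in> QS.cyc 2 \<Longrightarrow> pairing a b = pairing b a"
  by (simp add: pairing_def QS.cls_cup_commute)

lemma pairing_add_left:
  assumes "a \<in> QS.cyc 2" "a' \<in> QS.cyc 2" "b \<in> QS.cyc 2"
  shows "pairing (\<lambda>xs p. a xs p + a' xs p) b = pairing a b + pairing a' b"
proof -
  have "cup_cochain 2 (\<lambda>xs p. a xs p + a' xs p) b = (\<lambda>xs p. cup_cochain 2 a b xs p + cup_cochain 2 a' b xs p)"
    by (simp add: cup_cochain_def algebra_simps)
  then show ?thesis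
    using D_add [OF cup_Q [OF assms(1,3)] cup_Q [OF assms(2,3)]] by (simp add: pairing_def)
qed

lemma pairing_int_left:
  assumes "a \<in> QS.cyc 2" "b \<in> QS.cyc 2"
  shows "pairing (\<lambda>xs p. of_int k * a xs p) b = of_int k * pairing a b"
proof -
  have "cup_cochain 2 (\<lambda>xs p. of_int k * a xs p) b = (\<lambda>xs p. of_int k * cup_cochain 2 a b xs p)"
    by (simp add: cup_cochain_def algebra_simps)
  then show ?thesis
    using D_int [OF cup_Q [OF assms], of k] by (simp add: pairing_def)
qed

lemma pairing_add_right:
  assumes "a \<in> QS.cyc 2" "a' \<in> QS.cyc 2" "b \<in> QS.cyc 2"
  shows "pairing b (\<lambda>xs p. a xs p + a' xs p) = pairing b a + pairing b a'"
  using pairing_add_left [OF assms] assms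
  by (simp add: pairing_commute [of b] QS.cyc_add)

lemma QS_cyc_int: "a \<in> QS.cyc q \<Longrightarrow> (\<lambda>xs p. of_int k * a xs p) \<in> QS.cyc q"
  by (rule QS.cyc_scale) (auto intro: const_Q)

lemma pairing_int_right:
  assumes "a \<in> QS.cyc 2" "b \<in> QS.cyc 2"
  shows "pairing b (\<lambda>xs p. of_int k * a xs p) = of_int k * pairing b a"
  using pairing_int_left [OF assms] assms
  by (simp add: pairing_commute [of b] QS_cyc_int)

text \<open>The product of integral cocycles is an integral cocycle of degree 4, and the degree map
  takes integral values on integral classes.\<close>

lemma pairing_Z:
  assumes "a \<in> ZS.cyc 2" "b \<in> ZS.cyc 2"
  shows "pairing a b \<in> \<int>"
proof -
  have c: "cup_cochain 2 a b \<in> ZS.cyc 4"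
    using ZS.cup_cocycles [of a 2 b 2] assms by simp
  have "(D \<circ> Z_to_Q S 4) (ZS.cls 4 (cup_cochain 2 a b)) \<in> \<int>"
    using degree_map c unfolding degree_map_def bij_betw_def HZ_def by blast
  then show ?thesis
    using c by (simp add: pairing_def Z_to_Q_cls)
qed

end

section \<open>Reindexing and the exponential sequence\<close>

text \<open>
  The cochains of the limit complex live on point-indexed covers, which are refined only in place, so
  a cochain of units need not have a logarithm on a refinement.  It has one after reindexing along a
  map \<open>\<tau>\<close> with finite range.
\<close>

lemma reindexing_refinement:
  assumes comp: "compact_space X" and haus: "Hausdorff_space X" and U: "U \<in> point_covers X"
    and loc: "\<And>x y p. x \<in> topspace X \<Longrightarrow> y \<in> topspace X \<Longrightarrow> p \<in> U x \<inter> U y \<Longrightarrow>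
      \<exists>V. openin X V \<and> p \<in> V \<and> P x y V"
    and mono: "\<And>x y V V'. P x y V \<Longrightarrow> V' \<subseteq> V \<Longrightarrow> P x y V'"
  obtains W \<tau> where "W \<in> point_covers X" "\<And>p. p \<in> topspace X \<Longrightarrow> \<tau> p \<in> topspace X"
    "\<And>p. p \<in> topspace X \<Longrightarrow> W p \<subseteq> U p \<inter> U (\<tau> p)"
    "\<And>p q. p \<in> topspace X \<Longrightarrow> q \<in> topspace X \<Longrightarrow> W p \<inter> W q \<noteq> {} \<Longrightarrow> P (\<tau> p) (\<tau> q) (W p \<inter> W q)"
proof -
  \<comment> \<open>Regularity of compact Hausdorff spaces shrinks the cover, with a closed set
    \<open>C\<close> between the smaller open set and \<open>U x\<close>. The closed sets will
    control which members of the cover a small neighbourhood can meet.\<close>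
  have "\<exists>V C. openin X V \<and> closedin X C \<and> x \<in> V \<and> V \<subseteq> C \<and> C \<subseteq> U x" if x: "x \<in> topspace X" for x
  proof -
    have reg: "regular_space X"
      using comp haus compact_Hausdorff_imp_regular_space by blast
    have "closedin X (topspace X - U x) \<and> x \<in> topspace X - (topspace X - U x)"
      using U x by (auto simp: point_covers_def)
    from reg [unfolded regular_space_def, rule_format, OF this]
    obtain V V' where V: "openin X V" "openin X V'" "x \<in> V" "topspace X - U x \<subseteq> V'" "disjnt V V'"
      by blast
    have "V \<subseteq> topspace X - V'"
      using V(1,5) openin_subset [of X V] by (auto simp: disjnt_def)
    moreover have "closedin X (topspace X - V')" "topspace X - V' \<subseteq> U x"
      using V(2,4) by (auto simp: closedin_diff)
    ultimately show ?thesis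
      using V(1,3) by blast
  qed
  then obtain V C where VC: "\<And>x. x \<in> topspace X \<Longrightarrow>
      openin X (V x) \<and> closedin X (C x) \<and> x \<in> V x \<and> V x \<subseteq> C x \<and> C x \<subseteq> U x"
    by metis
  then have V: "\<And>x. x \<in> topspace X \<Longrightarrow> openin X (V x)" "\<And>x. x \<in> topspace X \<Longrightarrow> x \<in> V x"
    and C: "\<And>x. x \<in> topspace X \<Longrightarrow> closedin X (C x)" "\<And>x. x \<in> topspace X \<Longrightarrow> V x \<subseteq> C x"
      "\<And>x. x \<in> topspace X \<Longrightarrow> C x \<subseteq> U x"
    by blast+
  have "\<exists>\<F>. finite \<F> \<and> \<F> \<subseteq> V ` topspace X \<and> topspace X \<subseteq> \<Union>\<F>"
  proof -
    have "Ball (V ` topspace X) (openin X) \<and> topspace X \<subseteq> \<Union>(V ` topspace X)"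
      using V by blast
    with comp [unfolded compact_space_def compactin_def, THEN conjunct2, rule_format, of "V ` topspace X"]
    show ?thesis by simp
  qed
  then obtain \<F> where \<F>: "finite \<F>" "\<F> \<subseteq> V ` topspace X" "topspace X \<subseteq> \<Union>\<F>"
    by blast
  then obtain I where I: "I \<subseteq> topspace X" "finite I" "\<F> = V ` I"
    using finite_subset_image by metis
  have "\<forall>p\<in>topspace X. \<exists>i\<in>I. p \<in> V i"
    using \<F>(3) I(3) by blast
  then obtain \<tau> where \<tau>: "\<And>p. p \<in> topspace X \<Longrightarrow> \<tau> p \<in> I" "\<And>p. p \<in> topspace X \<Longrightarrow> p \<in> V (\<tau> p)"
    by metis
  have \<tau>': "\<tau> p \<in> topspace X" if "p \<in> topspace X" for p
    using \<tau>(1) [OF that] I(1) by blast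
  obtain N where N: "\<And>x y p. x \<in> topspace X \<Longrightarrow> y \<in> topspace X \<Longrightarrow> p \<in> U x \<inter> U y \<Longrightarrow>
      openin X (N x y p) \<and> p \<in> N x y p \<and> P x y (N x y p)"
    using loc by metis
  have IX: "i \<in> topspace X" if "i \<in> I" for i
    using I(1) that by blast
  \<comment> \<open>\<open>A p\<close> avoids each of the finitely many closed sets that miss
    \<open>p\<close>. So a neighbourhood inside \<open>A p\<close> meets \<open>V i\<close> only if
    \<open>p\<close> is in \<open>C i\<close>, hence in \<open>U i\<close>.\<close>
  define A where "A p = (\<Inter>i\<in>{i \<in> I. p \<notin> C i}. topspace X - C i) \<inter> topspace X" for p
  \<comment> \<open>One neighbourhood of \<open>p\<close> good for all pairs of indices in
    \<open>I\<close> whose sets contain \<open>p\<close>. Finiteness of \<open>I\<close> keeps the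
    intersection open; this is where compactness enters.\<close>
  define B where "B p = (\<Inter>ij\<in>{ij \<in> I \<times> I. p \<in> U (fst ij) \<inter> U (snd ij)}. N (fst ij) (snd ij) p)
      \<inter> topspace X" for p
  define W where "W p = U p \<inter> V (\<tau> p) \<inter> A p \<inter> B p" for p
  have W: "openin X (W p) \<and> p \<in> W p" if p: "p \<in> topspace X" for p
  proof
    have "openin X (B p)"
      unfolding B_def
    proof (rule openin_INT)
      show "finite {ij \<in> I \<times> I. p \<in> U (fst ij) \<inter> U (snd ij)}"
        using I(2) by simp
      show "openin X (N (fst ij) (snd ij) p)"
        if "ij \<in> {ij \<in> I \<times> I. p \<in> U (fst ij) \<inter> U (snd ij)}" for ij
        using that N [of "fst ij" "snd ij" p] IX by auto
    qed
    moreover have "openin X (A p)"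
      unfolding A_def by (rule openin_INT) (use I(2) IX C(1) in auto)
    moreover have "openin X (U p)" "openin X (V (\<tau> p))"
      using U p V(1) \<tau>' by (auto simp: point_covers_def)
    ultimately show "openin X (W p)"
      unfolding W_def by (intro openin_Int)
    have "p \<in> A p"
      using p by (simp add: A_def)
    moreover have "p \<in> B p"
      using p N IX by (auto simp: B_def)
    moreover have "p \<in> U p"
      using U p by (auto simp: point_covers_def)
    ultimately show "p \<in> W p"
      using \<tau>(2) [OF p] by (simp add: W_def)
  qed
  show ?thesis
  proof (rule that [of W \<tau>])
    show "W \<in> point_covers X"
      using W by (simp add: point_covers_def)
    show "\<tau> p \<in> topspace X" if "p \<in> topspace X" for p
      using \<tau>' that .
    show "W p \<subseteq> U p \<inter> U (\<tau> p)" if "p \<in> topspace X" for p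
      using C(2,3) [OF \<tau>' [OF that]] by (auto simp: W_def)
    show "P (\<tau> p) (\<tau> q) (W p \<inter> W q)"
      if p: "p \<in> topspace X" and q: "q \<in> topspace X" and ne: "W p \<inter> W q \<noteq> {}" for p q
    proof -
      obtain r where r: "r \<in> W p" "r \<in> W q"
        using ne by blast
      \<comment> \<open>A common point \<open>r\<close> forces \<open>p\<close> itself into
        \<open>C (\<tau> q)\<close>, by the choice of \<open>A p\<close>. Hence the pair
        \<open>\<tau> p\<close>, \<open>\<tau> q\<close> is among those that \<open>B p\<close>
        takes care of.\<close>
      have "r \<in> C (\<tau> q)"
        using r(2) C(2) [OF \<tau>' [OF q]] by (auto simp: W_def)
      moreover have "r \<in> A p"
        using r(1) by (simp add: W_def)
      ultimately have "p \<in> C (\<tau> q)"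
        using \<tau>(1) [OF q] unfolding A_def by blast
      then have pU: "p \<in> U (\<tau> p) \<inter> U (\<tau> q)"
        using C(2,3) [OF \<tau>' [OF p]] C(3) [OF \<tau>' [OF q]] \<tau>(2) [OF p] by blast
      have "W p \<subseteq> B p"
        by (auto simp: W_def)
      also have "B p \<subseteq> N (\<tau> p) (\<tau> q) p"
        using \<tau>(1) [OF p] \<tau>(1) [OF q] pU by (force simp: B_def)
      finally have "W p \<subseteq> N (\<tau> p) (\<tau> q) p" .
      then show ?thesis
        using N [OF \<tau>' [OF p] \<tau>' [OF q] pU] by (meson mono le_infI1)
    qed
  qed
qed

text \<open>The refinement map of Cech theory: a set \<open>W p\<close> inside
  \<open>U (\<tau> p)\<close> is relabelled by \<open>\<tau> p\<close>, whereas the point of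
  evaluation stays. In \<open>pull_cochain\<close> both move.\<close>

definition reindex :: "('p \<Rightarrow> 'p) \<Rightarrow> ('p, 'v) cochain \<Rightarrow> ('p, 'v) cochain" where
  "reindex \<tau> c = (\<lambda>xs. c (map \<tau> xs))"

lemma coboundary_reindex: "coboundary G (reindex \<tau> c) xs p = coboundary G c (map \<tau> xs) p"
  by (simp add: coboundary_def reindex_def take_map drop_map)

context ring_sheaf
begin

text \<open>The prism operator shows that reindexing does not change the class.\<close>

lemma reindex_cohomologous:
  assumes c: "c \<in> cyc 2" and U: "U \<in> point_covers X"
    "\<And>xs. xs \<in> simplices X 2 \<Longrightarrow> c xs \<in> F (overlap U xs)"
    "\<And>xs p. xs \<in> simplices X 3 \<Longrightarrow> p \<in> overlap U xs \<Longrightarrow> add_coboundary c xs p = 0"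
    and W: "W \<in> point_covers X" "\<And>p. p \<in> topspace X \<Longrightarrow> \<tau> p \<in> topspace X"
    "\<And>p. p \<in> topspace X \<Longrightarrow> W p \<subseteq> U p \<inter> U (\<tau> p)"
  shows "reindex \<tau> c \<in> cyc 2" "cls 2 (reindex \<tau> c) = cls 2 c"
proof -
  \<comment> \<open>The square with corners \<open>x\<close>, \<open>y\<close>,
    \<open>\<tau> x\<close>, \<open>\<tau> y\<close> is cut into the triangles
    \<open>x, \<tau> x, \<tau> y\<close> and \<open>x, y, \<tau> y\<close>, taken with opposite
    signs.\<close>
  define H where "H = (\<lambda>xs p. c [xs ! 0, \<tau> (xs ! 0), \<tau> (xs ! 1)] p - c [xs ! 0, xs ! 1, \<tau> (xs ! 1)] p)"
  have H: "H \<in> coch 1"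
  proof (rule cochainsI [OF _ W(1)])
    fix xs assume xs: "xs \<in> simplices X 1"
    then obtain x y where x: "xs = [x, y]" "x \<in> topspace X" "y \<in> topspace X"
      by (auto simp: simplices_def length_Suc_conv)
    have s: "c zs \<in> F (overlap W xs)" if "zs \<in> simplices X 2" "set zs \<subseteq> {x, y, \<tau> x, \<tau> y}" for zs
      by (rule sheaf_restrict [OF U(2) [OF that(1)]]) (use that(2) W(3) x in \<open>fastforce simp: overlap_def\<close>)
    have "(\<lambda>p. c [x, \<tau> x, \<tau> y] p + - c [x, y, \<tau> y] p) \<in> F (overlap W xs)"
      using x W(2) by (intro sheaf_add sheaf_uminus s openin_overlap [OF W(1) xs]) (auto simp: simplices_def)
    then show "H xs \<in> F (overlap W xs)"
      by (simp add: H_def x)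
  qed simp
  have "agree X (Suc 1) (reindex \<tau> c) (\<lambda>xs p. c xs p + add_coboundary H xs p)"
    unfolding agree_def
  proof (intro bexI [OF _ W(1)] ballI)
    fix xs p assume xs: "xs \<in> simplices X (Suc 1)" and p: "p \<in> overlap W xs"
    then obtain x y z where x: "xs = [x, y, z]" "x \<in> topspace X" "y \<in> topspace X" "z \<in> topspace X"
      by (auto simp: simplices_def length_Suc_conv)
    have mem: "p \<in> U v \<and> v \<in> topspace X" if "v \<in> {x, y, z, \<tau> x, \<tau> y, \<tau> z}" for v
      using that p x(2-4) W(2) [OF x(2)] W(2) [OF x(3)] W(2) [OF x(4)]
        W(3) [OF x(2)] W(3) [OF x(3)] W(3) [OF x(4)]
      by (auto simp: x(1))
    \<comment> \<open>Since \<open>W\<close> lies inside both \<open>U\<close> and its reindexing,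
      the cocycle condition holds on simplices mixing old and new vertices. It reduces everything to
      values on triples that start with \<open>x\<close>.\<close>
    have r: "c [u, v, w] p = c [x, v, w] p - c [x, u, w] p + c [x, u, v] p"
      if "{u, v, w} \<subseteq> {y, z, \<tau> x, \<tau> y, \<tau> z}" for u v w
    proof -
      have "p \<in> overlap U [x, u, v, w]" "[x, u, v, w] \<in> simplices X 3"
        using that mem [of x] mem [of u] mem [of v] mem [of w] by (auto simp: simplices_def)
      then show ?thesis
        using U(3) [of "[x, u, v, w]" p] by (simp add: algebra_simps)
    qed
    show "reindex \<tau> c xs p = c xs p + add_coboundary H xs p"
      by (simp add: x reindex_def H_def)
         (simp add: r [of "\<tau> x" "\<tau> y" "\<tau> z"] r [of y "\<tau> y" "\<tau> z"] r [of y z "\<tau> z"])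
  qed
  from cls_eqI [OF _ H this] c
  show "reindex \<tau> c \<in> cyc 2" "cls 2 (reindex \<tau> c) = cls 2 c"
    by (simp_all add: numeral_2_eq_2)
qed

lemma cls_add_cong:
  assumes "c \<in> cyc q" "c' \<in> cyc q" "d \<in> cyc q" "d' \<in> cyc q" "cls q c = cls q c'" "cls q d = cls q d'"
  shows "cls q (\<lambda>xs p. c xs p + d xs p) = cls q (\<lambda>xs p. c' xs p + d' xs p)"
  using cls_add [of c q d] cls_add [of c' q d'] assms by simp

lemma cls_int_cong:
  assumes "c \<in> cyc q" "c' \<in> cyc q" "cls q c = cls q c'"
  shows "cls q (\<lambda>xs p. of_int k * c xs p) = cls q (\<lambda>xs p. of_int k * c' xs p)"
  using cls_int_pow [of c q k] cls_int_pow [of c' q k] assms by simp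

end

context complex_space
begin

lemma hol_integer_valued:
  assumes W: "openin X W" and f: "f \<in> hol S W" and int: "\<And>p. p \<in> W \<Longrightarrow> f p \<in> \<int>"
  shows "f \<in> locally_constant X \<int> W"
  unfolding locally_constant_def
proof (intro CollectI ballI conjI)
  fix p assume p: "p \<in> W"
  show "f p \<in> \<int>" using int p .
  \<comment> \<open>Radius 1 suffices because distinct integers have distance at least 1.\<close>
  obtain V where V: "openin X V" "p \<in> V" "V \<subseteq> W" "f ` V \<subseteq> ball (f p) 1"
    by (rule hol_continuous [OF W f p, of "ball (f p) 1"]) auto
  have "f q = f p" if "q \<in> V" for q
  proof -
    have "f q - f p \<in> \<int>"
      using int that p V(3) by auto
    then obtain k where k: "f q - f p = of_int k"
      by (rule Ints_cases)
    have "norm (f q - f p) < 1"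
      using V(4) that by (auto simp: dist_norm norm_minus_commute)
    then have "real_of_int \<bar>k\<bar> < 1"
      unfolding k by simp
    then have "k = 0" by linarith
    then show ?thesis using k by simp
  qed
  then show "\<exists>V. openin X V \<and> p \<in> V \<and> (\<forall>q\<in>V \<inter> W. f q = f p)"
    using V(1,2) by blast
qed

section \<open>Exactness of the exponential sequence in degree 2\<close>

lemma exp_eq_1_iff_Ints: "exp (2 * of_real pi * \<i> * w) = 1 \<longleftrightarrow> w \<in> \<int>"
proof
  assume "exp (2 * of_real pi * \<i> * w) = 1"
  then obtain k :: int where k: "Im w = 0" "Re w = of_int k"
    by (auto simp: exp_eq_1)
  then have "w = of_int k" by (simp add: complex_eq_iff)
  then show "w \<in> \<int>" by simp
qed (auto simp: exp_eq_1 elim!: Ints_cases)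

abbreviation "ucls q \<equiv> coh_class X unit_group (hol_units S) q"

text \<open>Exactness at the second cohomology of O. If the exponential of \<open>c\<close> is the
  coboundary of a unit cochain \<open>g\<close>, logarithms \<open>L\<close> of the reindexed
  \<open>g\<close> give a holomorphic cochain whose coboundary corrects the reindexed
  \<open>c\<close> to an integral cocycle. Compactness is what makes simultaneous logarithms
  available.\<close>

lemma exponential_exact_O:
  assumes comp: "compact_space X" and c: "c \<in> OS.cyc 2" and one: "ucls 2 (exp_cochain c) = \<one>\<^bsub>HU S 2\<^esub>"
  obtains z where "z \<in> ZS.cyc 2" "OS.cls 2 c = OS.cls 2 z"
proof -
  have haus: "Hausdorff_space X"
    using manifold by (simp add: complex_manifold_def)
  have ec: "exp_cochain c \<in> cocycles X unit_group (hol_units S) 2"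
    by (rule cochain_map.map_cocycles [OF cochain_map_O_to_U c])
  have "ucls (Suc 1) (exp_cochain c) = ucls (Suc 1) (\<lambda>xs p. \<one>\<^bsub>unit_group\<^esub>)"
    using one US.coh_class_one [of 2] by (simp add: HU_def numeral_2_eq_2)
  then obtain g where g: "g \<in> cochains X unit_group (hol_units S) 1"
    "agree X 2 (exp_cochain c) (coboundary unit_group g)"
    using US.coh_class_eqE [of "exp_cochain c" 1 "\<lambda>xs p. \<one>\<^bsub>unit_group\<^esub>"] ec US.cocycles_one [of 2]
    by (auto simp: numeral_2_eq_2)
  obtain U1 where U1: "U1 \<in> point_covers X" "\<And>xs. xs \<in> simplices X 1 \<Longrightarrow> g xs \<in> hol_units S (overlap U1 xs)"
    using g(1) by (auto simp: cochains_def)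
  obtain U2 where U2: "U2 \<in> point_covers X"
    "\<And>xs p. xs \<in> simplices X 2 \<Longrightarrow> p \<in> overlap U2 xs \<Longrightarrow> exp_cochain c xs p = coboundary unit_group g xs p"
    using g(2) by (auto simp: agree_def)
  obtain U3 where U3: "U3 \<in> point_covers X" "\<And>xs. xs \<in> simplices X 2 \<Longrightarrow> c xs \<in> hol S (overlap U3 xs)"
    using OS.cocycles_cochains [OF c] by (auto simp: cochains_def)
  obtain U4 where U4: "U4 \<in> point_covers X"
    "\<And>xs p. xs \<in> simplices X 3 \<Longrightarrow> p \<in> overlap U4 xs \<Longrightarrow> add_coboundary c xs p = 0"
    using OS.agree_add_coboundary [OF c] by (auto simp: agree_def)
  define U where "U x = (U1 x \<inter> U2 x) \<inter> (U3 x \<inter> U4 x)" for x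
  have U: "U \<in> point_covers X"
    unfolding U_def by (intro point_covers_Int U1 U2 U3 U4)
  have Usub: "overlap U xs \<subseteq> overlap U1 xs" "overlap U xs \<subseteq> overlap U2 xs"
      "overlap U xs \<subseteq> overlap U3 xs" "overlap U xs \<subseteq> overlap U4 xs" for xs
    by (auto simp: U_def overlap_def)
  define P where "P x y V \<longleftrightarrow> (\<exists>l\<in>hol S V. \<forall>q\<in>V. exp (2 * of_real pi * \<i> * l q) = g [x, y] q)" for x y V
  have loc: "\<exists>V. openin X V \<and> p \<in> V \<and> P x y V"
    if "x \<in> topspace X" "y \<in> topspace X" "p \<in> U x \<inter> U y" for x y p
  proof -
    have xy: "[x, y] \<in> simplices X 1" "p \<in> overlap U1 [x, y]"
      using that by (auto simp: simplices_def U_def)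
    obtain V l where "openin X V" "p \<in> V" "V \<subseteq> overlap U1 [x, y]" "l \<in> hol S V"
        "\<And>q. q \<in> V \<Longrightarrow> exp (2 * of_real pi * \<i> * l q) = g [x, y] q"
      using hol_units_local_log [OF openin_overlap [OF U1(1) xy(1)] U1(2) [OF xy(1)] xy(2)] by blast
    then show ?thesis unfolding P_def by blast
  qed
  have mono: "P x y V'" if "P x y V" "V' \<subseteq> V" for x y V V'
    using that hol_restrict unfolding P_def by blast
  obtain W \<tau> where W: "W \<in> point_covers X" and \<tau>: "\<And>p. p \<in> topspace X \<Longrightarrow> \<tau> p \<in> topspace X"
    and WU: "\<And>p. p \<in> topspace X \<Longrightarrow> W p \<subseteq> U p \<inter> U (\<tau> p)"
    and WP: "\<And>p q. p \<in> topspace X \<Longrightarrow> q \<in> topspace X \<Longrightarrow> W p \<inter> W q \<noteq> {} \<Longrightarrow> P (\<tau> p) (\<tau> q) (W p \<inter> W q)"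
    by (rule reindexing_refinement [OF comp haus U, of P])
      ((rule loc; assumption) | (rule mono; assumption) | (rule that; assumption))+
  have "P (\<tau> x) (\<tau> y) (W x \<inter> W y)" if "x \<in> topspace X" "y \<in> topspace X" for x y
  proof (cases "W x \<inter> W y = {}")
    \<comment> \<open>The refinement controls only overlaps that are non-empty. On an empty overlap
      the logarithm condition is vacuous, and the zero section will do.\<close>
    case True
    show ?thesis
      unfolding P_def True by (rule bexI [of _ "\<lambda>_. 0"]) (simp_all add: hol_const)
  qed (use WP that in blast)
  then have ex: "\<exists>l. l \<in> hol S (W x \<inter> W y) \<and> (\<forall>q\<in>W x \<inter> W y. exp (2 * of_real pi * \<i> * l q) = g [\<tau> x, \<tau> y] q)"
    if "x \<in> topspace X" "y \<in> topspace X" for x y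
    using that unfolding P_def by blast
  define l where "l x y = (SOME l. l \<in> hol S (W x \<inter> W y) \<and>
      (\<forall>q\<in>W x \<inter> W y. exp (2 * of_real pi * \<i> * l q) = g [\<tau> x, \<tau> y] q))" for x y
  have l: "l x y \<in> hol S (W x \<inter> W y)"
      "q \<in> W x \<inter> W y \<Longrightarrow> exp (2 * of_real pi * \<i> * l x y q) = g [\<tau> x, \<tau> y] q"
    if "x \<in> topspace X" "y \<in> topspace X" for x y q
    using someI_ex [OF ex [OF that]] unfolding l_def by blast+
  define L where "L xs = l (xs ! 0) (xs ! 1)" for xs
  have L: "L \<in> OS.coch 1"
  proof (rule OS.cochainsI [OF _ W])
    fix xs assume "xs \<in> simplices X 1"
    then obtain x y where "xs = [x, y]" "x \<in> topspace X" "y \<in> topspace X"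
      by (auto simp: simplices_def length_Suc_conv)
    then show "L xs \<in> hol S (overlap W xs)"
      using l(1) by (simp add: L_def)
  qed simp
  have expL: "exp_cochain L xs p = reindex \<tau> g xs p" if xs: "xs \<in> simplices X 1" and p: "p \<in> overlap W xs" for xs p
  proof -
    obtain x y where "xs = [x, y]" "x \<in> topspace X" "y \<in> topspace X"
      using xs by (auto simp: simplices_def length_Suc_conv)
    then show ?thesis
      using l(2) p by (simp add: L_def exp_cochain_def reindex_def)
  qed
  have cU: "c xs \<in> hol S (overlap U xs)" if "xs \<in> simplices X 2" for xs
    by (rule hol_restrict [OF U3(2) [OF that] Usub(3)])
  have dU: "add_coboundary c xs p = 0" if "xs \<in> simplices X 3" "p \<in> overlap U xs" for xs p
    by (rule U4(2) [OF that(1) subsetD [OF Usub(4) that(2)]])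
  have rc: "reindex \<tau> c \<in> OS.cyc 2" "OS.cls 2 (reindex \<tau> c) = OS.cls 2 c"
    by (rule OS.reindex_cohomologous [OF c U cU dU W \<tau> WU]; assumption)+
  \<comment> \<open>The exponentials of \<open>reindex \<tau> c\<close> and of the coboundary of
    \<open>L\<close> are both the coboundary of the reindexed \<open>g\<close> on small overlaps, so
    the exponential of \<open>z\<close> is 1 there.\<close>
  define z where "z = (\<lambda>xs p. reindex \<tau> c xs p - add_coboundary L xs p)"
  have z: "z \<in> OS.cyc 2"
    unfolding z_def using rc(1) OS.coboundary_in_cocycles [OF L] by (intro OS.cyc_diff) (simp_all add: numeral_2_eq_2)
  have map_simp: "map \<tau> xs \<in> simplices X q" if "xs \<in> simplices X q" for xs q
    using that \<tau> by (auto simp: simplices_def)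
  have overlap_map: "overlap W xs \<subseteq> overlap U (map \<tau> xs)" if "xs \<in> simplices X q" for xs q
    using that WU by (fastforce simp: simplices_def overlap_def)
  have zint: "z xs p \<in> \<int>" if xs: "xs \<in> simplices X 2" and p: "p \<in> overlap W xs" for xs p
  proof -
    have "exp_cochain (reindex \<tau> c) xs p = coboundary unit_group g (map \<tau> xs) p"
      using U2(2) [OF map_simp [OF xs]] overlap_map [OF xs] Usub(2) p
      by (auto simp: exp_cochain_def reindex_def)
    also have "\<dots> = coboundary unit_group (reindex \<tau> g) xs p"
      by (simp add: coboundary_reindex)
    also have "\<dots> = coboundary unit_group (exp_cochain L) xs p"
    proof (rule comm_group.coboundary_cong [OF comm_group_unit_group])
      fix i assume i: "i < length xs"
      have "face i xs \<in> simplices X 1"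
        using xs i face_simplices [of xs X 1 i] by (simp add: numeral_2_eq_2)
      then show "reindex \<tau> g (face i xs) p = exp_cochain L (face i xs) p"
        using p overlap_face [of W xs i] by (intro expL [symmetric]) auto
    qed simp
    also have "\<dots> = exp_cochain (add_coboundary L) xs p"
      by (simp add: exp_cochain_coboundary)
    finally have "exp (2 * of_real pi * \<i> * z xs p) = 1"
      by (simp add: exp_cochain_def z_def right_diff_distrib exp_diff)
    then show ?thesis
      by (simp add: exp_eq_1_iff_Ints)
  qed
  obtain W' where W': "W' \<in> point_covers X" "\<And>xs. xs \<in> simplices X 2 \<Longrightarrow> z xs \<in> hol S (overlap W' xs)"
    using OS.cocycles_cochains [OF z] by (auto simp: cochains_def)
  have "z \<in> ZS.coch 2"
  proof (rule ZS.cochainsI [OF _ point_covers_Int [OF W W'(1)]])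
    fix xs assume xs: "xs \<in> simplices X 2"
    show "z xs \<in> locally_constant X \<int> (overlap (\<lambda>x. W x \<inter> W' x) xs)"
      unfolding overlap_Int
    proof (rule hol_integer_valued)
      show "openin X (overlap W xs \<inter> overlap W' xs)"
        by (intro openin_Int openin_overlap [OF W xs] openin_overlap [OF W'(1) xs])
      show "z xs \<in> hol S (overlap W xs \<inter> overlap W' xs)"
        using W'(2) [OF xs] by (rule hol_restrict) simp
    qed (use zint xs in blast)
  qed simp
  then have "z \<in> ZS.cyc 2"
    using OS.agree_coboundary_cocycle [OF z] by (rule ZS.cocyclesI)
  moreover have "OS.cls 2 c = OS.cls 2 z"
  proof -
    have "agree X (Suc 1) (reindex \<tau> c) (\<lambda>xs p. z xs p + add_coboundary L xs p)"
      by (simp add: z_def)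
    from OS.cls_eqI(2) [OF _ L this] z rc(2) show ?thesis
      by (simp add: numeral_2_eq_2)
  qed
  ultimately show ?thesis by (rule that)
qed

text \<open>Exactness at the second integral cohomology. A holomorphic primitive of \<open>w\<close>
  is exactly a system of logarithms of transition functions of a line bundle with Chern class
  \<open>w\<close>.\<close>

lemma Pic_iff:
  assumes w: "w \<in> ZS.cyc 2"
  shows "ZS.cls 2 w \<in> Pic S \<longleftrightarrow> OS.cls 2 w = OS.cls 2 (\<lambda>xs p. 0)"
proof
  assume "ZS.cls 2 w \<in> Pic S"
  then obtain l where l: "l \<in> OS.coch 1" "add_coboundary l \<in> ZS.cls 2 w"
    by (auto simp: Pic_def chern_class_def)
  have "OS.cls 2 w = OS.cls 2 (add_coboundary l)"
    using ZS.coh_class_memD [OF w l(2)] w by (intro QO_cls_eq ZQ_cls_eq ZQ_cyc) auto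
  also have "\<dots> = OS.cls 2 (\<lambda>xs p. 0)"
    using OS.cls_eqI(2) [OF OS.cyc_zero l(1), of "add_coboundary l"] by (simp add: numeral_2_eq_2)
  finally show "OS.cls 2 w = OS.cls 2 (\<lambda>xs p. 0)" .
next
  assume "OS.cls 2 w = OS.cls 2 (\<lambda>xs p. 0)"
  then obtain l where l: "l \<in> OS.coch 1" "agree X 2 w (add_coboundary l)"
    using OS.cls_eqE [of w 1 "\<lambda>xs p. 0"] OS.cyc_zero [of 2] QO_cyc [OF ZQ_cyc [OF w]]
    by (auto simp: numeral_2_eq_2)
  have dl: "add_coboundary l \<in> ZS.cyc 2"
    by (rule ZS.cyc_agree [OF w l(2)])
  have "ZS.cls 2 w = ZS.cls 2 (add_coboundary l)"
    using ZS.cls_eqI(2) [of "add_coboundary l" 1 "\<lambda>xs p. 0" w] dl l(2) ZS.coch_zero [of 1]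
    by (simp add: numeral_2_eq_2 add_coboundary_cmult [of "\<lambda>_. 0", simplified])
  then have mem: "add_coboundary l \<in> ZS.cls 2 w"
    using ZS.coh_class_self [OF dl] by simp
  obtain U where U: "U \<in> point_covers X" "\<And>xs. xs \<in> simplices X 2 \<Longrightarrow> w xs \<in> locally_constant X \<int> (overlap U xs)"
    using ZS.cocycles_cochains [OF w] by (auto simp: cochains_def)
  have expw: "agree X 2 (exp_cochain w) (\<lambda>xs p. 1)"
    unfolding agree_def
  proof (intro bexI [OF _ U(1)] ballI)
    fix xs p assume "xs \<in> simplices X 2" "p \<in> overlap U xs"
    then have "w xs p \<in> \<int>"
      using U(2) by (auto simp: locally_constant_def)
    then show "exp_cochain w xs p = 1"
      by (simp add: exp_cochain_def exp_eq_1_iff_Ints)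
  qed
  \<comment> \<open>The coboundary of the exponential of \<open>l\<close> is the exponential of the
    coboundary of \<open>l\<close>, which agrees with that of the integral cochain \<open>w\<close>
    and is therefore 1.\<close>
  have "exp_cochain l \<in> cocycles X unit_group (hol_units S) 1"
  proof (rule US.cocyclesI)
    show "exp_cochain l \<in> cochains X unit_group (hol_units S) 1"
      by (rule cochain_map.map_cochains [OF cochain_map_O_to_U l(1)])
    have "agree X 2 (coboundary unit_group (exp_cochain l)) (exp_cochain w)"
      unfolding exp_cochain_coboundary [symmetric]
      by (rule agree_sym, rule cochain_map.map_agree [OF cochain_map_O_to_U l(2)])
    then show "agree X (Suc 1) (coboundary unit_group (exp_cochain l)) (\<lambda>xs p. \<one>\<^bsub>unit_group\<^esub>)"
      using agree_trans [OF _ expw] by (simp add: numeral_2_eq_2)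
  qed
  then have "chern_class S (ucls 1 (exp_cochain l)) (ZS.cls 2 w)"
    unfolding chern_class_def HU_def HZ_def
    using l(1) mem w US.coh_class_carrier US.coh_class_self ZS.coh_class_carrier by blast
  then show "ZS.cls 2 w \<in> Pic S"
    by (auto simp: Pic_def)
qed

end

section \<open>Discriminants of lattices of rank two\<close>

lemma det_mat_2:
  "Determinant.det (Matrix.mat 2 2 (\<lambda>(i, j). g i j)) = g 0 0 * g 1 1 - g 0 1 * (g 1 0 :: 'a :: comm_ring_1)"
proof -
  let ?A = "Matrix.mat 2 2 (\<lambda>(i, j). g i j)"
  have "Determinant.det ?A = (\<Sum>i<2. ?A $$ (i, 0) * Determinant.cofactor ?A i 0)"
    by (rule laplace_expansion_column) auto
  also have "\<dots> = g 0 0 * Determinant.cofactor ?A 0 0 + g 1 0 * Determinant.cofactor ?A 1 0"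
    by (simp add: numeral_2_eq_2)
  also have "Determinant.cofactor ?A 0 0 = g 1 1"
    unfolding Determinant.cofactor_def by (subst det_single) (auto simp: mat_delete_def)
  also have "Determinant.cofactor ?A 1 0 = - g 0 1"
    unfolding Determinant.cofactor_def by (subst det_single) (auto simp: mat_delete_def)
  finally show ?thesis by (simp add: algebra_simps)
qed

section \<open>Integral bases and their base change\<close>

context comm_group
begin

lemma finprod_int_pow:
  assumes "x \<in> carrier G" "finite A"
  shows "finprod G (\<lambda>j. x [^] (f j :: int)) A = x [^] sum f A"
  using assms(2)
proof (induction A rule: finite_induct)
  case (insert a A)
  then show ?case
    using assms(1) by (subst finprod_insert) (auto simp: int_pow_mult)
qed simp

lemma int_pow_finprod:
  assumes "finite A" "f \<in> A \<rightarrow> carrier G"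
  shows "finprod G f A [^] (k :: int) = finprod G (\<lambda>j. f j [^] k) A"
  using assms
proof (induction A rule: finite_induct)
  case (insert a A)
  then show ?case
    by (simp add: Pi_iff int_pow_mult_distrib m_comm)
qed simp

text \<open>The map whose bijectivity \<open>Z_basis\<close> asserts, here for arbitrary coefficient
  functions in place of extensional ones.\<close>

definition lincomb :: "'a list \<Rightarrow> (nat \<Rightarrow> int) \<Rightarrow> 'a" where
  "lincomb bs = (\<lambda>n. finprod G (\<lambda>i. bs ! i [^] n i) {..<length bs})"

lemma nth_carrier: "set bs \<subseteq> carrier G \<Longrightarrow> i < length bs \<Longrightarrow> bs ! i \<in> carrier G"
  using nth_mem by blast

lemma lincomb_cong: "(\<And>i. i < length bs \<Longrightarrow> n i = n' i) \<Longrightarrow> set bs \<subseteq> carrier G \<Longrightarrow> lincomb bs n = lincomb bs n'"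
  unfolding lincomb_def by (intro finprod_cong') (auto intro: nth_carrier)

lemma lincomb_add:
  assumes "set bs \<subseteq> carrier G"
  shows "lincomb bs (\<lambda>i. n i + n' i) = lincomb bs n \<otimes> lincomb bs n'"
proof -
  note bs = nth_carrier [OF assms]
  have "lincomb bs (\<lambda>i. n i + n' i) = finprod G (\<lambda>i. bs ! i [^] n i \<otimes> bs ! i [^] n' i) {..<length bs}"
    unfolding lincomb_def using bs by (intro finprod_cong') (auto simp: int_pow_mult)
  also have "\<dots> = lincomb bs n \<otimes> lincomb bs n'"
    unfolding lincomb_def using bs by (intro finprod_multf) auto
  finally show ?thesis .
qed

lemma lincomb_scale:
  assumes "set bs \<subseteq> carrier G"
  shows "lincomb bs (\<lambda>i. k * n i) = lincomb bs n [^] k"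
proof -
  note bs = nth_carrier [OF assms]
  have "lincomb bs n [^] k = finprod G (\<lambda>i. (bs ! i [^] n i) [^] k) {..<length bs}"
    unfolding lincomb_def using bs by (intro int_pow_finprod) auto
  also have "\<dots> = lincomb bs (\<lambda>i. k * n i)"
    unfolding lincomb_def using bs by (intro finprod_cong') (auto simp: int_pow_pow mult.commute)
  finally show ?thesis by simp
qed

lemma lincomb_unit:
  assumes "set bs \<subseteq> carrier G" "i < length bs"
  shows "lincomb bs (\<lambda>j. if i = j then 1 else 0) = bs ! i"
proof -
  have "lincomb bs (\<lambda>j. if i = j then 1 else 0) = finprod G (\<lambda>j. if i = j then bs ! j else \<one>) {..<length bs}"
    unfolding lincomb_def using nth_carrier [OF assms(1)] by (intro finprod_cong') auto
  also have "\<dots> = bs ! i"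
    using assms by (intro finprod_singleton) (auto intro: nth_carrier)
  finally show ?thesis .
qed

lemma lincomb_single: "x \<in> carrier G \<Longrightarrow> lincomb [x] n = x [^] n 0"
  by (simp add: lincomb_def lessThan_Suc)

lemma lincomb_pair: "x \<in> carrier G \<Longrightarrow> y \<in> carrier G \<Longrightarrow> lincomb [x, y] n = x [^] n 0 \<otimes> y [^] n 1"
  by (simp add: lincomb_def lessThan_Suc m_comm)

lemma Z_basisD:
  assumes "Z_basis G P bs" "set bs \<subseteq> carrier G"
  shows "lincomb bs n \<in> P"
    and "p \<in> P \<Longrightarrow> \<exists>n. p = lincomb bs n"
    and "lincomb bs n = lincomb bs n' \<Longrightarrow> i < length bs \<Longrightarrow> n i = n' i"
proof -
  have bij: "bij_betw (lincomb bs) ({..<length bs} \<rightarrow>\<^sub>E UNIV) P"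
    using assms(1) by (simp add: Z_basis_def lincomb_def)
  \<comment> \<open>Restriction to the index range passes from an arbitrary coefficient function to
    one of the extensional functions over which \<open>Z_basis\<close> quantifies.\<close>
  have eq: "lincomb bs (restrict n {..<length bs}) = lincomb bs n" for n
    by (rule lincomb_cong) (use assms(2) in auto)
  have mem: "restrict n {..<length bs} \<in> {..<length bs} \<rightarrow>\<^sub>E UNIV" for n :: "nat \<Rightarrow> int"
    by simp
  have inj: "inj_on (lincomb bs) ({..<length bs} \<rightarrow>\<^sub>E UNIV)"
    and img: "lincomb bs ` ({..<length bs} \<rightarrow>\<^sub>E UNIV) = P"
    using bij by (simp_all add: bij_betw_def)
  show "lincomb bs n \<in> P"
    unfolding img [symmetric] by (rule image_eqI [OF _ mem [of n]]) (simp add: eq)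
  show "\<exists>n. p = lincomb bs n" if "p \<in> P"
    using that unfolding img [symmetric] by blast
  show "n i = n' i" if "lincomb bs n = lincomb bs n'" "i < length bs"
  proof -
    have "restrict n {..<length bs} = restrict n' {..<length bs}"
      by (rule inj_onD [OF inj _ mem mem]) (simp add: eq that(1))
    then show ?thesis
      using that(2) by (metis lessThan_iff restrict_apply')
  qed
qed

text \<open>Express \<open>bs\<close> in \<open>x, y\<close> by a matrix \<open>A\<close> and
  \<open>x, y\<close> in \<open>bs\<close> by a matrix \<open>C\<close>. They are mutually inverse,
  so traces give the rank, and the Gram determinant is multiplied by the square of the determinant
  of \<open>A\<close>, which is a unit of the integers.\<close>

lemma Z_basis_pair_gram_det:
  fixes f :: "'a \<Rightarrow> 'a \<Rightarrow> rat"
  assumes xy: "x \<in> carrier G" "y \<in> carrier G" and bxy: "Z_basis G P [x, y]"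
    and bs: "set bs \<subseteq> carrier G" "Z_basis G P bs"
    and left: "\<And>u v w m n. u \<in> carrier G \<Longrightarrow> v \<in> carrier G \<Longrightarrow> w \<in> carrier G \<Longrightarrow>
      f (u [^] (m :: int) \<otimes> v [^] (n :: int)) w = of_int m * f u w + of_int n * f v w"
    and right: "\<And>u v w m n. u \<in> carrier G \<Longrightarrow> v \<in> carrier G \<Longrightarrow> w \<in> carrier G \<Longrightarrow>
      f w (u [^] (m :: int) \<otimes> v [^] (n :: int)) = of_int m * f w u + of_int n * f w v"
  shows "length bs = 2"
    and "f (bs ! 0) (bs ! 0) * f (bs ! 1) (bs ! 1) - f (bs ! 0) (bs ! 1) * f (bs ! 1) (bs ! 0) =
      f x x * f y y - f x y * f y x"
proof -
  let ?m = "length bs"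
  note bsc = nth_carrier [OF bs(1)]
  have xyc: "set [x, y] \<subseteq> carrier G" using xy by simp
  have "\<exists>n. bs ! i = lincomb [x, y] n" if "i < ?m" for i
    using Z_basisD(1) [OF bs(2,1)] lincomb_unit [OF bs(1) that] Z_basisD(2) [OF bxy xyc] by metis
  then obtain N where N: "\<And>i. i < ?m \<Longrightarrow> bs ! i = lincomb [x, y] (N i)" by metis
  define A0 A1 where "A0 i = N i 0" and "A1 i = N i 1" for i
  have A: "bs ! i = x [^] A0 i \<otimes> y [^] A1 i" if "i < ?m" for i
    using N [OF that] xy by (simp add: lincomb_pair A0_def A1_def)
  have "x = lincomb [x, y] (\<lambda>j. if 0 = j then 1 else 0)" "y = lincomb [x, y] (\<lambda>j. if 1 = j then 1 else 0)"
    using xy by (simp_all add: lincomb_pair)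
  then have "x \<in> P" "y \<in> P"
    using Z_basisD(1) [OF bxy xyc] by metis+
  then obtain C0 C1 where C: "x = lincomb bs C0" "y = lincomb bs C1"
    using Z_basisD(2) [OF bs(2,1)] by metis
  have AC: "A0 i * C0 j + A1 i * C1 j = (if i = j then 1 else 0)" if "i < ?m" "j < ?m" for i j
  proof -
    have "lincomb bs (\<lambda>j. A0 i * C0 j + A1 i * C1 j) = x [^] A0 i \<otimes> y [^] A1 i"
      unfolding lincomb_add [OF bs(1)] lincomb_scale [OF bs(1)] C [symmetric] ..
    also have "\<dots> = lincomb bs (\<lambda>j. if i = j then 1 else 0)"
      using A [OF that(1)] lincomb_unit [OF bs(1) that(1)] by simp
    finally show ?thesis
      using Z_basisD(3) [OF bs(2,1) _ that(2)] by blast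
  qed
  have expand: "lincomb bs n = x [^] (\<Sum>j<?m. n j * A0 j) \<otimes> y [^] (\<Sum>j<?m. n j * A1 j)" for n
  proof -
    have "lincomb bs n = finprod G (\<lambda>j. x [^] (n j * A0 j) \<otimes> y [^] (n j * A1 j)) {..<?m}"
      unfolding lincomb_def using A xy
      by (intro finprod_cong') (auto simp: int_pow_mult_distrib m_comm int_pow_pow mult.commute)
    also have "\<dots> = finprod G (\<lambda>j. x [^] (n j * A0 j)) {..<?m} \<otimes> finprod G (\<lambda>j. y [^] (n j * A1 j)) {..<?m}"
      using xy by (intro finprod_multf) auto
    finally show ?thesis
      using xy by (simp add: finprod_int_pow)
  qed
  have coord: "m = m' \<and> n = n'" if "x [^] m \<otimes> y [^] n = x [^] m' \<otimes> y [^] n'" for m n m' n' :: int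
    using Z_basisD(3) [OF bxy xyc, of "\<lambda>i. if i = 0 then m else n" "\<lambda>i. if i = 0 then m' else n'" 0]
      Z_basisD(3) [OF bxy xyc, of "\<lambda>i. if i = 0 then m else n" "\<lambda>i. if i = 0 then m' else n'" 1]
      that xy by (simp add: lincomb_pair)
  have "x [^] (\<Sum>j<?m. C0 j * A0 j) \<otimes> y [^] (\<Sum>j<?m. C0 j * A1 j) = x [^] (1 :: int) \<otimes> y [^] (0 :: int)"
    using expand [of C0] C(1) xy by simp
  then have t0: "(\<Sum>j<?m. C0 j * A0 j) = 1"
    using coord by blast
  have "x [^] (\<Sum>j<?m. C1 j * A0 j) \<otimes> y [^] (\<Sum>j<?m. C1 j * A1 j) = x [^] (0 :: int) \<otimes> y [^] (1 :: int)"
    using expand [of C1] C(2) xy by simp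
  then have t1: "(\<Sum>j<?m. C1 j * A1 j) = 1"
    using coord by blast
  \<comment> \<open>the traces of \<open>A C\<close> and \<open>C A\<close> agree\<close>
  have "int ?m = (\<Sum>j<?m. A0 j * C0 j + A1 j * C1 j)"
    using AC by simp
  also have "\<dots> = 2"
    using t0 t1 by (simp add: sum.distrib mult.commute)
  finally show m: "?m = 2" by simp
  \<comment> \<open>Multiplicativity of 2 by 2 determinants, written out: the right-hand side is the
    determinant of the product, and its entries are those of \<open>AC\<close>.\<close>
  have "(A0 0 * A1 1 - A0 1 * A1 0) * (C0 0 * C1 1 - C0 1 * C1 0) =
      (A0 0 * C0 0 + A1 0 * C1 0) * (A0 1 * C0 1 + A1 1 * C1 1) -
      (A0 0 * C0 1 + A1 0 * C1 1) * (A0 1 * C0 0 + A1 1 * C1 0)"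
    by (simp add: algebra_simps)
  also have "\<dots> = 1"
    using AC [of 0 0] AC [of 0 1] AC [of 1 0] AC [of 1 1] m by simp
  finally have "A0 0 * A1 1 - A0 1 * A1 0 = 1 \<or> A0 0 * A1 1 - A0 1 * A1 0 = - 1"
    by (auto simp: zmult_eq_1_iff)
  then have sq: "(of_int (A0 0) * of_int (A1 1) - of_int (A0 1) * of_int (A1 0)) ^ 2 = (1 :: rat)"
    by (auto simp flip: of_int_mult of_int_diff)
  have g: "f (bs ! i) (bs ! j) = of_int (A0 i) * of_int (A0 j) * f x x + of_int (A0 i) * of_int (A1 j) * f x y +
      of_int (A1 i) * of_int (A0 j) * f y x + of_int (A1 i) * of_int (A1 j) * f y y" if "i < 2" "j < 2" for i j
    using that m A [of i] A [of j] xy bsc [of j] by (simp add: left right algebra_simps)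
  have "f (bs ! 0) (bs ! 0) * f (bs ! 1) (bs ! 1) - f (bs ! 0) (bs ! 1) * f (bs ! 1) (bs ! 0) =
      (of_int (A0 0) * of_int (A1 1) - of_int (A0 1) * of_int (A1 0)) ^ 2 * (f x x * f y y - f x y * f y x)"
    by (simp add: g) (simp add: power2_eq_square algebra_simps)
  then show "f (bs ! 0) (bs ! 0) * f (bs ! 1) (bs ! 1) - f (bs ! 0) (bs ! 1) * f (bs ! 1) (bs ! 0) =
      f x x * f y y - f x y * f y x"
    using sq by simp
qed

end

text \<open>
  The elements of a basis list are not required to lie in the group.  In a quotient group, where the
  product is that of sets, an arbitrary representing set \<open>x\<close> acts like the coset \<open>\<one> \<otimes> x\<close>.
\<close>

locale total_comm_group = comm_group G for G (structure) +
  assumes total_assoc: "(x \<otimes> y) \<otimes> z = x \<otimes> (y \<otimes> z)" and total_comm: "x \<otimes> y = y \<otimes> x"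
begin

text \<open>\<open>x\<close> may lie outside the group. Associativity for arbitrary elements turns
  the product of \<open>x \<otimes> y\<close> with the inverse of \<open>y\<close> into
  \<open>\<one> \<otimes> x\<close>.\<close>

lemma one_mult_closed:
  assumes "x \<otimes> y \<in> carrier G" "y \<in> carrier G"
  shows "\<one> \<otimes> x \<in> carrier G"
proof -
  have "(x \<otimes> y) \<otimes> inv y = \<one> \<otimes> x"
    unfolding total_assoc r_inv [OF assms(2)] by (rule total_comm)
  then show ?thesis using assms by (metis inv_closed m_closed)
qed

lemma pow_one_mult:
  assumes "\<one> \<otimes> x \<in> carrier G"
  shows "(\<one> \<otimes> x) [^] (k :: int) = x [^] k"
proof -
  have "(\<one> \<otimes> x) [^] (m :: nat) = x [^] m" for m
  proof (induction m)
    case (Suc m)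
    have "x [^] m \<in> carrier G"
      using nat_pow_closed [OF assms, of m] by (simp only: Suc)
    then have "x [^] m \<otimes> (\<one> \<otimes> x) = x [^] m \<otimes> x"
      using total_assoc [of "x [^] m" \<one> x] by simp
    then show ?case by (simp only: nat_pow_Suc Suc)
  qed (simp only: nat_pow_0)
  then show ?thesis by (simp only: int_pow_def2)
qed

text \<open>The relation behind \<open>finprod\<close> demands that every partial product lies in
  the carrier. Dividing a partial product by its predecessor leaves
  \<open>\<one> \<otimes> g i\<close>.\<close>

lemma foldSetD_factor:
  assumes "(A, z) \<in> foldSetD (carrier G) (mult G \<circ> g) \<one>"
  shows "i \<in> A \<Longrightarrow> \<one> \<otimes> g i \<in> carrier G"
  using assms
proof (induction rule: foldSetD.induct)
  case (insertI x A y)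
  then show ?case
    using one_mult_closed [of "g x" y] foldSetD_closed [OF insertI.hyps(3)] by auto
qed simp

text \<open>A bad entry contradicts injectivity. Of two consecutive powers of it at least one is
  outside the carrier, and with such an exponent the product has no value and defaults to one fixed
  element, the same for all these exponents.\<close>

lemma Z_basis_one_mult_closed:
  assumes "Z_basis G P bs" "i < length bs"
  shows "\<one> \<otimes> bs ! i \<in> carrier G"
proof (rule ccontr)
  assume no: "\<one> \<otimes> bs ! i \<notin> carrier G"
  define x where "x = bs ! i"
  have step: "x [^] Suc k \<notin> carrier G" if "x [^] k \<in> carrier G" for k :: nat
    using one_mult_closed [of x "x [^] k"] that no by (auto simp: x_def total_comm)
  have one_pow: "\<one> \<otimes> x [^] k = x [^] k" for k :: nat
  proof (induction k)
    case (Suc k)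
    then show ?case by (metis nat_pow_Suc total_assoc)
  qed simp
  define n where "n k j = (if j < length bs then if j = i then int k else 0 else undefined)" for k j
  have n: "n k \<in> {..<length bs} \<rightarrow>\<^sub>E UNIV" for k
    by (simp add: n_def PiE_def extensional_def)
  have junk: "finprod G (\<lambda>j. bs ! j [^] n k j) {..<length bs} = (THE x. False)"
    if xk: "x [^] k \<notin> carrier G" for k
  proof -
    have "({..<length bs}, z) \<notin> foldSetD (carrier G) (mult G \<circ> (\<lambda>j. bs ! j [^] n k j)) \<one>" for z
    proof
      assume "({..<length bs}, z) \<in> foldSetD (carrier G) (mult G \<circ> (\<lambda>j. bs ! j [^] n k j)) \<one>"
      from foldSetD_factor [OF this, of i] assms(2) have "\<one> \<otimes> x [^] k \<in> carrier G"
        by (simp add: n_def x_def int_pow_int)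
      then show False using xk by (simp add: one_pow)
    qed
    then show ?thesis
      by (simp add: finprod_def foldD_def)
  qed
  have ex: "\<exists>k\<in>{m, Suc m}. x [^] k \<notin> carrier G" for m
    using step [of m] by blast
  \<comment> \<open>The ranges 1, 2 and 3, 4 are disjoint, so the two exponents found are distinct
    coefficients with the same default product.\<close>
  obtain k where k: "k \<in> {1, Suc 1}" "x [^] k \<notin> carrier G"
    using ex [of 1] by blast
  obtain l where l: "l \<in> {3, Suc 3}" "x [^] l \<notin> carrier G"
    using ex [of 3] by blast
  have "n k = n l"
    by (rule inj_onD [OF bij_betw_imp_inj_on [OF assms(1) [unfolded Z_basis_def]] _ n n])
       (simp only: junk [OF k(2)] junk [OF l(2)])
  then have "n k i = n l i" by simp
  then show False
    using k(1) l(1) assms(2) by (auto simp: n_def)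
qed

lemma lattice_disc_pair:
  fixes f :: "'a \<Rightarrow> 'a \<Rightarrow> rat"
  assumes xy: "x \<in> carrier G" "y \<in> carrier G" and bxy: "Z_basis G P [x, y]"
    and left: "\<And>u v w m n. u \<in> carrier G \<Longrightarrow> v \<in> carrier G \<Longrightarrow> w \<in> carrier G \<Longrightarrow>
      f (u [^] (m :: int) \<otimes> v [^] (n :: int)) w = of_int m * f u w + of_int n * f v w"
    and right: "\<And>u v w m n. u \<in> carrier G \<Longrightarrow> v \<in> carrier G \<Longrightarrow> w \<in> carrier G \<Longrightarrow>
      f w (u [^] (m :: int) \<otimes> v [^] (n :: int)) = of_int m * f w u + of_int n * f w v"
    and repr: "\<And>u v. \<one> \<otimes> u \<in> carrier G \<Longrightarrow> \<one> \<otimes> v \<in> carrier G \<Longrightarrow> f u v = f (\<one> \<otimes> u) (\<one> \<otimes> v)"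
  shows "lattice_disc G P f = f x x * f y y - f x y * f y x"
  unfolding lattice_disc_def
proof (rule the_equality)
  have "Matrix.mat (length [x, y]) (length [x, y]) (\<lambda>(i, j). f ([x, y] ! i) ([x, y] ! j)) =
      Matrix.mat 2 2 (\<lambda>(i, j). f ([x, y] ! i) ([x, y] ! j))"
    by (simp add: numeral_2_eq_2)
  then have "f x x * f y y - f x y * f y x =
      Determinant.det (Matrix.mat (length [x, y]) (length [x, y]) (\<lambda>(i, j). f ([x, y] ! i) ([x, y] ! j)))"
    by (simp only: det_mat_2) simp
  then show "\<exists>bs. Z_basis G P bs \<and> f x x * f y y - f x y * f y x =
      Determinant.det (Matrix.mat (length bs) (length bs) (\<lambda>(i, j). f (bs ! i) (bs ! j)))"
    using bxy by blast
next
  fix \<delta>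
  assume "\<exists>bs. Z_basis G P bs \<and>
      \<delta> = Determinant.det (Matrix.mat (length bs) (length bs) (\<lambda>(i, j). f (bs ! i) (bs ! j)))"
  then obtain bs where bs: "Z_basis G P bs"
    and \<delta>: "\<delta> = Determinant.det (Matrix.mat (length bs) (length bs) (\<lambda>(i, j). f (bs ! i) (bs ! j)))"
    by blast
  \<comment> \<open>The normalized list has entries in the group and the same powers as
    \<open>bs\<close>, hence the same products, so it is again a basis. By \<open>repr\<close> its
    Gram matrix is that of \<open>bs\<close> too.\<close>
  define cs where "cs = map (\<lambda>u. \<one> \<otimes> u) bs"
  have rc: "\<one> \<otimes> bs ! i \<in> carrier G" if "i < length bs" for i
    by (rule Z_basis_one_mult_closed [OF bs that])
  have len_cs: "length cs = length bs"
    by (simp add: cs_def)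
  have cs: "set cs \<subseteq> carrier G"
    using rc by (auto simp: cs_def in_set_conv_nth)
  have pow: "cs ! i [^] (k :: int) = bs ! i [^] k" if "i < length bs" for i k
    using pow_one_mult [OF rc [OF that]] that by (simp add: cs_def)
  have "finprod G (\<lambda>i. bs ! i [^] n i) {..<length bs} = finprod G (\<lambda>i. cs ! i [^] n i) {..<length cs}"
    for n :: "nat \<Rightarrow> int"
  proof (rule finprod_cong')
    show "(\<lambda>i. cs ! i [^] n i) \<in> {..<length cs} \<rightarrow> carrier G"
      using cs by (auto intro: nth_carrier)
  qed (simp_all add: pow len_cs)
  then have csb: "Z_basis G P cs"
    using bs unfolding Z_basis_def by (simp add: len_cs)
  note gram = Z_basis_pair_gram_det [OF xy bxy cs csb left right]
  have len: "length bs = 2"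
    using gram(1) by (simp add: cs_def)
  have feq: "f (bs ! i) (bs ! j) = f (cs ! i) (cs ! j)" if "i < 2" "j < 2" for i j
    using repr [OF rc rc, of i j] that len by (simp add: cs_def)
  have "\<delta> = f (bs ! 0) (bs ! 0) * f (bs ! 1) (bs ! 1) - f (bs ! 0) (bs ! 1) * f (bs ! 1) (bs ! 0)"
    unfolding \<delta> len det_mat_2 ..
  also have "\<dots> = f x x * f y y - f x y * f y x"
    using gram(2) by (simp add: feq)
  finally show "\<delta> = f x x * f y y - f x y * f y x" .
qed

end

section \<open>B-fields and the Brauer homomorphism\<close>

lemma nat_pow_unit_group [simp]:
  fixes x :: "'a::field"
  shows "x [^]\<^bsub>unit_group\<^esub> (n :: nat) = x ^ n"
  by (induction n) (simp_all add: nat_pow_def)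

text \<open>The product of the quotient group is elementwise addition of sets of cochains, which is
  associative and commutative on all sets, not only on cosets.\<close>

lemma (in additive_sheaf) total_comm_group_cohomology:
  "total_comm_group (cohomology X additive_group F q)"
proof (intro total_comm_group.intro comm_group_cohomology total_comm_group_axioms.intro)
  fix x y z :: "('p, complex) cochain set"
  show "(x \<otimes>\<^bsub>cohomology X additive_group F q\<^esub> y) \<otimes>\<^bsub>cohomology X additive_group F q\<^esub> z =
      x \<otimes>\<^bsub>cohomology X additive_group F q\<^esub> (y \<otimes>\<^bsub>cohomology X additive_group F q\<^esub> z)"
    by (simp add: cohomology_def set_mult_def add.assoc)
  show "x \<otimes>\<^bsub>cohomology X additive_group F q\<^esub> y = y \<otimes>\<^bsub>cohomology X additive_group F q\<^esub> x"
  proof -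
    have "(\<Union>c\<in>x. \<Union>d\<in>y. {\<lambda>xs p. c xs p + d xs p}) = (\<Union>d\<in>y. \<Union>c\<in>x. {\<lambda>xs p. c xs p + d xs p})"
      by blast
    also have "\<dots> = (\<Union>d\<in>y. \<Union>c\<in>x. {\<lambda>xs p. d xs p + c xs p})"
      by (simp only: add.commute)
    finally show ?thesis
      by (simp add: cohomology_def set_mult_def)
  qed
qed

lemma (in ring_sheaf) cls_scale_cong:
  assumes "\<And>W. openin X W \<Longrightarrow> (\<lambda>p. r) \<in> F W" "c \<in> cyc (Suc q)" "d \<in> cyc (Suc q)" "cls (Suc q) c = cls (Suc q) d"
  shows "cls (Suc q) (\<lambda>xs p. r * c xs p) = cls (Suc q) (\<lambda>xs p. r * d xs p)"
proof -
  obtain e where e: "e \<in> coch q" "agree X (Suc q) c (\<lambda>xs p. d xs p + add_coboundary e xs p)"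
    using cls_eqE [OF assms(2-4)] .
  have "agree X (Suc q) (\<lambda>xs p. r * c xs p) (\<lambda>xs p. r * d xs p + add_coboundary (\<lambda>xs p. r * e xs p) xs p)"
    using e(2) by (rule agree_cong) (simp add: add_coboundary_cmult distrib_left)
  from cls_eqI(2) [OF cyc_scale [OF assms(1,3)] coch_scale [OF assms(1) e(1)] this] show ?thesis .
qed

context complex_space
begin

text \<open>As 0 is a coboundary, a set \<open>u\<close> whose product with the trivial coset is a
  class is a non-empty set of representatives of that class. The union in \<open>induced\<close>
  then yields the image of this class.\<close>

lemma Z_to_Q_one_mult:
  assumes "\<one>\<^bsub>HZ S q\<^esub> \<otimes>\<^bsub>HZ S q\<^esub> u \<in> carrier (HZ S q)"
  shows "Z_to_Q S q u = Z_to_Q S q (\<one>\<^bsub>HZ S q\<^esub> \<otimes>\<^bsub>HZ S q\<^esub> u)"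
proof -
  obtain c where c: "c \<in> ZS.cyc q" "\<one>\<^bsub>HZ S q\<^esub> \<otimes>\<^bsub>HZ S q\<^esub> u = ZS.cls q c"
    using assms unfolding HZ_def by (rule ZS.cohomologyE)
  have sum: "ZS.cls q c = (\<Union>b\<in>coboundaries X additive_group (locally_constant X \<int>) q. \<Union>a\<in>u. {\<lambda>xs p. b xs p + a xs p})"
    unfolding c(2) [symmetric] by (simp add: HZ_def cohomology_def set_mult_def)
  have "u \<noteq> {}"
    using ZS.coh_class_self [OF c(1)] unfolding sum by auto
  have zero: "(\<lambda>xs p. 0 :: complex) \<in> coboundaries X additive_group (locally_constant X \<int>) q"
    using subgroup.one_closed [OF ZS.subgroup_coboundaries [of q]] by simp
  have "QS.cls q a = QS.cls q c" if "a \<in> u" for a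
  proof -
    have "(\<lambda>xs p. 0 + a xs p) \<in> ZS.cls q c"
      unfolding sum using zero that by blast
    then have "a \<in> ZS.cls q c" by simp
    then show ?thesis
      using ZS.coh_class_memD [OF c(1)] c(1) by (intro ZQ_cls_eq) auto
  qed
  then have "Z_to_Q S q u = QS.cls q c"
    using \<open>u \<noteq> {}\<close> unfolding Z_to_Q_def induced_def by auto
  then show ?thesis
    using c by (simp add: Z_to_Q_cls)
qed

lemma half_Q: "openin X W \<Longrightarrow> (\<lambda>p. 1 / 2) \<in> locally_constant X \<rat> W"
  by (rule const_Q) simp

abbreviation half :: "('p, complex) cochain \<Rightarrow> ('p, complex) cochain" where
  "half c \<equiv> \<lambda>xs p. 1 / 2 * c xs p"

lemma half_cyc: "c \<in> ZS.cyc q \<Longrightarrow> half c \<in> QS.cyc q"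
  by (rule QS.cyc_scale [OF half_Q ZQ_cyc])

lemma exp_cochain_cocycle: "c \<in> OS.cyc q \<Longrightarrow> exp_cochain c \<in> cocycles X unit_group (hol_units S) q"
  by (rule cochain_map.map_cocycles [OF cochain_map_O_to_U])

lemma exp_integral_one:
  assumes "c \<in> ZS.cyc (Suc q)"
  shows "ucls (Suc q) (exp_cochain c) = \<one>\<^bsub>HU S (Suc q)\<^esub>"
proof -
  obtain U where U: "U \<in> point_covers X"
      "\<And>xs. xs \<in> simplices X (Suc q) \<Longrightarrow> c xs \<in> locally_constant X \<int> (overlap U xs)"
    using ZS.cocycles_cochains [OF assms] by (auto simp: cochains_def)
  have "agree X (Suc q) (exp_cochain c) (\<lambda>xs p. 1)"
    unfolding agree_def
  proof (intro bexI [OF _ U(1)] ballI)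
    fix xs p assume "xs \<in> simplices X (Suc q)" "p \<in> overlap U xs"
    then have "c xs p \<in> \<int>"
      using U(2) by (auto simp: locally_constant_def)
    then show "exp_cochain c xs p = 1"
      by (simp add: exp_cochain_def exp_eq_1_iff_Ints)
  qed
  then have "ucls (Suc q) (exp_cochain c) = ucls (Suc q) (\<lambda>xs p. \<one>\<^bsub>unit_group\<^esub>)"
    using US.coh_class_eqI(2) [OF US.cocycles_one US.cochains_one, of q "exp_cochain c"]
    by (simp add: US.coboundary_one [simplified])
  then show ?thesis
    using US.coh_class_one [of "Suc q"] by (simp add: HU_def)
qed

lemma B_field_half:
  assumes "k \<in> ZS.cyc 2"
  shows "B_field S (ucls 2 (exp_cochain (half k))) (QS.cls 2 (half k))"
  unfolding B_field_def
proof (intro conjI)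
  show "QS.cls 2 (half k) \<in> carrier (HQ S 2)"
    using half_cyc [OF assms] by (auto simp: HQ_def)
  have "QS.cls 2 (half k) [^]\<^bsub>HQ S 2\<^esub> (2 :: nat) = QS.cls 2 (half k) [^]\<^bsub>HQ S 2\<^esub> (2 :: int)"
    using int_pow_int [of "HQ S 2" "QS.cls 2 (half k)" 2] by simp
  also have "\<dots> = QS.cls 2 k"
    using QS.cls_int_pow [OF half_cyc [OF assms], of 2] by (simp add: HQ_def)
  also have "\<dots> = Z_to_Q S 2 (ZS.cls 2 k)"
    using assms by (simp add: Z_to_Q_cls)
  finally show "QS.cls 2 (half k) [^]\<^bsub>HQ S 2\<^esub> (2 :: nat) \<in> Z_to_Q S 2 ` carrier (HZ S 2)"
    using assms by (auto simp: HZ_def)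
  show "O_to_U S 2 (Q_to_O S 2 (QS.cls 2 (half k))) = ucls 2 (exp_cochain (half k))"
    using half_cyc [OF assms] by (simp add: Q_to_O_cls O_to_U_cls QO_cyc)
qed

lemma half_Br2:
  assumes "k \<in> ZS.cyc 2"
  shows "ucls 2 (exp_cochain (half k)) \<in> Br2 S"
proof -
  have c: "exp_cochain (half k) \<in> cocycles X unit_group (hol_units S) 2"
    by (intro exp_cochain_cocycle QO_cyc half_cyc assms)
  have "exp_cochain (half k) xs p ^ 2 = exp_cochain k xs p" for xs p
    by (simp add: exp_cochain_def algebra_simps flip: exp_of_nat_mult)
  then have "ucls 2 (exp_cochain (half k)) [^]\<^bsub>HU S 2\<^esub> (2 :: nat) = ucls 2 (exp_cochain k)"
    using US.coh_class_nat_pow [OF c, of 2] unfolding HU_def nat_pow_unit_group by presburger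
  also have "\<dots> = \<one>\<^bsub>HU S 2\<^esub>"
    using exp_integral_one [of k 1] assms unfolding numeral_2_eq_2 One_nat_def by blast
  finally have "ucls 2 (exp_cochain (half k)) [^]\<^bsub>HU S 2\<^esub> (2 :: nat) = \<one>\<^bsub>HU S 2\<^esub>" .
  moreover have "ucls 2 (exp_cochain (half k)) \<in> carrier (HU S 2)"
    unfolding HU_def by (rule US.coh_class_carrier [OF c])
  ultimately show ?thesis
    unfolding Br2_def Br_def using zero_less_numeral by blast
qed

text \<open>Membership in \<open>Pic\<close> is vanishing in the second cohomology of O, where
  cochains may be multiplied by 1/2.\<close>

lemma Pic_half:
  assumes z: "z \<in> ZS.cyc 2" and "ZS.cls 2 (\<lambda>xs p. 2 * z xs p) \<in> Pic S"
  shows "ZS.cls 2 z \<in> Pic S"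
proof -
  have z2: "(\<lambda>xs p. 2 * z xs p) \<in> ZS.cyc 2"
    by (rule ZS.cyc_scale [OF _ z]) (rule const_Z, auto)
  have "OS.cls 2 (\<lambda>xs p. 2 * z xs p) = OS.cls 2 (\<lambda>xs p. 0)"
    using assms(2) Pic_iff [OF z2] by simp
  then have "OS.cls 2 (\<lambda>xs p. 1 / 2 * (2 * z xs p)) = OS.cls 2 (\<lambda>xs p. 1 / 2 * 0)"
    using OS.cls_scale_cong [of "1 / 2" "\<lambda>xs p. 2 * z xs p" 1 "\<lambda>xs p. 0"] hol_const z2 OS.cyc_zero [of 2]
    by (simp add: numeral_2_eq_2 QO_cyc ZQ_cyc)
  then show ?thesis
    using Pic_iff [OF z] by simp
qed

text \<open>Exactness makes \<open>b\<close> equal to an integral \<open>z\<close> in the cohomology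
  of O; then \<open>w - 2 z\<close> vanishes there, like \<open>2 b - 2 b\<close>, and lies in
  \<open>Pic\<close>. This serves both for showing a Brauer class non-trivial and for comparing two
  B-fields of one class.\<close>

lemma exp_one_decompose:
  assumes comp: "compact_space X" and b: "b \<in> QS.cyc 2" and w: "w \<in> ZS.cyc 2"
    and bw: "QS.cls 2 (\<lambda>xs p. 2 * b xs p) = QS.cls 2 w"
    and one: "ucls 2 (exp_cochain b) = \<one>\<^bsub>HU S 2\<^esub>"
  obtains z where "z \<in> ZS.cyc 2" "(\<lambda>xs p. w xs p - 2 * z xs p) \<in> ZS.cyc 2"
    "ZS.cls 2 (\<lambda>xs p. w xs p - 2 * z xs p) \<in> Pic S"
proof -
  obtain z where z: "z \<in> ZS.cyc 2" "OS.cls 2 b = OS.cls 2 z"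
    using exponential_exact_O [OF comp QO_cyc [OF b] one] .
  have zO: "z \<in> OS.cyc 2" and bO: "b \<in> OS.cyc 2" and wO: "w \<in> OS.cyc 2"
    using z(1) b w by (simp_all add: QO_cyc ZQ_cyc)
  have z2: "(\<lambda>xs p. of_int (- 2) * z xs p) \<in> ZS.cyc 2"
    by (rule ZS.cyc_scale [OF _ z(1)]) (rule const_Z, auto)
  have wz: "(\<lambda>xs p. w xs p + of_int (- 2) * z xs p) \<in> ZS.cyc 2"
    by (rule ZS.cyc_add [OF w z2])
  have b2: "(\<lambda>xs p. of_int 2 * b xs p) \<in> QS.cyc 2" "(\<lambda>xs p. of_int (- 2) * b xs p) \<in> QS.cyc 2"
    by (rule QS.cyc_scale [OF _ b]; rule const_Q; simp)+
  have "OS.cls 2 (\<lambda>xs p. w xs p + of_int (- 2) * z xs p) =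
      OS.cls 2 (\<lambda>xs p. of_int 2 * b xs p + of_int (- 2) * b xs p)"
  proof (rule OS.cls_add_cong [OF wO QO_cyc [OF b2(1)] QO_cyc [OF ZQ_cyc [OF z2]] QO_cyc [OF b2(2)]])
    show "OS.cls 2 w = OS.cls 2 (\<lambda>xs p. of_int 2 * b xs p)"
      using bw b2(1) w by (intro QO_cls_eq) (simp_all add: ZQ_cyc)
    show "OS.cls 2 (\<lambda>xs p. of_int (- 2) * z xs p) = OS.cls 2 (\<lambda>xs p. of_int (- 2) * b xs p)"
      using z(2) by (intro OS.cls_int_cong [OF zO bO]) simp
  qed
  then have "OS.cls 2 (\<lambda>xs p. w xs p + of_int (- 2) * z xs p) = OS.cls 2 (\<lambda>xs p. 0)"
    by simp
  then show ?thesis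
    using that [OF z(1)] wz Pic_iff [OF wz] by simp
qed

text \<open>The ambiguity of a B-field by half of \<open>Pic S\<close> and by integral classes. The
  relation is stated for \<open>2 b\<close>, so that all terms on the right are integral
  cocycles.\<close>

lemma B_field_decompose:
  assumes comp: "compact_space X" and k: "k \<in> ZS.cyc 2"
    and B: "B_field S (ucls 2 (exp_cochain (half k))) B"
  obtains b z p where "b \<in> QS.cyc 2" "B = QS.cls 2 b" "z \<in> ZS.cyc 2" "p \<in> ZS.cyc 2" "ZS.cls 2 p \<in> Pic S"
    "QS.cls 2 (\<lambda>xs q. 2 * b xs q) = QS.cls 2 (\<lambda>xs q. p xs q + k xs q + 2 * z xs q)"
proof -
  obtain b where b: "b \<in> QS.cyc 2" "B = QS.cls 2 b"
    using B unfolding B_field_def HQ_def by (metis QS.cohomologyE)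
  have b2: "QS.cls 2 b [^]\<^bsub>HQ S 2\<^esub> (2 :: nat) = QS.cls 2 (\<lambda>xs p. 2 * b xs p)"
    using QS.cls_int_pow [OF b(1), of 2] int_pow_int [of "HQ S 2" "QS.cls 2 b" 2] by (simp add: HQ_def)
  obtain w where w: "w \<in> ZS.cyc 2" "QS.cls 2 (\<lambda>xs p. 2 * b xs p) = QS.cls 2 w"
    using B b2 unfolding B_field_def HZ_def b(2) by (auto elim!: ZS.cohomologyE simp: Z_to_Q_cls)
  have eb: "ucls 2 (exp_cochain b) = ucls 2 (exp_cochain (half k))"
    using B b by (simp add: B_field_def Q_to_O_cls O_to_U_cls QO_cyc)
  \<comment> \<open>The difference of two B-fields of the same class has trivial image in the units.
    Its double is represented by the integral cocycle \<open>w - k\<close>.\<close>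
  define b' where "b' = (\<lambda>xs p. b xs p - half k xs p)"
  have b': "b' \<in> QS.cyc 2"
    unfolding b'_def by (rule QS.cyc_diff [OF b(1) half_cyc [OF k]])
  have "ucls 2 (exp_cochain b') \<otimes>\<^bsub>HU S 2\<^esub> ucls 2 (exp_cochain (half k)) = ucls 2 (exp_cochain b)"
    unfolding HU_def
    using US.coh_class_mult [OF exp_cochain_cocycle [OF QO_cyc [OF b']] exp_cochain_cocycle [OF QO_cyc [OF half_cyc [OF k]]]]
    by (simp add: exp_cochain_def b'_def algebra_simps flip: exp_add)
  moreover have "ucls 2 (exp_cochain b') \<in> carrier (HU S 2)" "ucls 2 (exp_cochain (half k)) \<in> carrier (HU S 2)"
    unfolding HU_def using b' half_cyc [OF k] by (auto intro!: US.coh_class_carrier exp_cochain_cocycle QO_cyc)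
  ultimately have one: "ucls 2 (exp_cochain b') = \<one>\<^bsub>HU S 2\<^esub>"
    using US.comm_group_cohomology [of 2] eb unfolding HU_def
    by (metis comm_group.axioms(2) group.r_cancel_one')
  have nk: "(\<lambda>xs p. of_int (- 1) * k xs p) \<in> ZS.cyc 2"
    by (rule ZS.cyc_scale [OF _ k]) (rule const_Z, auto)
  have wk: "(\<lambda>xs p. w xs p + of_int (- 1) * k xs p) \<in> ZS.cyc 2"
    by (rule ZS.cyc_add [OF w(1) nk])
  have b2c: "(\<lambda>xs p. 2 * b xs p) \<in> QS.cyc 2"
    by (rule QS.cyc_scale [OF _ b(1)]) (rule const_Q, auto)
  have "QS.cls 2 (\<lambda>xs p. 2 * b xs p + of_int (- 1) * k xs p) = QS.cls 2 (\<lambda>xs p. w xs p + of_int (- 1) * k xs p)"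
    by (rule QS.cls_add_cong [OF b2c ZQ_cyc [OF w(1)] ZQ_cyc [OF nk] ZQ_cyc [OF nk] w(2) refl])
  then have "QS.cls 2 (\<lambda>xs p. 2 * b' xs p) = QS.cls 2 (\<lambda>xs p. w xs p + of_int (- 1) * k xs p)"
    by (simp add: b'_def right_diff_distrib)
  from exp_one_decompose [OF comp b' wk this one]
  obtain z where z: "z \<in> ZS.cyc 2" "(\<lambda>xs p. w xs p + of_int (- 1) * k xs p - 2 * z xs p) \<in> ZS.cyc 2"
    "ZS.cls 2 (\<lambda>xs p. w xs p + of_int (- 1) * k xs p - 2 * z xs p) \<in> Pic S" .
  show ?thesis
    by (rule that [OF b z(1) z(2) z(3)]) (simp add: w(2))
qed

end

context degree_space
begin

text \<open>\<open>Brauer_hom\<close> evaluates an arbitrarily chosen B-field, which the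
  decomposition compares with half of \<open>k\<close>. The \<open>Pic\<close> term is orthogonal to
  \<open>x\<close>, the \<open>k\<close> term vanishes by hypothesis, and the integral term
  contributes an integer.\<close>

lemma Brauer_hom_half:
  assumes comp: "compact_space X" and k: "k \<in> ZS.cyc 2" and x: "x \<in> ZS.cyc 2"
    and T: "ZS.cls 2 x \<in> transcendental_lattice S D" and xk: "pairing x k = 0"
  shows "Brauer_hom S D (ucls 2 (exp_cochain (half k))) (ZS.cls 2 x) = 0"
proof -
  let ?a = "ucls 2 (exp_cochain (half k))"
  have "B_field S ?a (SOME B. B_field S ?a B)"
    by (rule someI [of "B_field S ?a", OF B_field_half [OF k]])
  from B_field_decompose [OF comp k this]
  obtain b z p where b: "b \<in> QS.cyc 2" "(SOME B. B_field S ?a B) = QS.cls 2 b"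
    and z: "z \<in> ZS.cyc 2" and p: "p \<in> ZS.cyc 2" "ZS.cls 2 p \<in> Pic S"
    and eq: "QS.cls 2 (\<lambda>xs q. 2 * b xs q) = QS.cls 2 (\<lambda>xs q. p xs q + k xs q + 2 * z xs q)" .
  have Q: "x \<in> QS.cyc 2" "z \<in> QS.cyc 2" "p \<in> QS.cyc 2" "k \<in> QS.cyc 2"
    using x z p k by (simp_all add: ZQ_cyc)
  have pk: "(\<lambda>xs q. p xs q + k xs q) \<in> QS.cyc 2"
    by (rule QS.cyc_add [OF Q(3,4)])
  have "pairing x (\<lambda>xs q. of_int 2 * b xs q) = pairing x (\<lambda>xs q. (p xs q + k xs q) + of_int 2 * z xs q)"
    using eq by (intro pairing_cong Q QS_cyc_int QS.cyc_add b(1)) simp_all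
  then have "2 * pairing x b = pairing x p + pairing x k + 2 * pairing x z"
    unfolding pairing_int_right [OF b(1) Q(1)] pairing_add_right [OF pk QS_cyc_int [OF Q(2)] Q(1)]
      pairing_add_right [OF Q(3,4,1)] pairing_int_right [OF Q(2,1)] by simp
  moreover have "pairing x p = 0"
    using T p x inter_Z_cls [OF x p(1)] by (simp add: transcendental_lattice_def)
  ultimately have "pairing x b = pairing x z"
    using xk by simp
  then have "pairing x b \<in> \<int>"
    using pairing_Z [OF x z] by simp
  then show ?thesis
    unfolding Brauer_hom_def b(2) Z_to_Q_cls [OF x] inter_Q_cls [OF Q(1) b(1)]
    by (simp add: frac_eq_0_iff)
qed

end

section \<open>Comparison of the two fibres\<close>

context degree_space
begin

lemma inter_Z_left:
  fixes k l :: int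
  assumes "u \<in> carrier (HZ S 2)" "v \<in> carrier (HZ S 2)" "w \<in> carrier (HZ S 2)"
  shows "inter_Z S D (u [^]\<^bsub>HZ S 2\<^esub> k \<otimes>\<^bsub>HZ S 2\<^esub> v [^]\<^bsub>HZ S 2\<^esub> l) w =
      of_int k * inter_Z S D u w + of_int l * inter_Z S D v w"
    and "inter_Z S D w (u [^]\<^bsub>HZ S 2\<^esub> k \<otimes>\<^bsub>HZ S 2\<^esub> v [^]\<^bsub>HZ S 2\<^esub> l) =
      of_int k * inter_Z S D w u + of_int l * inter_Z S D w v"
proof -
  obtain a where a: "a \<in> ZS.cyc 2" "u = ZS.cls 2 a"
    using assms(1) unfolding HZ_def by (rule ZS.cohomologyE)
  obtain b where b: "b \<in> ZS.cyc 2" "v = ZS.cls 2 b"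
    using assms(2) unfolding HZ_def by (rule ZS.cohomologyE)
  obtain c where c: "c \<in> ZS.cyc 2" "w = ZS.cls 2 c"
    using assms(3) unfolding HZ_def by (rule ZS.cohomologyE)
  have int: "(\<lambda>xs p. of_int m * z xs p) \<in> ZS.cyc 2" if "z \<in> ZS.cyc 2" for m z
    by (rule ZS.cyc_scale [OF _ that]) (rule const_Z, auto)
  note ia = int [OF a(1), of k] and ib = int [OF b(1), of l]
  have eq: "u [^]\<^bsub>HZ S 2\<^esub> k \<otimes>\<^bsub>HZ S 2\<^esub> v [^]\<^bsub>HZ S 2\<^esub> l =
      ZS.cls 2 (\<lambda>xs p. of_int k * a xs p + of_int l * b xs p)"
    using ZS.cls_add [OF ia ib] by (simp add: a b HZ_def ZS.cls_int_pow)
  have Q: "a \<in> QS.cyc 2" "b \<in> QS.cyc 2" "c \<in> QS.cyc 2"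
      "(\<lambda>xs p. of_int k * a xs p) \<in> QS.cyc 2" "(\<lambda>xs p. of_int l * b xs p) \<in> QS.cyc 2"
    using a b c ia ib by (simp_all add: ZQ_cyc)
  show "inter_Z S D (u [^]\<^bsub>HZ S 2\<^esub> k \<otimes>\<^bsub>HZ S 2\<^esub> v [^]\<^bsub>HZ S 2\<^esub> l) w =
      of_int k * inter_Z S D u w + of_int l * inter_Z S D v w"
    unfolding eq unfolding a(2) b(2) c(2) inter_Z_cls [OF ZS.cyc_add [OF ia ib] c(1)]
      inter_Z_cls [OF a(1) c(1)] inter_Z_cls [OF b(1) c(1)] pairing_add_left [OF Q(4,5,3)]
      pairing_int_left [OF Q(1,3)] pairing_int_left [OF Q(2,3)] ..
  show "inter_Z S D w (u [^]\<^bsub>HZ S 2\<^esub> k \<otimes>\<^bsub>HZ S 2\<^esub> v [^]\<^bsub>HZ S 2\<^esub> l) =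
      of_int k * inter_Z S D w u + of_int l * inter_Z S D w v"
    unfolding eq unfolding a(2) b(2) c(2) inter_Z_cls [OF c(1) ZS.cyc_add [OF ia ib]]
      inter_Z_cls [OF c(1) a(1)] inter_Z_cls [OF c(1) b(1)] pairing_add_right [OF Q(4,5,3)]
      pairing_int_right [OF Q(1,3)] pairing_int_right [OF Q(2,3)] ..
qed

lemma lattice_disc_rank_2:
  assumes x: "x \<in> carrier (HZ S 2)" and y: "y \<in> carrier (HZ S 2)" and basis: "Z_basis (HZ S 2) P [x, y]"
  shows "lattice_disc (HZ S 2) P (inter_Z S D) =
    inter_Z S D x x * inter_Z S D y y - inter_Z S D x y * inter_Z S D y x"
proof (rule total_comm_group.lattice_disc_pair [OF _ x y basis])
  show "total_comm_group (HZ S 2)"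
    unfolding HZ_def by (rule ZS.total_comm_group_cohomology)
qed (fact inter_Z_left | simp add: inter_Z_def Z_to_Q_one_mult [symmetric])+

end

text \<open>What is kept of the family: two spaces with degree maps, and the identifying map
  \<open>\<phi>\<close> with a continuous left inverse. No relation between \<open>D\<close> and
  \<open>D0\<close> is built in.\<close>

locale specialization_pair = A: degree_space S n D + B: degree_space S0 n D0
  for S S0 :: "'p cspace" and n :: "'n::finite itself" and D D0 +
  fixes \<phi> \<psi> :: "'p \<Rightarrow> 'p"
  assumes compact: "compact_space (topol S)"
    and phi: "continuous_map (topol S0) (topol S) \<phi>"
    and psi: "continuous_map (topol S) (topol S0) \<psi>"
    and psi_phi: "y \<in> topspace (topol S0) \<Longrightarrow> \<psi> (\<phi> y) = y"
begin

abbreviation "pull \<equiv> pull_cochain \<phi> :: ('p, complex) cochain \<Rightarrow> ('p, complex) cochain"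

lemma cochain_map_pull_phi:
  "cochain_map additive_group A.X (locally_constant A.X \<int>) additive_group B.X (locally_constant B.X \<int>) pull"
  by (rule cochain_map_pull [OF phi A.ZS.additive_sheaf_axioms B.ZS.additive_sheaf_axioms])

lemma pull_cyc: "c \<in> A.ZS.cyc q \<Longrightarrow> pull c \<in> B.ZS.cyc q"
  by (rule cochain_map.map_cocycles [OF cochain_map_pull_phi])

lemma pull_Z_cls: "c \<in> A.ZS.cyc q \<Longrightarrow> pull_Z S0 q \<phi> (A.ZS.cls q c) = B.ZS.cls q (pull c)"
  unfolding pull_Z_def by (rule cochain_map.induced_coh_class [OF cochain_map_pull_phi])

lemma pull_cls_cong:
  "c \<in> A.ZS.cyc q \<Longrightarrow> d \<in> A.ZS.cyc q \<Longrightarrow> A.ZS.cls q c = A.ZS.cls q d \<Longrightarrow>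
    B.ZS.cls q (pull c) = B.ZS.cls q (pull d)"
  using pull_Z_cls by metis

text \<open>The pullback along \<open>\<psi>\<close> provides a preimage because
  \<open>\<psi>\<close> after \<open>\<phi>\<close> is the identity. This moves \<open>k\<close>,
  given on \<open>S0\<close>, to \<open>S\<close>, where a B-field has to live.\<close>

lemma pull_surj:
  assumes "c \<in> B.ZS.cyc 2"
  obtains d where "d \<in> A.ZS.cyc 2" "B.ZS.cls 2 (pull d) = B.ZS.cls 2 c"
proof -
  have d: "pull_cochain \<psi> c \<in> A.ZS.cyc 2"
    by (rule cochain_map.map_cocycles [OF cochain_map_pull [OF psi B.ZS.additive_sheaf_axioms A.ZS.additive_sheaf_axioms] assms])
  have "agree B.X (Suc 1) (pull (pull_cochain \<psi> c)) (\<lambda>xs p. c xs p + add_coboundary (\<lambda>xs p. 0) xs p)"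
    using pull_cochain_inverse [of B.X \<psi> \<phi> "Suc 1" c] psi_phi
    by (simp add: add_coboundary_cmult [of "\<lambda>_. 0", simplified])
  from B.ZS.cls_eqI(2) [OF _ B.ZS.coch_zero this] assms
  have "B.ZS.cls 2 (pull (pull_cochain \<psi> c)) = B.ZS.cls 2 c"
    by (simp add: numeral_2_eq_2)
  with d show ?thesis by (rule that)
qed

text \<open>
  \<open>D\<close> identifies \<open>H\<^sup>4(S, \<int>)\<close> with \<open>\<int>\<close>, so the pullback of \<open>D0\<close> is a multiple of \<open>D\<close>; the factor is
  read off a class with non-zero square.
\<close>

lemma degree_pull:
  obtains m where "\<And>c. c \<in> A.ZS.cyc 4 \<Longrightarrow> D0 (B.QS.cls 4 (pull c)) = m * D (A.QS.cls 4 c)"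
proof -
  have bij: "bij_betw (D \<circ> Z_to_Q S 4) (carrier (HZ S 4)) \<int>"
    using A.degree_map by (simp add: degree_map_def)
  then obtain u where u: "u \<in> carrier (HZ S 4)" "D (Z_to_Q S 4 u) = 1"
    unfolding bij_betw_def by (metis Ints_1 comp_apply imageE)
  obtain g where g: "g \<in> A.ZS.cyc 4" "u = A.ZS.cls 4 g"
    using u(1) unfolding HZ_def by (rule A.ZS.cohomologyE)
  have Dg: "D (A.QS.cls 4 g) = 1"
    using u(2) g by (simp add: A.Z_to_Q_cls)
  have "D0 (B.QS.cls 4 (pull c)) = D0 (B.QS.cls 4 (pull g)) * D (A.QS.cls 4 c)" if c: "c \<in> A.ZS.cyc 4" for c
  proof -
    have "(D \<circ> Z_to_Q S 4) (A.ZS.cls 4 c) \<in> \<int>"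
      using bij c unfolding bij_betw_def HZ_def by blast
    then obtain k where k: "D (A.QS.cls 4 c) = of_int k"
      using c by (auto simp: A.Z_to_Q_cls elim: Ints_cases)
    have kg: "(\<lambda>xs p. of_int k * g xs p) \<in> A.ZS.cyc 4"
      by (rule A.ZS.cyc_scale [OF _ g(1)]) (rule A.const_Z, auto)
    \<comment> \<open>\<open>g\<close> has degree 1 and \<open>D\<close> is injective on integral
      classes, so \<open>c\<close> is cohomologous to its degree times \<open>g\<close>. Pullback
      preserves this relation.\<close>
    have "(D \<circ> Z_to_Q S 4) (A.ZS.cls 4 c) = (D \<circ> Z_to_Q S 4) (A.ZS.cls 4 (\<lambda>xs p. of_int k * g xs p))"
      using c kg g(1) by (simp add: A.Z_to_Q_cls A.D_int A.ZQ_cyc Dg k)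
    then have "A.ZS.cls 4 c = A.ZS.cls 4 (\<lambda>xs p. of_int k * g xs p)"
      using bij c kg unfolding bij_betw_def HZ_def inj_on_def by blast
    then have "B.ZS.cls 4 (pull c) = B.ZS.cls 4 (\<lambda>xs p. of_int k * pull g xs p)"
      using pull_cls_cong [OF c kg] by (simp add: pull_cochain_def)
    then have "B.QS.cls 4 (pull c) = B.QS.cls 4 (\<lambda>xs p. of_int k * pull g xs p)"
      using pull_cyc [OF c] pull_cyc [OF kg] by (intro B.ZQ_cls_eq) (simp_all add: pull_cochain_def)
    then show ?thesis
      using B.D_int [OF B.ZQ_cyc [OF pull_cyc [OF g(1)]]] k by simp
  qed
  then show ?thesis by (rule that)
qed

text \<open>Since \<open>e\<close> has the same non-zero square on both sides, the proportionality
  factor between the degree maps is 1.\<close>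

lemma pairing_pull:
  assumes e: "e \<in> A.ZS.cyc 2" "A.pairing e e \<noteq> 0" "B.pairing (pull e) (pull e) = A.pairing e e"
    and a: "a \<in> A.ZS.cyc 2" and b: "b \<in> A.ZS.cyc 2"
  shows "B.pairing (pull a) (pull b) = A.pairing a b"
proof -
  obtain m where m: "\<And>c. c \<in> A.ZS.cyc 4 \<Longrightarrow> D0 (B.QS.cls 4 (pull c)) = m * D (A.QS.cls 4 c)"
    using degree_pull by blast
  have "B.pairing (pull x) (pull y) = m * A.pairing x y" if "x \<in> A.ZS.cyc 2" "y \<in> A.ZS.cyc 2" for x y
    using m [of "cup_cochain 2 x y"] A.ZS.cup_cocycles [of x 2 y 2] that
    by (simp add: A.pairing_def B.pairing_def pull_cochain_cup)
  from this [OF e(1,1)] this [OF a b] e(2,3) show ?thesis by simp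
qed

end

section \<open>The vanishing Brauer class\<close>

context specialization_pair
begin

text \<open>The class \<open>e\<close> normalizes the degree maps, so that orthogonality to
  \<open>k\<close> on \<open>S0\<close> can be read on \<open>S\<close>. The lemma is applied to
  \<open>k\<close> and to 0, which yields the two elements of the kernel.\<close>

lemma half_specialization_kernel:
  assumes e: "e \<in> A.ZS.cyc 2" "A.pairing e e \<noteq> 0" "B.pairing (pull e) (pull e) = A.pairing e e"
    and k: "k \<in> A.ZS.cyc 2" and pk: "B.ZS.cls 2 (pull k) \<in> Pic S0"
  shows "A.ucls 2 (exp_cochain (A.half k)) \<in> specialization_kernel S D S0 D0 \<phi>"
  unfolding specialization_kernel_def
proof (intro CollectI conjI ballI impI)
  show "A.ucls 2 (exp_cochain (A.half k)) \<in> Br2 S"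
    by (rule A.half_Br2 [OF k])
  fix x assume x: "x \<in> transcendental_lattice S D"
    and px: "pull_Z S0 2 \<phi> x \<in> transcendental_lattice S0 D0"
  have "x \<in> carrier (HZ S 2)"
    using x by (simp add: transcendental_lattice_def)
  then obtain a where a: "a \<in> A.ZS.cyc 2" "x = A.ZS.cls 2 a"
    unfolding HZ_def by (rule A.ZS.cohomologyE)
  have "inter_Z S0 D0 (pull_Z S0 2 \<phi> x) (B.ZS.cls 2 (pull k)) = 0"
    using px pk by (simp add: transcendental_lattice_def)
  then have "B.pairing (pull a) (pull k) = 0"
    by (simp add: a pull_Z_cls B.inter_Z_cls pull_cyc k)
  then have "A.pairing a k = 0"
    using pairing_pull [OF e a(1) k] by simp
  then show "Brauer_hom S D (A.ucls 2 (exp_cochain (A.half k))) x = 0"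
    using A.Brauer_hom_half [OF compact k a(1)] x a(2) by simp
qed

lemma half_nontrivial:
  assumes e: "e \<in> A.ZS.cyc 2" and k: "k \<in> A.ZS.cyc 2"
    and basisA: "Z_basis (HZ S 2) (Pic S) [A.ZS.cls 2 e]"
    and basisB: "Z_basis (HZ S0 2) (Pic S0) [B.ZS.cls 2 (pull e), B.ZS.cls 2 (pull k)]"
  shows "A.ucls 2 (exp_cochain (A.half k)) \<noteq> \<one>\<^bsub>HU S 2\<^esub>"
proof
  assume one: "A.ucls 2 (exp_cochain (A.half k)) = \<one>\<^bsub>HU S 2\<^esub>"
  have "A.QS.cls 2 (\<lambda>xs p. 2 * A.half k xs p) = A.QS.cls 2 k" by simp
  from A.exp_one_decompose [OF compact A.half_cyc [OF k] k this one]
  obtain z where z: "z \<in> A.ZS.cyc 2" "(\<lambda>xs p. k xs p - 2 * z xs p) \<in> A.ZS.cyc 2"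
    "A.ZS.cls 2 (\<lambda>xs p. k xs p - 2 * z xs p) \<in> Pic S" .
  interpret HA: comm_group "HZ S 2"
    unfolding HZ_def by (rule A.ZS.comm_group_cohomology)
  interpret HB: comm_group "HZ S0 2"
    unfolding HZ_def by (rule B.ZS.comm_group_cohomology)
  let ?e = "B.ZS.cls 2 (pull e)" and ?k = "B.ZS.cls 2 (pull k)"
  have eA: "A.ZS.cls 2 e \<in> carrier (HZ S 2)" and eB: "?e \<in> carrier (HZ S0 2)" and kB: "?k \<in> carrier (HZ S0 2)"
    unfolding HZ_def using e k by (auto intro: A.ZS.coh_class_carrier B.ZS.coh_class_carrier pull_cyc)
  have setA: "set [A.ZS.cls 2 e] \<subseteq> carrier (HZ S 2)" and setB: "set [?e, ?k] \<subseteq> carrier (HZ S0 2)"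
    using eA eB kB by auto
  have intA: "(\<lambda>xs p. of_int m * c xs p) \<in> A.ZS.cyc 2" if "c \<in> A.ZS.cyc 2" for m c
    by (rule A.ZS.cyc_scale [OF _ that]) (rule A.const_Z, auto)
  have intB: "(\<lambda>xs p. of_int m * c xs p) \<in> B.ZS.cyc 2" if "c \<in> B.ZS.cyc 2" for m c
    by (rule B.ZS.cyc_scale [OF _ that]) (rule B.const_Z, auto)
  have lin: "HB.lincomb [?e, ?k] n = B.ZS.cls 2 (\<lambda>xs p. of_int (n 0) * pull e xs p + of_int (n 1) * pull k xs p)" for n
    unfolding HB.lincomb_pair [OF eB kB]
    unfolding HZ_def B.ZS.cls_int_pow [OF pull_cyc [OF e]] B.ZS.cls_int_pow [OF pull_cyc [OF k]]
    by (rule B.ZS.cls_add [OF intB [OF pull_cyc [OF e]] intB [OF pull_cyc [OF k]]])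
  obtain n where n: "A.ZS.cls 2 (\<lambda>xs p. k xs p - 2 * z xs p) = HA.lincomb [A.ZS.cls 2 e] n"
    using HA.Z_basisD(2) [OF basisA setA z(3)] by blast
  then have "A.ZS.cls 2 (\<lambda>xs p. k xs p - 2 * z xs p) = A.ZS.cls 2 (\<lambda>xs p. of_int (n 0) * e xs p)"
    unfolding HA.lincomb_single [OF eA] by (simp add: HZ_def A.ZS.cls_int_pow [OF e])
  from pull_cls_cong [OF z(2) intA [OF e] this]
  have kz: "B.ZS.cls 2 (\<lambda>xs p. pull k xs p - 2 * pull z xs p) = B.ZS.cls 2 (\<lambda>xs p. of_int (n 0) * pull e xs p)"
    by (simp add: pull_cochain_def)
  have kzc: "(\<lambda>xs p. pull k xs p - 2 * pull z xs p) \<in> B.ZS.cyc 2"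
    using pull_cyc [OF z(2)] by (simp add: pull_cochain_def)
  have z2: "(\<lambda>xs p. 2 * pull z xs p) \<in> B.ZS.cyc 2"
    using intB [OF pull_cyc [OF z(1)], of 2] by simp
  \<comment> \<open>hence \<open>2 z = k - n h\<close> in \<open>Pic S0\<close>, which is saturated\<close>
  have "B.ZS.cls 2 (\<lambda>xs p. 2 * pull z xs p) =
      HB.lincomb [?e, ?k] (\<lambda>i. if i = 0 then - n 0 else 1)"
  proof -
    have "B.ZS.cls 2 (\<lambda>xs p. of_int (- 1) * (pull k xs p - 2 * pull z xs p) + pull k xs p) =
        B.ZS.cls 2 (\<lambda>xs p. of_int (- 1) * (of_int (n 0) * pull e xs p) + pull k xs p)"
      by (intro B.ZS.cls_add_cong B.ZS.cls_int_cong intB kzc pull_cyc e k kz refl)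
    then show ?thesis
      unfolding lin by simp
  qed
  then have "B.ZS.cls 2 (\<lambda>xs p. 2 * pull z xs p) \<in> Pic S0"
    using HB.Z_basisD(1) [OF basisB setB] by metis
  then have "B.ZS.cls 2 (pull z) \<in> Pic S0"
    by (rule B.Pic_half [OF pull_cyc [OF z(1)]])
  then obtain l where "B.ZS.cls 2 (pull z) = HB.lincomb [?e, ?k] l"
    using HB.Z_basisD(2) [OF basisB setB] by blast
  then have "HB.lincomb [?e, ?k] (\<lambda>i. 2 * l i) = B.ZS.cls 2 (\<lambda>xs p. 2 * pull z xs p)"
    unfolding HB.lincomb_scale [OF setB] using B.ZS.cls_int_pow [OF pull_cyc [OF z(1)], of 2]
    by (simp add: HZ_def)
  also note \<open>\<dots> = HB.lincomb [?e, ?k] (\<lambda>i. if i = 0 then - n 0 else 1)\<close>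
  \<comment> \<open>The coefficient of \<open>k\<close> is compared; it would have to be even and
    equal to 1.\<close>
  finally have "2 * l 1 = 1"
    using HB.Z_basisD(3) [OF basisB setB, of "\<lambda>i. 2 * l i" "\<lambda>i. if i = 0 then - n 0 else 1" 1] by simp
  then show False by presburger
qed

text \<open>Once the class is identified, \<open>2 B\<close> is represented by
  \<open>t = n e + k + 2 z\<close>, and both invariants are found by pairing \<open>t\<close> with
  \<open>e\<close> and with itself. The integers \<open>v\<close> and \<open>y\<close> collect the
  ambiguity from \<open>n\<close> and \<open>z\<close>.\<close>

lemma vanishing_class_invariants:
  fixes d b c :: int
  assumes e: "e \<in> A.ZS.cyc 2" and k: "k \<in> A.ZS.cyc 2"
    and basisA: "Z_basis (HZ S 2) (Pic S) [A.ZS.cls 2 e]"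
    and basisB: "Z_basis (HZ S0 2) (Pic S0) [B.ZS.cls 2 (pull e), B.ZS.cls 2 (pull k)]"
    and ee: "A.pairing e e = of_int (2 * d)" "B.pairing (pull e) (pull e) = of_int (2 * d)" and "d > 0"
    and ek: "B.pairing (pull e) (pull k) = of_int b" and kk: "B.pairing (pull k) (pull k) = of_int (2 * c)"
    and van: "vanishing_Brauer_class S D S0 D0 \<phi> \<alpha>" and B: "B_field S \<alpha> B"
  obtains v y :: int where "inter_Q S D B (Z_to_Q S 2 (A.ZS.cls 2 e)) = of_int b / 2 + of_int v"
    "even (b + d) \<longrightarrow> inter_Q S D B B = of_int c / 2 + of_int y"
proof -
  have ne: "A.pairing e e \<noteq> 0" "B.pairing (pull e) (pull e) = A.pairing e e"
    using ee \<open>d > 0\<close> by simp_all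
  let ?K = "specialization_kernel S D S0 D0 \<phi>" and ?\<alpha> = "A.ucls 2 (exp_cochain (A.half k))"
  interpret HA: comm_group "HZ S 2"
    unfolding HZ_def by (rule A.ZS.comm_group_cohomology)
  interpret HB: comm_group "HZ S0 2"
    unfolding HZ_def by (rule B.ZS.comm_group_cohomology)
  have eA: "A.ZS.cls 2 e \<in> carrier (HZ S 2)" and setB: "set [B.ZS.cls 2 (pull e), B.ZS.cls 2 (pull k)] \<subseteq> carrier (HZ S0 2)"
    unfolding HZ_def using e k by (auto intro: A.ZS.coh_class_carrier B.ZS.coh_class_carrier pull_cyc)
  have "B.ZS.cls 2 (pull k) \<in> Pic S0"
    using HB.Z_basisD(1) [OF basisB setB] HB.lincomb_unit [OF setB, of 1] by simp metis
  then have \<alpha>K: "?\<alpha> \<in> ?K"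
    by (rule half_specialization_kernel [OF e ne k])
  have "B.ZS.cls 2 (pull (\<lambda>xs p. 0)) \<in> Pic S0"
    using B.Pic_iff [OF B.ZS.cyc_zero] by (simp add: pull_cochain_def)
  from half_specialization_kernel [OF e ne A.ZS.cyc_zero this]
  have "A.ucls 2 (exp_cochain (\<lambda>xs p. 0)) \<in> ?K" by simp
  then have oneK: "\<one>\<^bsub>HU S 2\<^esub> \<in> ?K"
    using A.exp_integral_one [OF A.ZS.cyc_zero, of 1] by (simp add: numeral_2_eq_2)
  have nontriv: "?\<alpha> \<noteq> \<one>\<^bsub>HU S 2\<^esub>"
    by (rule half_nontrivial [OF e k basisA basisB])
  have \<alpha>: "\<alpha> = ?\<alpha>"
  proof -
    have card: "card ?K = 2" "\<alpha> \<in> ?K" "\<alpha> \<noteq> \<one>\<^bsub>HU S 2\<^esub>"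
      using van by (simp_all add: vanishing_Brauer_class_def)
    \<comment> \<open>Two distinct known elements exhaust a set of cardinality 2, so the non-trivial
      one is \<open>\<alpha>\<close>.\<close>
    then have "finite ?K" by (intro card_ge_0_finite) simp
    then have "{\<one>\<^bsub>HU S 2\<^esub>, ?\<alpha>} = ?K"
      using card(1) nontriv oneK \<alpha>K by (intro card_subset_eq) auto
    then show ?thesis using card(2,3) by blast
  qed
  from A.B_field_decompose [OF compact k B [unfolded \<alpha>]]
  obtain \<beta> z p where \<beta>: "\<beta> \<in> A.QS.cyc 2" "B = A.QS.cls 2 \<beta>" and z: "z \<in> A.ZS.cyc 2"
    and p: "p \<in> A.ZS.cyc 2" "A.ZS.cls 2 p \<in> Pic S"
    and eq: "A.QS.cls 2 (\<lambda>xs q. 2 * \<beta> xs q) = A.QS.cls 2 (\<lambda>xs q. p xs q + k xs q + 2 * z xs q)" .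
  obtain n' where "A.ZS.cls 2 p = HA.lincomb [A.ZS.cls 2 e] n'"
    using HA.Z_basisD(2) [OF basisA _ p(2)] eA by auto
  then have "A.ZS.cls 2 p = A.ZS.cls 2 e [^]\<^bsub>HZ S 2\<^esub> n' 0"
    using HA.lincomb_single [OF eA] by simp
  then obtain n where n: "A.ZS.cls 2 p = A.ZS.cls 2 (\<lambda>xs q. of_int n * e xs q)"
    using A.ZS.cls_int_pow [OF e] by (metis HZ_def)
  have Q: "e \<in> A.QS.cyc 2" "k \<in> A.QS.cyc 2" "z \<in> A.QS.cyc 2" "p \<in> A.QS.cyc 2"
    using e k z p by (simp_all add: A.ZQ_cyc)
  have neZ: "(\<lambda>xs q. of_int n * e xs q) \<in> A.ZS.cyc 2"
    by (rule A.ZS.cyc_scale [OF _ e]) (rule A.const_Z, auto)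
  note neQ = A.ZQ_cyc [OF neZ] and z2Q = A.QS_cyc_int [OF Q(3), of 2] and b2Q = A.QS_cyc_int [OF \<beta>(1), of 2]
  define s where "s = (\<lambda>xs q. of_int n * e xs q + k xs q)"
  have sQ: "s \<in> A.QS.cyc 2"
    unfolding s_def by (rule A.QS.cyc_add [OF neQ Q(2)])
  define t where "t = (\<lambda>xs q. s xs q + of_int 2 * z xs q)"
  have tQ: "t \<in> A.QS.cyc 2"
    unfolding t_def by (rule A.QS.cyc_add [OF sQ z2Q])
  have "A.QS.cls 2 (\<lambda>xs q. p xs q + k xs q + of_int 2 * z xs q) = A.QS.cls 2 t"
    unfolding t_def s_def
    by (intro A.QS.cls_add_cong A.QS.cyc_add neQ Q z2Q refl A.ZQ_cls_eq [OF p(1) neZ n])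
  with eq have bt: "A.QS.cls 2 (\<lambda>xs q. of_int 2 * \<beta> xs q) = A.QS.cls 2 t"
    by simp
  have t_left: "A.pairing t x = of_int n * A.pairing e x + A.pairing k x + 2 * A.pairing z x" if "x \<in> A.QS.cyc 2" for x
    unfolding t_def s_def A.pairing_add_left [OF sQ [unfolded s_def] z2Q that] A.pairing_add_left [OF neQ Q(2) that]
      A.pairing_int_left [OF Q(1) that] A.pairing_int_left [OF Q(3) that] by simp
  have b_left: "2 * A.pairing \<beta> x = A.pairing t x" if "x \<in> A.QS.cyc 2" for x
    using A.pairing_cong [OF b2Q tQ that that bt refl] A.pairing_int_left [OF \<beta>(1) that, of 2] by simp
  note comm = A.pairing_commute
  have pairing_ek: "A.pairing e k = of_int b" "A.pairing k k = of_int (2 * c)"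
    using pairing_pull [OF e ne e k] pairing_pull [OF e ne k k] ek kk by simp_all
  obtain ez kz zz :: int where ints: "A.pairing e z = of_int ez" "A.pairing k z = of_int kz" "A.pairing z z = of_int zz"
    using A.pairing_Z [OF e z] A.pairing_Z [OF k z] A.pairing_Z [OF z z] by (auto elim!: Ints_cases)
  have be: "A.pairing \<beta> e = of_int b / 2 + of_int (n * d + ez)"
    using b_left [OF Q(1)] t_left [OF Q(1)] pairing_ek ints ee(1) comm [OF Q(2,1)] comm [OF Q(3,1)]
    by (simp add: field_simps)
  \<comment> \<open>Each factor \<open>\<beta>\<close> is doubled and replaced by \<open>t\<close>;
    the square of \<open>t\<close> is then expanded by bilinearity and symmetry.\<close>
  have "4 * A.pairing \<beta> \<beta> = 2 * A.pairing \<beta> t"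
    using b_left [OF \<beta>(1)] comm [OF tQ \<beta>(1)] by simp
  also have "\<dots> = A.pairing t t"
    by (rule b_left [OF tQ])
  also have "\<dots> = of_int n * A.pairing t e + A.pairing t k + 2 * A.pairing t z"
    using t_left [OF tQ] comm [OF Q(1) tQ] comm [OF Q(2) tQ] comm [OF Q(3) tQ] by simp
  also have "\<dots> = of_int (2 * n * (n * d + b) + 2 * c + 4 * (n * ez + kz + zz))"
    using t_left [OF Q(1)] t_left [OF Q(2)] t_left [OF Q(3)] pairing_ek ints ee(1)
      comm [OF Q(2,1)] comm [OF Q(3,1)] comm [OF Q(3,2)]
    by (simp add: algebra_simps)
  finally have bb: "4 * A.pairing \<beta> \<beta> = of_int (2 * n * (n * d + b) + 2 * c + 4 * (n * ez + kz + zz))" .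
  have bbe: "\<exists>y :: int. A.pairing \<beta> \<beta> = of_int c / 2 + of_int y" if "even (b + d)"
  proof -
    \<comment> \<open>For odd \<open>n\<close> the second factor has the parity of
      \<open>b + d\<close>. This is where the condition on the first invariant is used.\<close>
    have "even (n * (n * d + b))"
      using that by auto
    then obtain m where m: "n * (n * d + b) = 2 * m" ..
    have "4 * A.pairing \<beta> \<beta> = of_int (2 * (n * (n * d + b)) + 2 * c + 4 * (n * ez + kz + zz))"
      unfolding bb by (simp add: mult.assoc)
    then have "A.pairing \<beta> \<beta> = of_int c / 2 + of_int (m + (n * ez + kz + zz))"
      unfolding m by simp
    then show ?thesis by blast
  qed
  then obtain y :: int where y: "even (b + d) \<Longrightarrow> A.pairing \<beta> \<beta> = of_int c / 2 + of_int y"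
    by blast
  show ?thesis
  proof (rule that)
    show "inter_Q S D B (Z_to_Q S 2 (A.ZS.cls 2 e)) = of_int b / 2 + of_int (n * d + ez)"
      using be by (simp add: \<beta>(2) A.Z_to_Q_cls [OF e] A.inter_Q_cls [OF \<beta>(1) Q(1)])
    show "even (b + d) \<longrightarrow> inter_Q S D B B = of_int c / 2 + of_int y"
      using y by (simp add: \<beta>(2) A.inter_Q_cls [OF \<beta>(1) \<beta>(1)])
  qed
qed

end

section \<open>Fibres of a family: structure sheaf and topological identification\<close>

lemma complex_space_fibre:
  assumes "complex_manifold n (fibre X \<pi> s)"
  shows "complex_space (fibre X \<pi> s) n"
proof
  have hol_iff: "f \<in> hol (fibre X \<pi> s) W \<longleftrightarrow>
      (\<forall>p\<in>W. \<exists>U u. openin (topol X) U \<and> p \<in> U \<and> u \<in> hol X U \<and> (\<forall>q\<in>U \<inter> W. f q = u q))" for f W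
    by (simp add: fibre_def)
  show "f \<in> hol (fibre X \<pi> s) V" if f: "f \<in> hol (fibre X \<pi> s) W" and VW: "V \<subseteq> W" for f V W
    unfolding hol_iff
  proof
    fix p assume "p \<in> V"
    then obtain U u where "openin (topol X) U" "p \<in> U" "u \<in> hol X U" "\<forall>q\<in>U \<inter> W. f q = u q"
      using f VW unfolding hol_iff by blast
    then show "\<exists>U u. openin (topol X) U \<and> p \<in> U \<and> u \<in> hol X U \<and> (\<forall>q\<in>U \<inter> V. f q = u q)"
      using VW by blast
  qed
  show "g \<in> hol (fibre X \<pi> s) W" if f: "f \<in> hol (fibre X \<pi> s) W" and fg: "\<And>p. p \<in> W \<Longrightarrow> f p = g p" for f g W
    unfolding hol_iff
  proof
    fix p assume "p \<in> W"
    then obtain U u where "openin (topol X) U" "p \<in> U" "u \<in> hol X U" "\<forall>q\<in>U \<inter> W. f q = u q"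
      using f unfolding hol_iff by blast
    then show "\<exists>U u. openin (topol X) U \<and> p \<in> U \<and> u \<in> hol X U \<and> (\<forall>q\<in>U \<inter> W. g q = u q)"
      using fg by (metis IntD2)
  qed
qed (fact assms)

text \<open>The left inverse is the inverse of the trivialization followed by projection to the
  central fibre.\<close>

lemma trivialization_fibre_maps:
  assumes triv: "trivialization X \<pi> r \<Phi>" and t: "t \<in> ball 0 r"
  obtains \<psi> where "continuous_map (topol (fibre X \<pi> 0)) (topol (fibre X \<pi> t)) (\<lambda>y. \<Phi> (y, t))"
    "continuous_map (topol (fibre X \<pi> t)) (topol (fibre X \<pi> 0)) \<psi>"
    "\<And>y. y \<in> topspace (topol (fibre X \<pi> 0)) \<Longrightarrow> \<psi> (\<Phi> (y, t)) = y"
proof -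
  let ?S0 = "topol (fibre X \<pi> 0)" and ?B = "top_of_set (ball 0 r)"
  have hom: "homeomorphic_map (prod_topology ?S0 ?B) (topol X) \<Phi>"
    using triv by (simp add: trivialization_def)
  then obtain \<Psi> where \<Psi>: "homeomorphic_maps (prod_topology ?S0 ?B) (topol X) \<Phi> \<Psi>"
    unfolding homeomorphic_map_maps by blast
  then have cont: "continuous_map (prod_topology ?S0 ?B) (topol X) \<Phi>"
    "continuous_map (topol X) (prod_topology ?S0 ?B) \<Psi>"
    and inv: "\<And>z. z \<in> topspace (prod_topology ?S0 ?B) \<Longrightarrow> \<Psi> (\<Phi> z) = z"
    by (auto simp: homeomorphic_maps_def)
  have pi: "\<pi> (\<Phi> (y, t)) = t" if "y \<in> topspace ?S0" for y
    using triv that t by (simp add: trivialization_def)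
  have "continuous_map ?S0 (prod_topology ?S0 ?B) (\<lambda>y. (y, t))"
    using t by (intro continuous_map_pairedI continuous_map_id [unfolded id_def] continuous_map_const [THEN iffD2]) auto
  then have "continuous_map ?S0 (topol X) (\<lambda>y. \<Phi> (y, t))"
    using continuous_map_compose [OF _ cont(1)] by (simp add: o_def)
  then have "continuous_map ?S0 (topol (fibre X \<pi> t)) (\<lambda>y. \<Phi> (y, t))"
    using pi by (auto simp: fibre_def continuous_map_in_subtopology)
  moreover have "continuous_map (topol (fibre X \<pi> t)) ?S0 (fst \<circ> \<Psi>)"
  proof (rule continuous_map_compose)
    show "continuous_map (topol (fibre X \<pi> t)) (prod_topology ?S0 ?B) \<Psi>"
      using cont(2) by (auto simp: fibre_def intro: continuous_map_from_subtopology)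
  qed (rule continuous_map_fst)
  moreover have "(fst \<circ> \<Psi>) (\<Phi> (y, t)) = y" if "y \<in> topspace ?S0" for y
    using inv [of "(y, t)"] that t by simp
  ultimately show ?thesis by (rule that)
qed

theorem corollary2p1p3:
  fixes S S0 :: "'p cspace" and h k \<alpha>_van :: "'p cclass"
    and D D0 :: "'p cclass \<Rightarrow> rat" and \<phi> :: "'p \<Rightarrow> 'p" and d b c :: int
  assumes "K3_surface S" and "polarization S h" and "degree_map S D"
    and "Z_basis (HZ S 2) (Pic S) [h]"
    and "inter_Z S D h h = of_int (2 * d)" and "d > 0"
    and "specialization S h S0 \<phi>" and "degree_map S0 D0"
    and "primitive (HZ S0 2) k"
    and "Z_basis (HZ S0 2) (Pic S0) [pull_Z S0 2 \<phi> h, k]"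
    and "inter_Z S0 D0 (pull_Z S0 2 \<phi> h) (pull_Z S0 2 \<phi> h) = of_int (2 * d)"
    and "inter_Z S0 D0 (pull_Z S0 2 \<phi> h) k = of_int b"
    and "inter_Z S0 D0 k k = of_int (2 * c)"
    and "vanishing_Brauer_class S D S0 D0 \<phi> \<alpha>_van"
  shows "\<forall>B_van. B_field S \<alpha>_van B_van \<longrightarrow>
    (let h_Q = Z_to_Q S 2 h in
      rat_cong (inter_Q S D B_van h_Q) (of_int b / 2) 1 \<and>
      (rat_cong (4 * inter_Q S D B_van h_Q + inter_Q S D h_Q h_Q) 0 4 \<longrightarrow>
         rat_cong (inter_Q S D B_van B_van) (of_int c / 2) 1) \<and>
      rat_cong (2 * inter_Q S D B_van h_Q)
        (lattice_disc (HZ S0 2) (Pic S0) (inter_Z S0 D0)) 2)"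
proof (intro allI impI)
  fix B assume B: "B_field S \<alpha>_van B"
  obtain X \<pi> r L \<Phi> t where fam: "quasi_polarized_family X \<pi> r L" and triv: "trivialization X \<pi> r \<Phi>"
    and t: "t \<in> ball 0 r" and S0: "S0 = fibre X \<pi> 0" and S: "S = fibre X \<pi> t" and \<phi>: "\<phi> = (\<lambda>y. \<Phi> (y, t))"
    using assms(7) unfolding specialization_def by blast
  obtain \<psi> where \<psi>: "continuous_map (topol S0) (topol S) \<phi>" "continuous_map (topol S) (topol S0) \<psi>"
    "\<And>y. y \<in> topspace (topol S0) \<Longrightarrow> \<psi> (\<phi> y) = y"
    using trivialization_fibre_maps [OF triv t] unfolding S S0 \<phi> by blast
  have "0 \<in> ball (0 :: complex) r"
    using t by (simp add: le_less_trans [OF norm_ge_zero])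
  then have "K3_surface S0"
    using fam unfolding quasi_polarized_family_def S0 by blast
  then have mani: "complex_manifold TYPE(2) S" "complex_manifold TYPE(2) S0"
    using assms(1) unfolding K3_surface_def by blast+
  interpret specialization_pair S S0 "TYPE(2)" D D0 \<phi> \<psi>
  proof (intro specialization_pair.intro degree_space.intro degree_space_axioms.intro
      specialization_pair_axioms.intro assms(3,8) \<psi>)
    show "complex_space S TYPE(2)" "complex_space S0 TYPE(2)"
      unfolding S S0 by (rule complex_space_fibre, rule mani [unfolded S S0])+
    show "compact_space (topol S)"
      using assms(1) by (simp add: K3_surface_def)
  qed
  have "h \<in> carrier (HZ S 2)"
    using assms(2) by (auto simp: polarization_def chern_class_def)
  then obtain e where e: "e \<in> A.ZS.cyc 2" "h = A.ZS.cls 2 e"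
    unfolding HZ_def by (rule A.ZS.cohomologyE)
  have kc: "k \<in> carrier (HZ S0 2)"
    using assms(9) by (simp add: primitive_def)
  then obtain k0 where k0: "k0 \<in> B.ZS.cyc 2" "k = B.ZS.cls 2 k0"
    unfolding HZ_def by (rule B.ZS.cohomologyE)
  obtain k' where k': "k' \<in> A.ZS.cyc 2" "B.ZS.cls 2 (pull k') = B.ZS.cls 2 k0"
    using pull_surj [OF k0(1)] .
  have k: "k = B.ZS.cls 2 (pull k')"
    using k0 k' by simp
  have h0: "pull_Z S0 2 \<phi> h = B.ZS.cls 2 (pull e)"
    using e by (simp add: pull_Z_cls)
  have h0c: "pull_Z S0 2 \<phi> h \<in> carrier (HZ S0 2)"
    unfolding h0 HZ_def using pull_cyc [OF e(1)] by (rule B.ZS.coh_class_carrier)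
  note pe = pull_cyc [OF e(1)] and pk = pull_cyc [OF k'(1)]
  have pairing: "A.pairing e e = of_int (2 * d)" "B.pairing (pull e) (pull e) = of_int (2 * d)"
    "B.pairing (pull e) (pull k') = of_int b" "B.pairing (pull k') (pull k') = of_int (2 * c)"
    using assms(5,11-13) unfolding h0 k unfolding e(2) A.inter_Z_cls [OF e(1) e(1)] B.inter_Z_cls [OF pe pe]
      B.inter_Z_cls [OF pe pk] B.inter_Z_cls [OF pk pk] by simp_all
  have basisA: "Z_basis (HZ S 2) (Pic S) [A.ZS.cls 2 e]"
    using assms(4) by (simp only: e(2))
  have basisB: "Z_basis (HZ S0 2) (Pic S0) [B.ZS.cls 2 (pull e), B.ZS.cls 2 (pull k')]"
    using assms(10) by (simp only: h0 k)
  from vanishing_class_invariants [OF e(1) k'(1) basisA basisB pairing(1,2) assms(6) pairing(3,4) assms(14) B]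
  obtain v y :: int where vy: "inter_Q S D B (Z_to_Q S 2 h) = of_int b / 2 + of_int v"
    "even (b + d) \<longrightarrow> inter_Q S D B B = of_int c / 2 + of_int y"
    unfolding e(2) [symmetric] .
  \<comment> \<open>The other off-diagonal entry of the Gram matrix, by symmetry of the
    pairing.\<close>
  have "inter_Z S0 D0 k (pull_Z S0 2 \<phi> h) = of_int b"
    using assms(12) B.pairing_commute [OF B.ZQ_cyc [OF pe] B.ZQ_cyc [OF pk]]
    unfolding h0 k B.inter_Z_cls [OF pe pk] B.inter_Z_cls [OF pk pe] by simp
  then have disc: "lattice_disc (HZ S0 2) (Pic S0) (inter_Z S0 D0) = of_int (4 * d * c - b * b)"
    using B.lattice_disc_rank_2 [OF h0c kc assms(10)] assms(11-13) by simp
  have hh: "inter_Q S D (Z_to_Q S 2 h) (Z_to_Q S 2 h) = of_int (2 * d)"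
    using assms(5) by (simp add: inter_Z_def)
  have "rat_cong (inter_Q S D B B) (of_int c / 2) 1"
    if cong: "rat_cong (4 * inter_Q S D B (Z_to_Q S 2 h) + inter_Q S D (Z_to_Q S 2 h) (Z_to_Q S 2 h)) 0 4"
  proof -
    \<comment> \<open>The condition reads \<open>2 b + 4 v + 2 d = 0 mod 4\<close>, that is,
      \<open>b + d\<close> is even.\<close>
    obtain m where "4 * (of_int b / 2 + of_int v) + of_int (2 * d) = (4 * of_int m :: rat)"
      using cong unfolding rat_cong_def vy(1) hh by auto
    then have "of_int (2 * b + 4 * v + 2 * d) = (of_int (4 * m) :: rat)"
      by simp
    then have "2 * b + 4 * v + 2 * d = 4 * m"
      by (simp only: of_int_eq_iff)
    then have "even (b + d)" by presburger
    then show ?thesis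
      using vy(2) by (auto simp: rat_cong_def)
  qed
  moreover have "rat_cong (2 * inter_Q S D B (Z_to_Q S 2 h))
      (lattice_disc (HZ S0 2) (Pic S0) (inter_Z S0 D0)) 2"
  proof -
    \<comment> \<open>Modulo 2 the discriminant \<open>4 d c - b^2\<close> is \<open>b^2\<close> and
      twice the first invariant is \<open>b\<close>; these have equal parity.\<close>
    have "even (b + b * b)" by simp
    then obtain m where m: "b + b * b = 2 * m" ..
    have "2 * inter_Q S D B (Z_to_Q S 2 h) - of_int (4 * d * c - b * b) =
        of_int (b + b * b + 2 * v - 4 * d * c)"
      by (simp add: vy(1))
    also have "\<dots> = 2 * of_int (m + v - 2 * d * c)"
      unfolding m by simp
    finally show ?thesis
      unfolding disc rat_cong_def by blast
  qed
  moreover have "rat_cong (inter_Q S D B (Z_to_Q S 2 h)) (of_int b / 2) 1"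
    by (auto simp: rat_cong_def vy(1))
  ultimately show "let h_Q = Z_to_Q S 2 h in
      rat_cong (inter_Q S D B h_Q) (of_int b / 2) 1 \<and>
      (rat_cong (4 * inter_Q S D B h_Q + inter_Q S D h_Q h_Q) 0 4 \<longrightarrow>
         rat_cong (inter_Q S D B B) (of_int c / 2) 1) \<and>
      rat_cong (2 * inter_Q S D B h_Q)
        (lattice_disc (HZ S0 2) (Pic S0) (inter_Z S0 D0)) 2"
    by (simp add: Let_def)
qed

end
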